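(* Let $d\ge1$, let $\Omega\subset\mathbb{R}^d$ be an arbitrary (bounded or unbounded) domain, $T>0$, $I=(0,T)$, $\Xi=I\times\Omega$. Let $f\in L^2(\Xi)$ and $u_0\in\mathring{H}^1(\Omega)$. Let $(u,p)\in \mathring{H}^{1;1}(\Xi)\times D(\Xi)$ be the exact solution of the time-dependent reaction-diffusion problem $$-\nabla u+p=0\ \text{ in }\Xi,\qquad \partial_\circ u-\operatorname{div}p+u=f\ \text{ in }\Xi,\qquad u(0,\cdot)=u_0\ \text{ in }\Omega,$$ and let $(\tilde u,\tilde p)\in \mathring{H}^{1;1}(\Xi)\times D(\Xi)$ be an arbitrary approximation. Then $$\|u-\tilde u\|_{H^{0;1}(\Xi)}^2+\|p-\tilde p\|_{L^2(\Xi)}^2+\|\partial_\circ(u-\tilde u)+\operatorname{div}(\tilde p-p)\|_{L^2(\Xi)}^2+\|(u-\tilde u)(T,\cdot)\|_{L^2(\Omega)}^2$$ $$=\|f-\partial_\circ\tilde u-\tilde u+\operatorname{div}\tilde p\|_{L^2(\Xi)}^2+\|\tilde p-\nabla\tilde u\|_{L^2(\Xi)}^2+\|u_0-\tilde u(0,\cdot)\|_{L^2(\Omega)}^2 .$$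
   Context: All functions and vector fields are real valued; $L^2$ is used for both scalar functions and $\mathbb{R}^d$-valued vector fields; derivatives are weak. $\nabla$ and $\operatorname{div}$ are the spatial gradient and divergence (with respect to the variable in $\Omega$), $\partial_\circ$ is the derivative with respect to time. $\mathring{H}^1(\Omega)$ is the closure in $H^1(\Omega)$ of the smooth functions with compact support in $\Omega$. $H^{0;1}(\Xi)=\{\varphi\in L^2(\Xi):\nabla\varphi\in L^2(\Xi)\}$ with $\|\varphi\|_{H^{0;1}(\Xi)}^2=\|\varphi\|_{L^2(\Xi)}^2+\|\nabla\varphi\|_{L^2(\Xi)}^2$. $\mathring{H}^{0;1}(\Xi)=\{\varphi\in H^{0;1}(\Xi):\varphi(t,\cdot)\in\mathring{H}^1(\Omega)\text{ for a.e. }t\in I\}$. $H^{1;0}(\Xi)=\{\varphi\in L^2(\Xi):\partial_\circ\varphi\in L^2(\Xi)\}$. $\mathring{H}^{1;1}(\Xi)=\mathring{H}^{0;1}(\Xi)\cap H^{1;0}(\Xi)$. $D(\Xi)=\{\phi\in L^2(\Xi):\operatorname{div}\phi\in L^2(\Xi)\}$ (vector fields with values in $\mathbb{R}^d$). For $\varphi\in H^{1;0}(\Xi)$, $\varphi(0,\cdot),\varphi(T,\cdot)\in L^2(\Omega)$ are the values at times $0$ and $T$ of the representative that is continuous in time with values in $L^2(\Omega)$. The stated problem is uniquely solvable. *)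

theory Defs
  imports "HOL-Analysis.Analysis"
begin

text \<open>
  Elements of the Lebesgue and Sobolev spaces below are functions on the whole type, regarded as
  representatives: only their values almost everywhere on the set in question matter.
\<close>

subsection \<open>Square-integrable functions\<close>

definition L2 :: "'a::euclidean_space set \<Rightarrow> ('a \<Rightarrow> 'b::euclidean_space) set" where
  "L2 S = {f. f \<in> borel_measurable (lebesgue_on S) \<and>
              integrable (lebesgue_on S) (\<lambda>x. (norm (f x))\<^sup>2)}"

definition L2_norm_on :: "'a::euclidean_space set \<Rightarrow> ('a \<Rightarrow> 'b::euclidean_space) \<Rightarrow> real" where
  "L2_norm_on S f = sqrt (LINT x|lebesgue_on S. (norm (f x))\<^sup>2)"

subsection \<open>Test functions\<close>

definition dir_deriv :: "'a::euclidean_space \<Rightarrow> ('a \<Rightarrow> real) \<Rightarrow> 'a \<Rightarrow> real" where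
  "dir_deriv v f x = frechet_derivative f (at x) v"

primrec Ck :: "nat \<Rightarrow> ('a::euclidean_space \<Rightarrow> real) \<Rightarrow> bool" where
  "Ck 0 f \<longleftrightarrow> continuous_on UNIV f"
| "Ck (Suc k) f \<longleftrightarrow> (\<forall>x. f differentiable (at x)) \<and> (\<forall>b\<in>Basis. Ck k (dir_deriv b f))"

text \<open>Smooth functions with compact support in \<open>S\<close>, extended by zero to the whole space.\<close>

definition test_fun :: "'a::euclidean_space set \<Rightarrow> ('a \<Rightarrow> real) set" where
  "test_fun S = {\<phi>. (\<forall>k. Ck k \<phi>) \<and> compact (closure {x. \<phi> x \<noteq> 0}) \<and> closure {x. \<phi> x \<noteq> 0} \<subseteq> S}"

subsection \<open>Weak derivatives\<close>

definition has_weak_dir_deriv ::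
    "'a::euclidean_space set \<Rightarrow> 'a \<Rightarrow> ('a \<Rightarrow> real) \<Rightarrow> ('a \<Rightarrow> real) \<Rightarrow> bool" where
  "has_weak_dir_deriv S v f g \<longleftrightarrow>
     (\<forall>\<phi>\<in>test_fun S. (LINT x|lebesgue_on S. f x * dir_deriv v \<phi> x)
                     = - (LINT x|lebesgue_on S. g x * \<phi> x))"

text \<open>
  The relations below characterise a weak derivative; the operators that follow select a
  representative of it, which is unique up to null sets and meaningful whenever the weak
  derivative exists in \<open>L2\<close>. On the space-time cylinder a point is \<open>(t, x)\<close>, and the
  gradient and divergence only involve the directions \<open>(0, axis i 1)\<close>.
\<close>

definition has_weak_grad ::
    "(real^'n) set \<Rightarrow> (real^'n \<Rightarrow> real) \<Rightarrow> (real^'n \<Rightarrow> real^'n) \<Rightarrow> bool" where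
  "has_weak_grad \<Omega> f G \<longleftrightarrow> (\<forall>i. has_weak_dir_deriv \<Omega> (axis i 1) f (\<lambda>x. G x $ i))"

definition has_weak_space_grad ::
    "(real \<times> (real^'n)) set \<Rightarrow> (real \<times> (real^'n) \<Rightarrow> real) \<Rightarrow> (real \<times> (real^'n) \<Rightarrow> real^'n) \<Rightarrow> bool" where
  "has_weak_space_grad \<Xi> f G \<longleftrightarrow> (\<forall>i. has_weak_dir_deriv \<Xi> (0, axis i 1) f (\<lambda>z. G z $ i))"

definition has_weak_time_deriv ::
    "(real \<times> (real^'n)) set \<Rightarrow> (real \<times> (real^'n) \<Rightarrow> real) \<Rightarrow> (real \<times> (real^'n) \<Rightarrow> real) \<Rightarrow> bool" where
  "has_weak_time_deriv \<Xi> f g \<longleftrightarrow> has_weak_dir_deriv \<Xi> (1, 0) f g"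

definition has_weak_space_div ::
    "(real \<times> (real^'n)) set \<Rightarrow> (real \<times> (real^'n) \<Rightarrow> real^'n) \<Rightarrow> (real \<times> (real^'n) \<Rightarrow> real) \<Rightarrow> bool" where
  "has_weak_space_div \<Xi> F g \<longleftrightarrow>
     (\<forall>\<phi>\<in>test_fun \<Xi>. (LINT z|lebesgue_on \<Xi>. (\<Sum>i\<in>UNIV. F z $ i * dir_deriv (0, axis i 1) \<phi> z))
                     = - (LINT z|lebesgue_on \<Xi>. g z * \<phi> z))"

definition weak_grad :: "(real^'n) set \<Rightarrow> (real^'n \<Rightarrow> real) \<Rightarrow> real^'n \<Rightarrow> real^'n" where
  "weak_grad \<Omega> f = (SOME G. G \<in> L2 \<Omega> \<and> has_weak_grad \<Omega> f G)"

definition space_grad ::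
    "(real \<times> (real^'n)) set \<Rightarrow> (real \<times> (real^'n) \<Rightarrow> real) \<Rightarrow> real \<times> (real^'n) \<Rightarrow> real^'n" where
  "space_grad \<Xi> f = (SOME G. G \<in> L2 \<Xi> \<and> has_weak_space_grad \<Xi> f G)"

definition time_deriv ::
    "(real \<times> (real^'n)) set \<Rightarrow> (real \<times> (real^'n) \<Rightarrow> real) \<Rightarrow> real \<times> (real^'n) \<Rightarrow> real" where
  "time_deriv \<Xi> f = (SOME g. g \<in> L2 \<Xi> \<and> has_weak_time_deriv \<Xi> f g)"

definition space_div ::
    "(real \<times> (real^'n)) set \<Rightarrow> (real \<times> (real^'n) \<Rightarrow> real^'n) \<Rightarrow> real \<times> (real^'n) \<Rightarrow> real" where
  "space_div \<Xi> F = (SOME g. g \<in> L2 \<Xi> \<and> has_weak_space_div \<Xi> F g)"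

subsection \<open>Sobolev spaces on the spatial domain\<close>

definition H1 :: "(real^'n) set \<Rightarrow> (real^'n \<Rightarrow> real) set" where
  "H1 \<Omega> = {f \<in> L2 \<Omega>. \<exists>G \<in> L2 \<Omega>. has_weak_grad \<Omega> f G}"

definition H1_norm :: "(real^'n) set \<Rightarrow> (real^'n \<Rightarrow> real) \<Rightarrow> real" where
  "H1_norm \<Omega> f = sqrt ((L2_norm_on \<Omega> f)\<^sup>2 + (L2_norm_on \<Omega> (weak_grad \<Omega> f))\<^sup>2)"

definition H1_ring :: "(real^'n) set \<Rightarrow> (real^'n \<Rightarrow> real) set" where
  "H1_ring \<Omega> = {f \<in> H1 \<Omega>. \<forall>\<epsilon>>0. \<exists>\<psi>\<in>test_fun \<Omega>. H1_norm \<Omega> (\<lambda>x. f x - \<psi> x) < \<epsilon>}"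

subsection \<open>Spaces on the space-time cylinder\<close>

definition cyl :: "real \<Rightarrow> (real^'n) set \<Rightarrow> (real \<times> (real^'n)) set" where
  "cyl T \<Omega> = {0<..<T} \<times> \<Omega>"

definition H01 :: "(real \<times> (real^'n)) set \<Rightarrow> (real \<times> (real^'n) \<Rightarrow> real) set" where
  "H01 \<Xi> = {f \<in> L2 \<Xi>. \<exists>G \<in> L2 \<Xi>. has_weak_space_grad \<Xi> f G}"

definition H01_norm :: "(real \<times> (real^'n)) set \<Rightarrow> (real \<times> (real^'n) \<Rightarrow> real) \<Rightarrow> real" where
  "H01_norm \<Xi> f = sqrt ((L2_norm_on \<Xi> f)\<^sup>2 + (L2_norm_on \<Xi> (space_grad \<Xi> f))\<^sup>2)"

definition H01_ring :: "real \<Rightarrow> (real^'n) set \<Rightarrow> (real \<times> (real^'n) \<Rightarrow> real) set" where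
  "H01_ring T \<Omega> = {f \<in> H01 (cyl T \<Omega>).
      AE t in lebesgue_on {0<..<T}. (\<lambda>x. f (t, x)) \<in> H1_ring \<Omega>}"

definition H10 :: "(real \<times> (real^'n)) set \<Rightarrow> (real \<times> (real^'n) \<Rightarrow> real) set" where
  "H10 \<Xi> = {f \<in> L2 \<Xi>. \<exists>g \<in> L2 \<Xi>. has_weak_time_deriv \<Xi> f g}"

definition H11_ring :: "real \<Rightarrow> (real^'n) set \<Rightarrow> (real \<times> (real^'n) \<Rightarrow> real) set" where
  "H11_ring T \<Omega> = H01_ring T \<Omega> \<inter> H10 (cyl T \<Omega>)"

definition Ddiv :: "(real \<times> (real^'n)) set \<Rightarrow> (real \<times> (real^'n) \<Rightarrow> real^'n) set" where
  "Ddiv \<Xi> = {F \<in> L2 \<Xi>. \<exists>g \<in> L2 \<Xi>. has_weak_space_div \<Xi> F g}"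

subsection \<open>Values at fixed times\<close>

text \<open>
  \<open>\<Phi>\<close> is a representative of \<open>f\<close> that is a continuous map from the closed interval
  \<open>{0..T}\<close> into \<open>L2 \<Omega>\<close>. The end points are included, so that \<open>time_value T \<Omega> f t\<close>
  is determined up to null sets for every \<open>t\<close> in \<open>{0..T}\<close>.
\<close>

definition cont_time_rep ::
    "real \<Rightarrow> (real^'n) set \<Rightarrow> (real \<times> (real^'n) \<Rightarrow> real) \<Rightarrow> (real \<Rightarrow> real^'n \<Rightarrow> real) \<Rightarrow> bool" where
  "cont_time_rep T \<Omega> f \<Phi> \<longleftrightarrow>
     (\<forall>t\<in>{0..T}. \<Phi> t \<in> L2 \<Omega>) \<and>
     (\<forall>t\<in>{0..T}. ((\<lambda>s. L2_norm_on \<Omega> (\<lambda>x. \<Phi> s x - \<Phi> t x)) \<longlongrightarrow> 0) (at t within {0..T})) \<and>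
     (AE t in lebesgue_on {0<..<T}. AE x in lebesgue_on \<Omega>. \<Phi> t x = f (t, x))"

definition time_value ::
    "real \<Rightarrow> (real^'n) set \<Rightarrow> (real \<times> (real^'n) \<Rightarrow> real) \<Rightarrow> real \<Rightarrow> real^'n \<Rightarrow> real" where
  "time_value T \<Omega> f = (SOME \<Phi>. cont_time_rep T \<Omega> f \<Phi>)"

subsection \<open>The reaction-diffusion problem\<close>

definition exact_solution ::
    "real \<Rightarrow> (real^'n) set \<Rightarrow> (real \<times> (real^'n) \<Rightarrow> real) \<Rightarrow> (real^'n \<Rightarrow> real)
      \<Rightarrow> (real \<times> (real^'n) \<Rightarrow> real) \<Rightarrow> (real \<times> (real^'n) \<Rightarrow> real^'n) \<Rightarrow> bool" where
  "exact_solution T \<Omega> f u\<^sub>0 u p \<longleftrightarrow>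
     u \<in> H11_ring T \<Omega> \<and> p \<in> Ddiv (cyl T \<Omega>) \<and>
     (AE z in lebesgue_on (cyl T \<Omega>). - space_grad (cyl T \<Omega>) u z + p z = 0) \<and>
     (AE z in lebesgue_on (cyl T \<Omega>).
        time_deriv (cyl T \<Omega>) u z - space_div (cyl T \<Omega>) p z + u z = f z) \<and>
     (AE x in lebesgue_on \<Omega>. time_value T \<Omega> u 0 x = u\<^sub>0 x)"

end

theory Submission
  imports Defs
begin

text \<open>
  Write \<open>w = u - u'\<close>, \<open>r = p - p'\<close>, \<open>s = \<nabla>w\<close>, \<open>d = div r\<close> and \<open>a = \<partial>\<^sub>t w - d\<close>. The equations satisfied by \<open>(u, p)\<close> turn
  the computable residuals on the right-hand side into errors: \<open>f - \<partial>\<^sub>t u' - u' + div p' = a + w\<close>,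
  \<open>p' - \<nabla>u' = s - r\<close> and \<open>u\<^sub>0 - u'(0) = w(0)\<close>. Expanding the squares, the identity reduces to the cancellation
  of the cross terms,

    \<open>2 \<langle>\<partial>\<^sub>t w, w\<rangle> - 2 \<langle>d, w\<rangle> - 2 \<langle>r, s\<rangle> = \<parallel>w(T)\<parallel>\<^sup>2 - \<parallel>w(0)\<parallel>\<^sup>2\<close>.

  This combines two facts: the energy identity \<open>2 \<langle>\<partial>\<^sub>t w, w\<rangle> = \<parallel>w(T)\<parallel>\<^sup>2 - \<parallel>w(0)\<parallel>\<^sup>2\<close> (\<open>time_value_energy\<close>),
  and Green's formula \<open>\<langle>d, w\<rangle> + \<langle>r, \<nabla>w\<rangle> = 0\<close> without boundary terms (\<open>Green_cylinder\<close>).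

  For the energy identity, \<open>continuous_time_representative\<close> shows that \<open>w\<close> agrees almost everywhere with
  \<open>W(t, x) = C(x) + \<integral>\<^sub>0\<^sup>t g(s, x) ds\<close>, where \<open>g = \<partial>\<^sub>t w\<close> weakly. Such a \<open>W\<close> is continuous in time with values in \<open>L\<^sup>2\<close>, and for
  fixed \<open>x\<close> the formula \<open>W(T)\<^sup>2 - W(0)\<^sup>2 = 2 \<integral> W g\<close> is an application of Fubini's theorem on a triangle. Continuous
  representatives are unique, so the values selected by \<open>time_value\<close> are those of \<open>W\<close>.

  For Green's formula, freeze the time. For almost every \<open>t\<close> the slice \<open>w(t, \<cdot>)\<close> is an \<open>H\<^sup>1\<close>-limit of test functions,
  so the formula on \<open>\<Omega>\<close> follows from the definition of the weak divergence (\<open>Green_spatial\<close>), with no regularity of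
  the boundary. The delicate point is that \<open>div r\<close> and \<open>\<nabla>w\<close> must be weak derivatives of the slices for almost every
  \<open>t\<close>. Testing with a product \<open>\<eta>(t) \<psi>(x)\<close> gives this for each \<open>\<psi>\<close> outside a null set of times that depends on
  \<open>\<psi>\<close>; since the space of test functions is separable in a sufficiently strong sense (\<open>countable_pointwise_dense\<close>), a
  single null set suffices (\<open>AE_slice_orthogonal\<close>).

  Underneath lies the uniqueness of weak derivatives, that is, the fundamental lemma of the calculus of variations
  (\<open>AE_zero_on_open\<close>), which is proved from explicit smooth bumps.
\<close>

section \<open>Calculus of test functions\<close>

lemma dir_deriv_eq:
  assumes "(f has_derivative f') (at x)"
  shows "dir_deriv v f x = f' v"
  using frechet_derivative_at[OF assms] by (simp add: dir_deriv_def)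

lemma has_derivative_frechet:
  assumes "f differentiable (at x)"
  shows "(f has_derivative (\<lambda>v. dir_deriv v f x)) (at x)"
  using assms unfolding dir_deriv_def by (simp add: frechet_derivative_works)

lemma Ck_SucD: "Ck (Suc k) f \<Longrightarrow> Ck k f"
proof (induction k arbitrary: f)
  case 0
  then have "f differentiable (at x)" for x by simp
  then have "continuous_on UNIV f"
    by (simp add: continuous_at_imp_continuous_on differentiable_imp_continuous_within)
  then show ?case by simp
next
  case (Suc k)
  then show ?case by (metis Ck.simps(2))
qed

lemma Ck_zero: "Ck k (\<lambda>x. 0)"
proof (induction k)
  case (Suc k)
  have "dir_deriv b (\<lambda>x. 0) = (\<lambda>x. 0)" for b :: 'a
    by (rule ext, rule dir_deriv_eq) (auto intro!: derivative_eq_intros)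
  with Suc show ?case by simp
qed simp

lemma Ck_const: "Ck k (\<lambda>x. c)"
proof (cases k)
  case (Suc j)
  have "dir_deriv b (\<lambda>x. c) = (\<lambda>x. 0)" for b :: 'a
    by (rule ext, rule dir_deriv_eq) (auto intro!: derivative_eq_intros)
  with Suc show ?thesis by (simp add: Ck_zero)
qed simp

lemma dir_deriv_add:
  assumes "f differentiable (at x)" "g differentiable (at x)"
  shows "dir_deriv v (\<lambda>x. f x + g x) x = dir_deriv v f x + dir_deriv v g x"
  by (rule dir_deriv_eq) (intro has_derivative_add has_derivative_frechet assms)

lemma dir_deriv_mult:
  assumes "f differentiable (at x)" "g differentiable (at x)"
  shows "dir_deriv v (\<lambda>x. f x * g x) x = f x * dir_deriv v g x + dir_deriv v f x * g x"
  using has_derivative_mult[OF assms[THEN has_derivative_frechet]] by (rule dir_deriv_eq)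

lemma Ck_add: "Ck k f \<Longrightarrow> Ck k g \<Longrightarrow> Ck k (\<lambda>x. f x + g x)"
proof (induction k arbitrary: f g)
  case 0
  then show ?case by (simp add: continuous_on_add)
next
  case (Suc k)
  have "dir_deriv b (\<lambda>x. f x + g x) = (\<lambda>x. dir_deriv b f x + dir_deriv b g x)" for b
    using Suc.prems by (auto simp: dir_deriv_add)
  with Suc show ?case by (auto intro!: differentiable_add)
qed

lemma Ck_mult: "Ck k f \<Longrightarrow> Ck k g \<Longrightarrow> Ck k (\<lambda>x. f x * g x)"
proof (induction k arbitrary: f g)
  case 0
  then show ?case by (simp add: continuous_on_mult)
next
  case (Suc k)
  have *: "dir_deriv b (\<lambda>x. f x * g x) = (\<lambda>x. f x * dir_deriv b g x + dir_deriv b f x * g x)" for b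
    using Suc.prems by (auto simp: dir_deriv_mult)
  have "Ck k f" "Ck k g" using Suc.prems Ck_SucD by blast+
  with Suc show ?case by (auto simp: * intro!: differentiable_mult Ck_add)
qed

lemma Ck_sum: "(\<And>i. i \<in> A \<Longrightarrow> Ck k (f i)) \<Longrightarrow> Ck k (\<lambda>x. \<Sum>i\<in>A. f i x)"
proof (induction A rule: infinite_finite_induct)
  case (insert a A)
  then show ?case by (simp add: Ck_add)
qed (simp_all add: Ck_zero)

lemma Ck_prod: "(\<And>i. i \<in> A \<Longrightarrow> Ck k (f i)) \<Longrightarrow> Ck k (\<lambda>x. \<Prod>i\<in>A. f i x)"
proof (induction A rule: infinite_finite_induct)
  case (insert a A)
  then show ?case by (simp add: Ck_mult)
qed (simp_all add: Ck_const)

text \<open>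
  \<open>Ck\<close> speaks of the coordinate directions only; this reduces all other directions to them.
\<close>

lemma dir_deriv_linear:
  assumes "f differentiable (at x)"
  shows "dir_deriv v f x = (\<Sum>b\<in>Basis. (v \<bullet> b) * dir_deriv b f x)"
proof -
  interpret bounded_linear "\<lambda>v. dir_deriv v f x"
    using has_derivative_frechet[OF assms] by (rule has_derivative_bounded_linear)
  have "dir_deriv v f x = dir_deriv (\<Sum>b\<in>Basis. (v \<bullet> b) *\<^sub>R b) f x"
    by (simp add: euclidean_representation)
  also have "\<dots> = (\<Sum>b\<in>Basis. (v \<bullet> b) * dir_deriv b f x)"
    by (simp add: sum scale)
  finally show ?thesis .
qed

lemma has_derivative_affine_comp:
  fixes L :: "'a::euclidean_space \<Rightarrow> 'b::euclidean_space"
  assumes L: "bounded_linear L" and f: "\<And>y. f differentiable (at y)"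
  shows "((\<lambda>x. f (c + L x)) has_derivative (\<lambda>v. dir_deriv (L v) f (c + L x))) (at x)"
proof -
  have "((\<lambda>x. c + L x) has_derivative L) (at x)"
    by (auto intro!: derivative_eq_intros bounded_linear.has_derivative[OF L])
  from diff_chain_at[OF this has_derivative_frechet[OF f]]
  show ?thesis by (simp add: o_def)
qed

lemma Ck_affine_comp:
  fixes L :: "'a::euclidean_space \<Rightarrow> 'b::euclidean_space"
  assumes L: "bounded_linear L"
  shows "Ck k f \<Longrightarrow> Ck k (\<lambda>x. f (c + L x))"
proof (induction k arbitrary: f)
  case 0
  then have "continuous_on UNIV (f \<circ> (\<lambda>x. c + L x))"
    by (intro continuous_on_compose continuous_intros linear_continuous_on[OF L])
       (auto intro: continuous_on_subset)
  then show ?case by (simp add: o_def)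
next
  case (Suc k)
  then have d: "f differentiable (at y)" for y by simp
  have "dir_deriv v (\<lambda>x. f (c + L x)) = (\<lambda>x. \<Sum>b\<in>Basis. (L v \<bullet> b) * dir_deriv b f (c + L x))" for v
    by (rule ext) (simp add: dir_deriv_eq[OF has_derivative_affine_comp[OF L d]] dir_deriv_linear[OF d, of "L v"])
  moreover have "(\<lambda>x. f (c + L x)) differentiable (at x)" for x
    using has_derivative_affine_comp[OF L d] by (auto simp: differentiable_def)
  ultimately show ?case
    using Suc by (auto intro!: Ck_sum Ck_mult Ck_const)
qed

lemma zero_outside_support: "x \<notin> closure {x. f x \<noteq> 0} \<Longrightarrow> f x = 0"
  using closure_subset[of "{x. f x \<noteq> 0}"] by auto

lemma test_funD:
  assumes "\<phi> \<in> test_fun S"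
  shows "Ck k \<phi>" "compact (closure {x. \<phi> x \<noteq> 0})" "closure {x. \<phi> x \<noteq> 0} \<subseteq> S"
    and "\<phi> differentiable (at x)" "continuous_on UNIV \<phi>" "x \<notin> S \<Longrightarrow> \<phi> x = 0"
proof -
  show c: "Ck k \<phi>" "compact (closure {x. \<phi> x \<noteq> 0})" "closure {x. \<phi> x \<noteq> 0} \<subseteq> S" for k
    using assms by (auto simp: test_fun_def)
  show "\<phi> differentiable (at x)" using c(1)[of 1] by simp
  show "continuous_on UNIV \<phi>" using c(1)[of 0] by simp
  show "x \<notin> S \<Longrightarrow> \<phi> x = 0" using c(3) zero_outside_support[of x \<phi>] by auto
qed

text \<open>
  Any compact set that contains the support may serve as a witness in place of the closed support itself.
\<close>

lemma test_funI:
  assumes "\<And>k. Ck k \<phi>" "compact K" "K \<subseteq> S" "\<And>x. x \<notin> K \<Longrightarrow> \<phi> x = 0"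
  shows "\<phi> \<in> test_fun S"
proof -
  have "closure {x. \<phi> x \<noteq> 0} \<subseteq> K"
    using assms(2,4) by (intro closure_minimal) (auto intro: compact_imp_closed)
  then show ?thesis
    using assms compact_Int_closed[OF assms(2) closed_closure, of "{x. \<phi> x \<noteq> 0}"]
    by (auto simp: test_fun_def Int_absorb1)
qed

lemma dir_deriv_zero_outside:
  assumes "x \<notin> closure {x. \<phi> x \<noteq> 0}"
  shows "dir_deriv v \<phi> x = 0"
proof -
  have "((\<lambda>x. 0) has_derivative (\<lambda>v. 0)) (at x)" by simp
  then have "(\<phi> has_derivative (\<lambda>v. 0)) (at x)"
  proof (rule has_derivative_transform_within_open)
    show "open (- closure {x. \<phi> x \<noteq> 0})" by (simp add: open_Compl)
    show "0 = \<phi> x" if "x \<in> - closure {x. \<phi> x \<noteq> 0}" for x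
      using that zero_outside_support[of x \<phi>] by simp
  qed (use assms in auto)
  then show ?thesis by (rule dir_deriv_eq)
qed

lemma test_fun_dir_deriv:
  assumes "\<phi> \<in> test_fun S"
  shows "dir_deriv v \<phi> \<in> test_fun S"
proof (rule test_funI[of _ "closure {x. \<phi> x \<noteq> 0}"])
  have eq: "dir_deriv v \<phi> = (\<lambda>x. \<Sum>b\<in>Basis. (v \<bullet> b) * dir_deriv b \<phi> x)"
    by (rule ext) (rule dir_deriv_linear, rule test_funD[OF assms])
  show "Ck k (dir_deriv v \<phi>)" for k
    unfolding eq using test_funD(1)[OF assms, of "Suc k"] by (auto intro!: Ck_sum Ck_mult Ck_const)
qed (fact test_funD(2,3)[OF assms] | erule dir_deriv_zero_outside)+

lemma test_fun_bounded:
  assumes "\<phi> \<in> test_fun S"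
  obtains B where "B > 0" "\<And>x. \<bar>\<phi> x\<bar> \<le> B"
proof -
  let ?K = "closure {x. \<phi> x \<noteq> 0}"
  have "compact (\<phi> ` ?K)"
    using test_funD[OF assms] by (intro compact_continuous_image) (auto intro: continuous_on_subset)
  then obtain B where B: "B > 0" "\<And>y. y \<in> \<phi> ` ?K \<Longrightarrow> norm y \<le> B"
    by (meson compact_imp_bounded bounded_pos)
  have "\<bar>\<phi> x\<bar> \<le> B" for x
    using B zero_outside_support[of x \<phi>] by (cases "x \<in> ?K") auto
  with B that show ?thesis by blast
qed

lemma test_fun_borel [measurable_dest]:
  "\<phi> \<in> test_fun S \<Longrightarrow> \<phi> \<in> borel_measurable borel"
  by (intro borel_measurable_continuous_onI test_funD)

lemma test_fun_support_cbox:
  fixes S :: "'a::euclidean_space set"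
  assumes "\<phi> \<in> test_fun S"
  obtains a b :: 'a where "\<And>x. x \<notin> cbox a b \<Longrightarrow> \<phi> x = 0"
proof -
  have "bounded (closure {x. \<phi> x \<noteq> 0})" using test_funD(2)[OF assms] compact_imp_bounded by blast
  then obtain a where "closure {x. \<phi> x \<noteq> 0} \<subseteq> cbox (-a) a"
    using bounded_subset_cbox_symmetric by blast
  then show ?thesis by (intro that[of "-a" a] zero_outside_support) blast
qed

lemma test_fun_square_integrable:
  fixes S :: "'a::euclidean_space set"
  assumes "\<phi> \<in> test_fun S"
  shows "integrable lborel (\<lambda>x. (\<phi> x)\<^sup>2)" "integrable lborel \<phi>"
proof -
  have i: "integrable lborel f" if c: "continuous_on UNIV f" and z: "\<And>x. x \<notin> cbox a b \<Longrightarrow> f x = 0"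
    for f :: "'a \<Rightarrow> real" and a b :: 'a
  proof -
    have "integrable lborel (\<lambda>x. indicator (cbox a b) x *\<^sub>R f x :: real)"
      by (rule borel_integrable_compact) (auto intro: continuous_on_subset[OF c])
    also have "(\<lambda>x. indicator (cbox a b) x *\<^sub>R f x) = f"
      by (rule ext) (auto simp: indicator_def z)
    finally show ?thesis .
  qed
  obtain a b where ab: "\<And>x. x \<notin> cbox a b \<Longrightarrow> \<phi> x = 0" using test_fun_support_cbox[OF assms] by blast
  show "integrable lborel (\<lambda>x. (\<phi> x)\<^sup>2)"
    by (rule i[of _ a b]) (auto simp: ab intro!: continuous_intros test_funD[OF assms])
  show "integrable lborel \<phi>"
    by (rule i[of _ a b]) (auto simp: ab intro!: continuous_intros test_funD[OF assms])
qed

text \<open>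
  The derivatives of \<open>t \<mapsto> exp (-1/t)\<close> (extended by zero to \<open>t \<le> 0\<close>) are combinations of the
  functions \<open>t\<^sup>-\<^sup>m exp (-1/t)\<close>. The span of this family is closed under differentiation, which
  makes smoothness a plain induction over the order.
\<close>

definition flat_exp :: "nat \<Rightarrow> real \<Rightarrow> real" where
  "flat_exp m t = (if t > 0 then exp (- 1 / t) / t ^ m else 0)"

lemma flat_exp_tendsto_0: "((\<lambda>t. exp (- 1 / t) / t ^ m) \<longlongrightarrow> 0) (at_right (0::real))"
proof -
  have "((\<lambda>s::real. s ^ m / exp s) \<longlongrightarrow> 0) at_top" by (rule tendsto_power_div_exp_0)
  then have "((\<lambda>t::real. inverse t ^ m / exp (inverse t)) \<longlongrightarrow> 0) (at_right 0)"
    by (rule filterlim_compose[OF _ filterlim_inverse_at_top_right])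
  then show ?thesis
    by (simp add: exp_minus field_simps power_inverse)
qed

lemma flat_exp_has_derivative:
  "(flat_exp m has_real_derivative (flat_exp (m + 2) t - real m * flat_exp (m + 1) t)) (at t)"
proof (cases t "0::real" rule: linorder_cases)
  case greater
  have m: "real m * t ^ (m - Suc 0) = real m * t ^ m / t"
    using greater by (cases m) auto
  have "((\<lambda>t. exp (- 1 / t) / t ^ m) has_real_derivative
        (exp (- 1 / t) * (1 / t\<^sup>2) * t ^ m - exp (- 1 / t) * (real m * t ^ (m - Suc 0))) / (t ^ m * t ^ m)) (at t)"
    using greater by (auto intro!: derivative_eq_intros simp: power2_eq_square)
  also have "(exp (- 1 / t) * (1 / t\<^sup>2) * t ^ m - exp (- 1 / t) * (real m * t ^ (m - Suc 0))) / (t ^ m * t ^ m)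
      = flat_exp (m + 2) t - real m * flat_exp (m + 1) t"
    unfolding m using greater by (simp add: flat_exp_def field_simps power2_eq_square)
  finally have "((\<lambda>t. exp (- 1 / t) / t ^ m) has_real_derivative
        (flat_exp (m + 2) t - real m * flat_exp (m + 1) t)) (at t)" .
  then show ?thesis
    by (rule has_field_derivative_transform_within_open[where S="{0<..}"])
       (use greater in \<open>auto simp: flat_exp_def\<close>)
next
  case less
  have "((\<lambda>t. 0) has_real_derivative (flat_exp (m + 2) t - real m * flat_exp (m + 1) t)) (at t)"
    using less by (auto simp: flat_exp_def)
  then show ?thesis
    by (rule has_field_derivative_transform_within_open[where S="{..<0}"])
       (use less in \<open>auto simp: flat_exp_def\<close>)
next
  case equal
  have "((\<lambda>t. (flat_exp m t - flat_exp m 0) / (t - 0)) \<longlongrightarrow> 0) (at_right 0)"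
  proof (rule Lim_transform_eventually)
    show "((\<lambda>t. exp (- 1 / t) / t ^ (Suc m)) \<longlongrightarrow> 0) (at_right (0::real))"
      by (rule flat_exp_tendsto_0)
    show "\<forall>\<^sub>F t in at_right 0. exp (- 1 / t) / t ^ (Suc m) = (flat_exp m t - flat_exp m 0) / (t - 0)"
      by (rule eventually_at_rightI[of 0 1]) (auto simp: flat_exp_def)
  qed
  moreover have "((\<lambda>t. (flat_exp m t - flat_exp m 0) / (t - 0)) \<longlongrightarrow> 0) (at_left 0)"
  proof (rule Lim_transform_eventually)
    show "((\<lambda>t. 0) \<longlongrightarrow> (0::real)) (at_left (0::real))" by simp
    show "\<forall>\<^sub>F t in at_left 0. 0 = (flat_exp m t - flat_exp m 0) / (t - 0)"
      by (rule eventually_at_leftI[of "-1" 0]) (auto simp: flat_exp_def)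
  qed
  ultimately have "((\<lambda>t. (flat_exp m t - flat_exp m 0) / (t - 0)) \<longlongrightarrow> 0) (at 0)"
    by (simp add: filterlim_split_at)
  then show ?thesis
    using equal by (simp add: has_field_derivative_iff flat_exp_def)
qed

lemma dir_deriv_real:
  assumes "(f has_real_derivative D) (at t)"
  shows "dir_deriv v f t = D * v"
  using dir_deriv_eq[OF assms[unfolded has_field_derivative_def]] by simp

lemma Ck_flat_exp: "Ck k (flat_exp m)"
proof (induction k arbitrary: m)
  case 0
  show ?case
    by (auto intro!: continuous_at_imp_continuous_on DERIV_isCont flat_exp_has_derivative)
next
  case (Suc k)
  have "flat_exp m differentiable (at t)" for t
    using flat_exp_has_derivative by (auto simp: differentiable_def has_field_derivative_def)
  moreover have "dir_deriv 1 (flat_exp m) = (\<lambda>t. flat_exp (m + 2) t + (- real m) * flat_exp (m + 1) t)"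
    by (rule ext) (simp add: dir_deriv_real[OF flat_exp_has_derivative])
  moreover have "Ck k (\<lambda>t. flat_exp (m + 2) t + (- real m) * flat_exp (m + 1) t)"
    by (intro Ck_add Ck_mult Ck_const Suc)
  ultimately show ?case by simp
qed

text \<open>
  Bumps that increase to the indicator function of an open box: the parameter \<open>k\<close> steepens each factor,
  since \<open>exp (-1/(k s)) \<longlongrightarrow> 1\<close> for every \<open>s > 0\<close>. The bump of a box in a product space is the product of
  the bumps of the two factors.
\<close>

definition box_bump :: "'a::euclidean_space \<Rightarrow> 'a \<Rightarrow> nat \<Rightarrow> 'a \<Rightarrow> real" where
  "box_bump a c k x = (\<Prod>b\<in>Basis. flat_exp 0 (k * (x \<bullet> b - a \<bullet> b)) * flat_exp 0 (k * (c \<bullet> b - x \<bullet> b)))"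

lemma flat_exp_0_bounds: "0 \<le> flat_exp 0 t" "flat_exp 0 t \<le> 1"
  by (auto simp: flat_exp_def)

lemma box_bump_bounds: "0 \<le> box_bump a c k x" "box_bump a c k x \<le> 1"
  unfolding box_bump_def
  by (auto intro!: prod_nonneg prod_le_1 mult_le_one simp: flat_exp_0_bounds)

lemma box_bump_zero:
  assumes "x \<notin> box a c"
  shows "box_bump a c k x = 0"
proof -
  obtain b where "b \<in> Basis" "x \<bullet> b \<le> a \<bullet> b \<or> c \<bullet> b \<le> x \<bullet> b"
    using assms by (force simp: mem_box)
  then have "flat_exp 0 (k * (x \<bullet> b - a \<bullet> b)) * flat_exp 0 (k * (c \<bullet> b - x \<bullet> b)) = 0"
    by (auto simp: flat_exp_def zero_less_mult_iff)
  then show ?thesis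
    unfolding box_bump_def using \<open>b \<in> Basis\<close> by (auto intro!: prod_zero)
qed

lemma box_bump_tendsto: "(\<lambda>k. box_bump a c k x) \<longlonglongrightarrow> indicator (box a c) x"
proof (cases "x \<in> box a c")
  case True
  have e: "(\<lambda>k. flat_exp 0 (real k * s)) \<longlonglongrightarrow> 1" if "s > 0" for s
  proof -
    have "(\<lambda>k. exp (- (inverse s) * (1 / real k))) \<longlonglongrightarrow> exp (- (inverse s) * 0)"
      by (intro tendsto_intros lim_1_over_n)
    moreover have "\<forall>\<^sub>F k in sequentially. exp (- (inverse s) * (1 / real k)) = flat_exp 0 (real k * s)"
      using eventually_gt_at_top[of 0]
      by eventually_elim (use that in \<open>auto simp: flat_exp_def field_simps\<close>)
    ultimately show ?thesis by (simp add: tendsto_cong)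
  qed
  have "(\<lambda>k. box_bump a c k x) \<longlonglongrightarrow> (\<Prod>b\<in>(Basis::'a set). 1 * 1)"
    unfolding box_bump_def using True by (intro tendsto_prod tendsto_mult e) (auto simp: mem_box)
  then show ?thesis using True by simp
qed (simp add: box_bump_zero)

lemma Ck_box_bump: "Ck k (box_bump a c m)"
proof -
  have "Ck k (\<lambda>x. flat_exp 0 (- real m * (a \<bullet> b) + real m * (x \<bullet> b)))" for b :: 'a
    by (rule Ck_affine_comp[OF _ Ck_flat_exp]) (intro bounded_linear_intros)
  moreover have "Ck k (\<lambda>x. flat_exp 0 (real m * (c \<bullet> b) + - real m * (x \<bullet> b)))" for b :: 'a
    by (rule Ck_affine_comp[OF _ Ck_flat_exp]) (intro bounded_linear_intros)
  ultimately have "Ck k (\<lambda>x. \<Prod>b\<in>(Basis::'a set). flat_exp 0 (- real m * (a \<bullet> b) + real m * (x \<bullet> b)) *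
      flat_exp 0 (real m * (c \<bullet> b) + - real m * (x \<bullet> b)))"
    by (intro Ck_prod Ck_mult)
  then show ?thesis unfolding box_bump_def[abs_def] by (simp add: algebra_simps)
qed

lemma test_fun_box_bump:
  assumes "cbox a c \<subseteq> S"
  shows "box_bump a c k \<in> test_fun S"
  using box_subset_cbox[of a c]
  by (intro test_funI[OF Ck_box_bump compact_cbox assms]) (auto intro: box_bump_zero)

text \<open>
  Products \<open>\<eta>(t) \<psi>(x)\<close> separate the time direction from the spatial ones, and they are rich enough for the fundamental
  lemma of the calculus of variations.
\<close>

lemma test_fun_times:
  assumes "\<eta> \<in> test_fun A" "\<psi> \<in> test_fun B"
  shows "(\<lambda>z. \<eta> (fst z) * \<psi> (snd z)) \<in> test_fun (A \<times> B)"
proof (rule test_funI[of _ "closure {x. \<eta> x \<noteq> 0} \<times> closure {x. \<psi> x \<noteq> 0}"])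
  let ?K = "closure {x. \<eta> x \<noteq> 0} \<times> closure {x. \<psi> x \<noteq> 0}"
  show "compact ?K" "?K \<subseteq> A \<times> B" using test_funD[OF assms(1)] test_funD[OF assms(2)]
    by (auto intro: compact_Times)
  show "\<eta> (fst z) * \<psi> (snd z) = 0" if "z \<notin> ?K" for z
    using that zero_outside_support[of "fst z" \<eta>] zero_outside_support[of "snd z" \<psi>]
    by (cases z) auto
  show "Ck k (\<lambda>z. \<eta> (fst z) * \<psi> (snd z))" for k
    using Ck_affine_comp[OF bounded_linear_fst test_funD(1)[OF assms(1), of k], of 0]
      Ck_affine_comp[OF bounded_linear_snd test_funD(1)[OF assms(2), of k], of 0]
    by (intro Ck_mult) auto
qed

lemma dir_deriv_times:
  assumes "\<eta> \<in> test_fun A" "\<psi> \<in> test_fun B"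
  shows "dir_deriv (r, v) (\<lambda>z. \<eta> (fst z) * \<psi> (snd z)) z
    = \<eta> (fst z) * dir_deriv v \<psi> (snd z) + dir_deriv r \<eta> (fst z) * \<psi> (snd z)"
proof (rule dir_deriv_eq[THEN trans])
  have "((\<lambda>z. \<eta> (fst z)) has_derivative (\<lambda>v. dir_deriv (fst v) \<eta> (fst z))) (at z)"
    using has_derivative_affine_comp[OF bounded_linear_fst test_funD(4)[OF assms(1)], of 0] by simp
  moreover have "((\<lambda>z. \<psi> (snd z)) has_derivative (\<lambda>v. dir_deriv (snd v) \<psi> (snd z))) (at z)"
    using has_derivative_affine_comp[OF bounded_linear_snd test_funD(4)[OF assms(2)], of 0] by simp
  ultimately show "((\<lambda>z. \<eta> (fst z) * \<psi> (snd z)) has_derivative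
     (\<lambda>v. \<eta> (fst z) * dir_deriv (snd v) \<psi> (snd z) + dir_deriv (fst v) \<eta> (fst z) * \<psi> (snd z))) (at z)"
    by (rule has_derivative_mult)
qed simp

lemma dir_deriv_0 [simp]: "\<eta> \<in> test_fun A \<Longrightarrow> dir_deriv 0 \<eta> x = 0"
  by (subst dir_deriv_linear) (auto intro: test_funD)


section \<open>Square-integrable functions\<close>

lemma integrable_mult_L2:
  fixes f g :: "'a \<Rightarrow> real"
  assumes [measurable]: "f \<in> borel_measurable M" "g \<in> borel_measurable M"
    and f: "integrable M (\<lambda>x. (f x)\<^sup>2)" and g: "integrable M (\<lambda>x. (g x)\<^sup>2)"
  shows "integrable M (\<lambda>x. f x * g x)"
proof (rule Bochner_Integration.integrable_bound[OF Bochner_Integration.integrable_add[OF f g]])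
  show "AE x in M. norm (f x * g x) \<le> norm ((f x)\<^sup>2 + (g x)\<^sup>2)"
  proof (rule AE_I2)
    fix x
    have "2 * (\<bar>f x\<bar> * \<bar>g x\<bar>) \<le> (f x)\<^sup>2 + (g x)\<^sup>2" "0 \<le> \<bar>f x\<bar> * \<bar>g x\<bar>"
      using sum_squares_bound[of "\<bar>f x\<bar>" "\<bar>g x\<bar>"] by (auto simp: mult.assoc)
    then show "norm (f x * g x) \<le> norm ((f x)\<^sup>2 + (g x)\<^sup>2)"
      unfolding real_norm_def abs_mult by linarith
  qed
qed simp

lemma norm_add_sq_le: "(norm (a + b))\<^sup>2 \<le> 2 * (norm a)\<^sup>2 + 2 * (norm b)\<^sup>2"
proof -
  have "(norm (a + b))\<^sup>2 \<le> (norm a + norm b)\<^sup>2"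
    by (intro power_mono norm_triangle_ineq) auto
  also have "\<dots> \<le> 2 * (norm a)\<^sup>2 + 2 * (norm b)\<^sup>2"
    using sum_squares_bound[of "norm a" "norm b"] by (simp add: power2_sum)
  finally show ?thesis .
qed

lemma integrable_add_L2:
  fixes f g :: "'a \<Rightarrow> 'b::euclidean_space"
  assumes [measurable]: "f \<in> borel_measurable M" "g \<in> borel_measurable M"
    and f: "integrable M (\<lambda>x. (norm (f x))\<^sup>2)" and g: "integrable M (\<lambda>x. (norm (g x))\<^sup>2)"
  shows "integrable M (\<lambda>x. (norm (f x + g x))\<^sup>2)"
proof (rule Bochner_Integration.integrable_bound)
  show "integrable M (\<lambda>x. 2 * (norm (f x))\<^sup>2 + 2 * (norm (g x))\<^sup>2)"
    using f g by simp
  show "AE x in M. norm ((norm (f x + g x))\<^sup>2) \<le> norm (2 * (norm (f x))\<^sup>2 + 2 * (norm (g x))\<^sup>2)"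
    by (rule AE_I2) (simp add: norm_add_sq_le)
qed simp

text \<open>
  With \<open>b = \<integral> f g\<close> and \<open>c = \<integral> g\<^sup>2\<close>, the integral of \<open>(f - (b / c) g)\<^sup>2\<close> is nonnegative; if \<open>c = 0\<close>, then
  \<open>g\<close> vanishes almost everywhere.
\<close>

lemma Cauchy_Schwarz_integral:
  fixes f g :: "'a \<Rightarrow> real"
  assumes [measurable]: "f \<in> borel_measurable M" "g \<in> borel_measurable M"
    and f: "integrable M (\<lambda>x. (f x)\<^sup>2)" and g: "integrable M (\<lambda>x. (g x)\<^sup>2)"
  shows "(LINT x|M. f x * g x)\<^sup>2 \<le> (LINT x|M. (f x)\<^sup>2) * (LINT x|M. (g x)\<^sup>2)"
proof -
  define b c where "b = (LINT x|M. f x * g x)" and "c = (LINT x|M. (g x)\<^sup>2)"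
  have fg: "integrable M (\<lambda>x. f x * g x)" by (intro integrable_mult_L2 assms)
  have "c \<ge> 0" unfolding c_def by (rule integral_nonneg_AE) simp
  show ?thesis
  proof (cases "c = 0")
    case True
    then have "AE x in M. (g x)\<^sup>2 = 0"
      using integral_nonneg_eq_0_iff_AE[OF g] by (simp add: c_def)
    then have "b = (LINT x|M. 0)" unfolding b_def by (intro integral_cong_AE) auto
    then show ?thesis using True by (simp add: b_def c_def)
  next
    case False
    have "0 \<le> (LINT x|M. (f x - b / c * g x)\<^sup>2)" by (rule integral_nonneg_AE) simp
    also have "(\<lambda>x. (f x - b / c * g x)\<^sup>2) = (\<lambda>x. (f x)\<^sup>2 - 2 * (b / c) * (f x * g x) + (b / c)\<^sup>2 * (g x)\<^sup>2)"
      by (rule ext) (simp add: power2_eq_square algebra_simps add_divide_distrib diff_divide_distrib)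
    also have "integral\<^sup>L M \<dots> = (LINT x|M. (f x)\<^sup>2) - 2 * (b / c) * b + (b / c)\<^sup>2 * c"
      using f g fg by (simp add: b_def c_def)
    also have "\<dots> = (LINT x|M. (f x)\<^sup>2) - b\<^sup>2 / c"
      using False by (simp add: field_simps power2_eq_square)
    finally have "b\<^sup>2 / c \<le> (LINT x|M. (f x)\<^sup>2)" by simp
    then have "b\<^sup>2 \<le> (LINT x|M. (f x)\<^sup>2) * c"
      using False \<open>c \<ge> 0\<close> by (simp add: pos_divide_le_eq)
    then show ?thesis by (simp add: b_def c_def)
  qed
qed

lemma L2D:
  assumes "f \<in> L2 S"
  shows "f \<in> borel_measurable (lebesgue_on S)" "integrable (lebesgue_on S) (\<lambda>x. (norm (f x))\<^sup>2)"
  using assms by (auto simp: L2_def)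

lemma L2_add: "f \<in> L2 S \<Longrightarrow> g \<in> L2 S \<Longrightarrow> (\<lambda>x. f x + g x) \<in> L2 S"
  unfolding L2_def by (auto intro: integrable_add_L2)

lemma L2_scaleR: "f \<in> L2 S \<Longrightarrow> (\<lambda>x. c *\<^sub>R f x) \<in> L2 S"
  unfolding L2_def by (auto simp: power_mult_distrib)

lemma L2_diff: "f \<in> L2 S \<Longrightarrow> g \<in> L2 S \<Longrightarrow> (\<lambda>x. f x - g x) \<in> L2 S"
  using L2_add[of f S "\<lambda>x. (-1) *\<^sub>R g x"] L2_scaleR[of g S "-1"] by simp

lemma L2_inner: "f \<in> L2 S \<Longrightarrow> (\<lambda>x. f x \<bullet> b) \<in> L2 S"
  unfolding L2_def
proof (safe, goal_cases)
  case 2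
  note [measurable] = 2(1)
  show ?case
  proof (rule Bochner_Integration.integrable_bound)
    show "integrable (lebesgue_on S) (\<lambda>x. (norm b)\<^sup>2 * (norm (f x))\<^sup>2)" using 2 by simp
    show "AE x in lebesgue_on S. norm ((norm (f x \<bullet> b))\<^sup>2) \<le> norm ((norm b)\<^sup>2 * (norm (f x))\<^sup>2)"
      using Cauchy_Schwarz_ineq2[of "f _" b]
      by (auto simp: power_mult_distrib[symmetric] mult.commute intro!: power2_mono)
  qed measurable
qed auto

lemma L2_component:
  fixes f :: "'a::euclidean_space \<Rightarrow> real^'n"
  shows "f \<in> L2 S \<Longrightarrow> (\<lambda>x. f x $ i) \<in> L2 S"
  using L2_inner[of f S "axis i 1"] by (simp add: inner_axis)

lemma L2_norm_on_sq: "(L2_norm_on S f)\<^sup>2 = (LINT x|lebesgue_on S. (norm (f x))\<^sup>2)"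
  unfolding L2_norm_on_def by (simp add: integral_nonneg_AE)

lemma L2_integrable_mult:
  fixes f g :: "_ \<Rightarrow> real"
  assumes "f \<in> L2 S" "g \<in> L2 S"
  shows "integrable (lebesgue_on S) (\<lambda>x. f x * g x)"
  using L2D[OF assms(1)] L2D[OF assms(2)] by (intro integrable_mult_L2) auto

text \<open>
  Elements of \<open>L2 S\<close> are only Lebesgue measurable, and the product of two completed measures is not complete. Borel
  representatives that vanish outside \<open>S\<close> live on \<open>lborel\<close>, which on a product space is the product of the two Lebesgue-Borel
  measures; there Fubini's theorem applies, and slices of such representatives are again measurable.
\<close>

definition borel_rep :: "'a::euclidean_space set \<Rightarrow> ('a \<Rightarrow> 'b::euclidean_space) \<Rightarrow> ('a \<Rightarrow> 'b) \<Rightarrow> bool" where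
  "borel_rep S f f0 \<longleftrightarrow> f0 \<in> borel_measurable borel \<and> (\<forall>x. x \<notin> S \<longrightarrow> f0 x = 0) \<and>
     integrable lborel (\<lambda>x. (norm (f0 x))\<^sup>2) \<and> (AE x in lborel. x \<in> S \<longrightarrow> f x = f0 x)"

lemma borel_repD:
  assumes "borel_rep S f f0"
  shows "f0 \<in> borel_measurable borel" "x \<notin> S \<Longrightarrow> f0 x = 0" "integrable lborel (\<lambda>x. (norm (f0 x))\<^sup>2)"
    "AE x in lborel. x \<in> S \<longrightarrow> f x = f0 x"
  using assms by (auto simp: borel_rep_def)

lemma AE_lebesgue_on_open:
  assumes "open S"
  shows "(AE x in lebesgue_on S. P x) \<longleftrightarrow> (AE x in lborel. x \<in> S \<longrightarrow> P x)"
  using assms by (simp add: AE_restrict_space_iff AE_completion_iff)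

lemma integral_lebesgue_on_rep:
  fixes h h0 :: "'a::euclidean_space \<Rightarrow> real"
  assumes S: "open S" and h: "h \<in> borel_measurable (lebesgue_on S)"
    and h0: "h0 \<in> borel_measurable borel" "\<And>x. x \<notin> S \<Longrightarrow> h0 x = 0"
    and eq: "AE x in lborel. x \<in> S \<longrightarrow> h x = h0 x"
  shows "(LINT x|lebesgue_on S. h x) = (LBINT x. h0 x)"
    and "integrable (lebesgue_on S) h \<longleftrightarrow> integrable lborel h0"
proof -
  have [measurable]: "h0 \<in> borel_measurable lebesgue"
    using h0(1) by (auto intro: measurable_completion)
  have [measurable]: "(\<lambda>x. indicator S x * h x) \<in> borel_measurable lebesgue"
    using h S borel_measurable_restrict_space_iff[of S lebesgue h] by simp
  have ae: "AE x in lebesgue. indicator S x *\<^sub>R h x = h0 x"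
    using eq unfolding AE_completion_iff by eventually_elim (auto simp: h0(2) indicator_def)
  show "(LINT x|lebesgue_on S. h x) = (LBINT x. h0 x)"
  proof -
    have "(LINT x|lebesgue_on S. h x) = (LINT x|lebesgue. indicator S x *\<^sub>R h x)"
      using S by (simp add: integral_restrict_space)
    also have "\<dots> = (LINT x|lebesgue. h0 x)" by (rule integral_cong_AE) (use ae in auto)
    finally show ?thesis using h0(1) by (simp add: integral_completion)
  qed
  have "integrable (lebesgue_on S) h \<longleftrightarrow> integrable lebesgue (\<lambda>x. indicator S x *\<^sub>R h x)"
    using S by (simp add: integrable_restrict_space)
  also have "\<dots> \<longleftrightarrow> integrable lebesgue h0" by (rule integrable_cong_AE) (use ae in auto)
  finally show "integrable (lebesgue_on S) h \<longleftrightarrow> integrable lborel h0"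
    using h0(1) by (simp add: integrable_completion)
qed

lemma borel_rep_exists_real:
  fixes f :: "'a::euclidean_space \<Rightarrow> real"
  assumes S: "open S" and f: "f \<in> borel_measurable (lebesgue_on S)"
  obtains f0 where "f0 \<in> borel_measurable borel" "\<And>x. x \<notin> S \<Longrightarrow> f0 x = 0"
    "AE x in lborel. x \<in> S \<longrightarrow> f x = f0 x"
proof -
  have [measurable]: "S \<in> sets borel" using S by simp
  have "(\<lambda>x. if x \<in> S then f x else 0) \<in> borel_measurable lebesgue"
    using S f by (intro borel_measurable_if_I) auto
  then obtain g where [measurable]: "g \<in> borel_measurable lborel"
    and g: "AE x in lborel. (if x \<in> S then f x else 0) = g x"
    using completion_ex_borel_measurable_real by blast
  show ?thesis
  proof (rule that[of "\<lambda>x. indicator S x * g x"])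
    show "AE x in lborel. x \<in> S \<longrightarrow> f x = indicator S x * g x"
      using g by eventually_elim auto
  qed auto
qed

lemma borel_rep_exists:
  fixes f :: "'a::euclidean_space \<Rightarrow> 'b::euclidean_space"
  assumes S: "open S" and f: "f \<in> L2 S"
  obtains f0 where "borel_rep S f f0"
proof -
  have "\<exists>g. g \<in> borel_measurable borel \<and> (\<forall>x. x \<notin> S \<longrightarrow> g x = 0) \<and> (AE x in lborel. x \<in> S \<longrightarrow> f x \<bullet> b = g x)" for b
  proof -
    have "(\<lambda>x. f x \<bullet> b) \<in> borel_measurable (lebesgue_on S)" using L2D(1)[OF f] by measurable
    from borel_rep_exists_real[OF S this] show ?thesis by metis
  qed
  then obtain g where g [measurable]: "\<And>b. g b \<in> borel_measurable borel"
    and g0: "\<And>b x. x \<notin> S \<Longrightarrow> g b x = 0" and gae: "\<And>b. AE x in lborel. x \<in> S \<longrightarrow> f x \<bullet> b = g b x"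
    by metis
  define f0 where "f0 x = (\<Sum>b\<in>Basis. g b x *\<^sub>R b)" for x
  have [measurable]: "f0 \<in> borel_measurable borel" unfolding f0_def[abs_def] by measurable
  have z: "f0 x = 0" if "x \<notin> S" for x using that by (simp add: f0_def g0)
  have "AE x in lborel. \<forall>b\<in>Basis. x \<in> S \<longrightarrow> f x \<bullet> b = g b x"
    using gae by (intro AE_finite_allI) auto
  then have ae: "AE x in lborel. x \<in> S \<longrightarrow> f x = f0 x"
    by eventually_elim (metis (no_types, lifting) euclidean_representation f0_def sum.cong)
  have "integrable (lebesgue_on S) (\<lambda>x. (norm (f x))\<^sup>2) \<longleftrightarrow> integrable lborel (\<lambda>x. (norm (f0 x))\<^sup>2)"
    by (rule integral_lebesgue_on_rep(2)[OF S])
       (use L2D[OF f] ae in \<open>auto simp: z elim: eventually_mono\<close>)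
  then show ?thesis
    using that[of f0] ae z L2D[OF f] by (simp add: borel_rep_def)
qed

section \<open>The fundamental lemma of the calculus of variations\<close>

text \<open>
  The positive and the negative part of \<open>h\<close> are densities of two finite measures that agree on open boxes.
  Boxes generate the Borel sets and are closed under intersection, so the measures coincide.
\<close>

lemma AE_zero_if_box_integrals_zero:
  fixes h :: "'a::euclidean_space \<Rightarrow> real"
  assumes h: "integrable lborel h"
    and zero: "\<And>a c. (LBINT x. indicator (box a c) x * h x) = 0"
  shows "AE x in lborel. h x = 0"
proof -
  have [measurable]: "h \<in> borel_measurable borel" using h by auto
  define P N where "P x = ennreal (max 0 (h x))" and "N x = ennreal (max 0 (- h x))" for x
  have [measurable]: "P \<in> borel_measurable lborel" "N \<in> borel_measurable lborel"
    unfolding P_def[abs_def] N_def[abs_def] by auto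
  have i: "integrable lborel (\<lambda>x. indicator (box a c) x * max 0 (s * h x))" for s a c
    by (rule Bochner_Integration.integrable_bound[of _ "\<lambda>x. s * h x"])
       (use h in \<open>auto simp: indicator_def split: split_max\<close>)
  have emeasure_box: "emeasure (density lborel (\<lambda>x. ennreal (max 0 (s * h x)))) (box a c)
      = ennreal (LBINT x. indicator (box a c) x * max 0 (s * h x))" for s a c
  proof -
    have "(\<integral>\<^sup>+x. ennreal (indicator (box a c) x * max 0 (s * h x)) \<partial>lborel)
        = ennreal (LBINT x. indicator (box a c) x * max 0 (s * h x))"
      by (rule nn_integral_eq_integral[OF i]) auto
    then show ?thesis
      by (simp add: emeasure_density ennreal_mult'' ennreal_indicator mult.commute)
  qed
  have "density lborel P = density lborel N"
  proof (rule measure_eqI_generator_eq)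
    let ?E = "range (\<lambda>(a, b). box a b::'a set)"
    show "Int_stable ?E"
      by (auto simp: Int_stable_def box_Int_box)
    show "?E \<subseteq> Pow UNIV" "sets (density lborel P) = sigma_sets UNIV ?E" "sets (density lborel N) = sigma_sets UNIV ?E"
      by (simp_all add: borel_eq_box)
    let ?A = "\<lambda>n::nat. box (- (real n *\<^sub>R One)) (real n *\<^sub>R One) :: 'a set"
    show "range ?A \<subseteq> ?E" "(\<Union>i. ?A i) = UNIV"
      unfolding UN_box_eq_UNIV by auto
    show "emeasure (density lborel P) (?A i) \<noteq> \<infinity>" for i
      using emeasure_box[of 1] by (simp add: P_def[abs_def])
    show "emeasure (density lborel P) X = emeasure (density lborel N) X" if XE: "X \<in> ?E" for X
    proof -
      obtain a c where X: "X = box a c" using XE by auto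
      have "(LBINT x. indicator (box a c) x * max 0 (1 * h x)) - (LBINT x. indicator (box a c) x * max 0 ((-1) * h x))
         = (LBINT x. indicator (box a c) x * max 0 (1 * h x) - indicator (box a c) x * max 0 ((-1) * h x))"
        by (rule Bochner_Integration.integral_diff[symmetric]) (rule i)+
      also have "\<dots> = (LBINT x. indicator (box a c) x * h x)"
        by (rule Bochner_Integration.integral_cong) (auto simp: indicator_def)
      finally show ?thesis
        using emeasure_box[of 1 a c] emeasure_box[of "-1" a c] zero[of a c]
        by (simp add: X P_def[abs_def] N_def[abs_def])
    qed
  qed
  then have "AE x in lborel. P x = N x"
    by (intro sigma_finite_measure.density_unique[OF sigma_finite_lborel]) auto
  then show ?thesis
    by eventually_elim (auto simp: P_def N_def max_def split: if_splits)
qed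

lemma AE_cbox_imp_box: "AE x in lborel. x \<in> cbox a b \<longrightarrow> x \<in> box a b"
proof -
  have "cbox a b - box a b \<in> null_sets lebesgue"
    using negligible_frontier_interval[of a b] by (simp add: negligible_iff_null_sets)
  then have "AE x in lebesgue. x \<notin> cbox a b - box a b" by (rule AE_not_in)
  then show ?thesis by (simp add: AE_completion_iff)
qed

text \<open>
  Fundamental lemma of the calculus of variations. The bumps of a box converge boundedly to its indicator function, so
  \<open>h\<close> has integral zero over every box with closure in \<open>S\<close>, hence vanishes on each of the countably many
  rational boxes that cover \<open>S\<close>.
\<close>

lemma AE_zero_on_open:
  fixes h :: "'a::euclidean_space \<Rightarrow> real"
  assumes S: "open S" and [measurable]: "h \<in> borel_measurable borel"
    and int: "\<And>a c. cbox a c \<subseteq> S \<Longrightarrow> integrable lborel (\<lambda>x. indicator (cbox a c) x * h x)"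
    and zero: "\<And>a c k. cbox a c \<subseteq> S \<Longrightarrow> box a c \<noteq> {} \<Longrightarrow> (LBINT x. h x * box_bump a c k x) = 0"
  shows "AE x in lborel. x \<in> S \<longrightarrow> h x = 0"
proof -
  have box0: "(LBINT x. indicator (box a c) x * h x) = 0" if ac: "cbox a c \<subseteq> S" for a c
  proof (cases "box a c = {}")
    case False
    have "(\<lambda>k. LBINT x. h x * box_bump a c k x) \<longlonglongrightarrow> (LBINT x. indicator (box a c) x * h x)"
    proof (rule integral_dominated_convergence)
      show "integrable lborel (\<lambda>x. norm (indicator (cbox a c) x * h x))"
        by (rule Bochner_Integration.integrable_norm[OF int[OF ac]])
      show "AE x in lborel. (\<lambda>k. h x * box_bump a c k x) \<longlonglongrightarrow> indicator (box a c) x * h x"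
        by (rule AE_I2) (subst mult.commute, intro tendsto_intros box_bump_tendsto)
      show "AE x in lborel. norm (h x * box_bump a c k x) \<le> norm (indicator (cbox a c) x * h x)" for k
      proof (rule AE_I2)
        fix x show "norm (h x * box_bump a c k x) \<le> norm (indicator (cbox a c) x * h x)"
        proof (cases "x \<in> box a c")
          case True
          then have "x \<in> cbox a c" using box_subset_cbox by blast
          then show ?thesis
            using mult_left_mono[of "\<bar>box_bump a c k x\<bar>" 1 "\<bar>h x\<bar>"] box_bump_bounds[of a c k x]
            by (simp add: abs_mult)
        qed (simp add: box_bump_zero)
      qed
      show "(\<lambda>x. h x * box_bump a c k x) \<in> borel_measurable lborel" for k
        using test_fun_borel[OF test_fun_box_bump[OF ac]] by measurable
    qed auto
    then show ?thesis
      using zero[OF ac False] by (simp add: LIMSEQ_const_iff)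
  qed simp
  have cbox0: "AE x in lborel. x \<in> cbox a c \<longrightarrow> h x = 0" if ac: "cbox a c \<subseteq> S" for a c
  proof -
    have "AE x in lborel. indicator (box a c) x * h x = 0"
    proof (rule AE_zero_if_box_integrals_zero)
      show "integrable lborel (\<lambda>x. indicator (box a c) x * h x)"
        by (rule Bochner_Integration.integrable_bound[OF int[OF ac]])
           (use box_subset_cbox[of a c] in \<open>auto simp: indicator_def\<close>)
      fix a' c'
      have "(LBINT x. indicator (box a' c') x * (indicator (box a c) x * h x))
          = (LBINT x. indicator (box a c \<inter> box a' c') x * h x)"
        by (simp add: indicator_inter_arith mult_ac)
      also have "\<dots> = 0"
        unfolding box_Int_box by (rule box0, unfold Int_interval[symmetric]) (use ac in auto)
      finally show "(LBINT x. indicator (box a' c') x * (indicator (box a c) x * h x)) = 0" .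
    qed
    with AE_cbox_imp_box[of a c] show ?thesis
      by eventually_elim (auto simp: indicator_def split: if_splits)
  qed
  define a' b' where "a' f = (\<Sum>(i::'a)\<in>Basis. fst (f i :: real \<times> real) *\<^sub>R i)"
    and "b' f = (\<Sum>(i::'a)\<in>Basis. snd (f i :: real \<times> real) *\<^sub>R i)" for f
  define I where "I = {f\<in>Basis \<rightarrow>\<^sub>E \<rat> \<times> \<rat>. cbox (a' f) (b' f) \<subseteq> S}"
  have SI: "S = (\<Union>f\<in>I. cbox (a' f) (b' f))"
    using open_UNION_cbox[OF S] by (simp add: I_def a'_def b'_def)
  have "countable ((Basis :: 'a set) \<rightarrow>\<^sub>E ((\<rat> \<times> \<rat>) :: (real \<times> real) set))"
    by (intro countable_PiE) (auto intro: countable_rat)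
  then have "countable I" unfolding I_def by (rule countable_subset[rotated]) auto
  moreover have "AE x in lborel. x \<in> cbox (a' f) (b' f) \<longrightarrow> h x = 0" if "f \<in> I" for f
    using that by (intro cbox0) (auto simp: I_def)
  ultimately have "AE x in lborel. \<forall>f\<in>I. x \<in> cbox (a' f) (b' f) \<longrightarrow> h x = 0"
    by (subst AE_ball_countable) auto
  then show ?thesis by eventually_elim (use SI in blast)
qed

lemma box_bump_Pair:
  "box_bump (a, a') (c, c') k z = box_bump a c k (fst z) * box_bump a' c' k (snd z)"
proof -
  let ?g = "\<lambda>b. flat_exp 0 (k * (z \<bullet> b - (a, a') \<bullet> b)) * flat_exp 0 (k * ((c, c') \<bullet> b - z \<bullet> b))"
  have "box_bump (a, a') (c, c') k z = prod ?g ((\<lambda>u. (u, 0)) ` Basis) * prod ?g ((\<lambda>v. (0, v)) ` Basis)"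
    unfolding box_bump_def Basis_prod_def by (rule prod.union_disjoint) auto
  also have "prod ?g ((\<lambda>u. (u, 0)) ` Basis) = box_bump a c k (fst z)"
    by (subst prod.reindex) (auto simp: box_bump_def inj_on_def inner_prod_def intro!: prod.cong)
  also have "prod ?g ((\<lambda>v. (0, v)) ` Basis) = box_bump a' c' k (snd z)"
    by (subst prod.reindex) (auto simp: box_bump_def inj_on_def inner_prod_def intro!: prod.cong)
  finally show ?thesis .
qed

text \<open>
  Since the bump of a box in a product space factorises, testing with products is enough.
\<close>

lemma AE_zero_on_open_Times:
  fixes h :: "'a::euclidean_space \<times> 'b::euclidean_space \<Rightarrow> real"
  assumes A: "open A" and B: "open B" and h: "h \<in> borel_measurable borel"
    and int: "\<And>a c. cbox a c \<subseteq> A \<times> B \<Longrightarrow> integrable lborel (\<lambda>x. indicator (cbox a c) x * h x)"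
    and zero: "\<And>\<eta> \<psi>. \<eta> \<in> test_fun A \<Longrightarrow> \<psi> \<in> test_fun B \<Longrightarrow> (LBINT z. h z * (\<eta> (fst z) * \<psi> (snd z))) = 0"
  shows "AE z in lborel. z \<in> A \<times> B \<longrightarrow> h z = 0"
proof (rule AE_zero_on_open[OF open_Times[OF A B] h int])
  fix a c :: "'a \<times> 'b" and k
  assume *: "cbox a c \<subseteq> A \<times> B" "box a c \<noteq> {}"
  then have "cbox a c \<noteq> {}" using box_subset_cbox by blast
  with *(1) have "cbox (fst a) (fst c) \<subseteq> A" "cbox (snd a) (snd c) \<subseteq> B"
    by (auto simp: cbox_prod times_subset_iff)
  then show "(LBINT x. h x * box_bump a c k x) = 0"
    using zero[OF test_fun_box_bump test_fun_box_bump] box_bump_Pair[of "fst a" "snd a" "fst c" "snd c"]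
    by simp
qed

lemma integrable_indicator_cbox_L2:
  fixes h :: "'a::euclidean_space \<Rightarrow> real"
  assumes [measurable]: "h \<in> borel_measurable borel" and "integrable lborel (\<lambda>x. (h x)\<^sup>2)"
  shows "integrable lborel (\<lambda>x. indicator (cbox a c) x * h x)"
proof (rule integrable_mult_L2)
  have "(\<lambda>x. (indicator (cbox a c) x :: real)\<^sup>2) = indicator (cbox a c)"
    by (auto simp: indicator_def)
  then show "integrable lborel (\<lambda>x. (indicator (cbox a c) x :: real)\<^sup>2)"
    by (simp add: integrable_indicator_iff emeasure_lborel_cbox_eq)
qed (use assms in auto)

lemma L2I_borel:
  fixes f :: "'a::euclidean_space \<Rightarrow> 'b::euclidean_space"
  assumes A: "open A" and f [measurable]: "f \<in> borel_measurable borel" and "integrable lborel (\<lambda>x. (norm (f x))\<^sup>2)"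
  shows "f \<in> L2 A"
proof -
  have "integrable lebesgue (\<lambda>x. (norm (f x))\<^sup>2)"
    using assms(3) by (simp add: integrable_completion)
  then have "integrable (lebesgue_on A) (\<lambda>x. (norm (f x))\<^sup>2)"
    using A integrable_mult_indicator[of A lebesgue "\<lambda>x. (norm (f x))\<^sup>2"]
    by (simp add: integrable_restrict_space)
  moreover have "f \<in> borel_measurable (lebesgue_on A)"
    by (intro measurable_restrict_space1 measurable_completion) simp
  ultimately show ?thesis by (simp add: L2_def)
qed

lemma test_fun_L2: "open A \<Longrightarrow> \<phi> \<in> test_fun S \<Longrightarrow> \<phi> \<in> L2 A"
  using test_fun_square_integrable(1)[of \<phi> S] by (intro L2I_borel test_fun_borel) simp_all

lemma AE_zero_if_orthogonal_test_fun:
  fixes h :: "'a::euclidean_space \<Rightarrow> real"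
  assumes S: "open S" and h: "h \<in> L2 S"
    and zero: "\<And>\<phi>. \<phi> \<in> test_fun S \<Longrightarrow> (LINT x|lebesgue_on S. h x * \<phi> x) = 0"
  shows "AE x in lebesgue_on S. h x = 0"
proof -
  obtain h0 where h0: "borel_rep S h h0" using borel_rep_exists[OF S h] .
  then have [measurable]: "h0 \<in> borel_measurable borel" and z: "\<And>x. x \<notin> S \<Longrightarrow> h0 x = 0"
    and i: "integrable lborel (\<lambda>x. (h0 x)\<^sup>2)" and ae: "AE x in lborel. x \<in> S \<longrightarrow> h x = h0 x"
    by (auto simp: borel_rep_def)
  have "AE x in lborel. x \<in> S \<longrightarrow> h0 x = 0"
  proof (rule AE_zero_on_open[OF S])
    fix a c k assume ac: "cbox a c \<subseteq> S"
    let ?\<phi> = "box_bump a c k"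
    have \<phi>: "?\<phi> \<in> test_fun S" by (rule test_fun_box_bump[OF ac])
    have [measurable]: "?\<phi> \<in> borel_measurable (lebesgue_on S)" "h \<in> borel_measurable (lebesgue_on S)"
      using L2D(1)[OF test_fun_L2[OF S \<phi>]] L2D(1)[OF h] by auto
    have [measurable]: "?\<phi> \<in> borel_measurable borel" by (rule test_fun_borel[OF \<phi>])
    have "(LINT x|lebesgue_on S. h x * ?\<phi> x) = (LBINT x. h0 x * ?\<phi> x)"
    proof (rule integral_lebesgue_on_rep(1)[OF S])
      show "AE x in lborel. x \<in> S \<longrightarrow> h x * ?\<phi> x = h0 x * ?\<phi> x" using ae by eventually_elim simp
    qed (auto simp: z)
    then show "(LBINT x. h0 x * ?\<phi> x) = 0" using zero[OF \<phi>] by simp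
  qed (auto intro: integrable_indicator_cbox_L2 i)
  with ae have "AE x in lborel. x \<in> S \<longrightarrow> h x = 0" by eventually_elim auto
  then show ?thesis using S by (simp add: AE_lebesgue_on_open)
qed


section \<open>Fubini's theorem for Lebesgue-Borel measure\<close>

lemma integrable_tensor_lborel:
  fixes f :: "'a::euclidean_space \<Rightarrow> real" and g :: "'b::euclidean_space \<Rightarrow> real"
  assumes f: "integrable lborel f" and g: "integrable lborel g"
  shows "integrable lborel (\<lambda>z. f (fst z) * g (snd z))"
proof -
  have [measurable]: "f \<in> borel_measurable borel" "g \<in> borel_measurable borel" using f g by auto
  have "integrable (lborel \<Otimes>\<^sub>M lborel) (\<lambda>z::'a \<times> 'b. f (fst z) * g (snd z))"
    by (rule lborel_pair.Fubini_integrable) (use f g in \<open>auto simp: abs_mult\<close>)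
  then show ?thesis by (simp add: lborel_prod)
qed

lemma Fubini_lborel:
  fixes h :: "'a::euclidean_space \<times> 'b::euclidean_space \<Rightarrow> real"
  assumes h: "integrable lborel h"
  shows "AE x in lborel. integrable lborel (\<lambda>y. h (x, y))"
    and "integrable lborel (\<lambda>x. LBINT y. h (x, y))"
    and "(LBINT x. LBINT y. h (x, y)) = (LBINT z. h z)"
    and "AE y in lborel. integrable lborel (\<lambda>x. h (x, y))"
    and "integrable lborel (\<lambda>y. LBINT x. h (x, y))"
    and "(LBINT y. LBINT x. h (x, y)) = (LBINT z. h z)"
proof -
  have h1: "integrable (lborel \<Otimes>\<^sub>M lborel) h" using h by (simp add: lborel_prod)
  then have h2: "integrable (lborel \<Otimes>\<^sub>M lborel) (case_prod (\<lambda>x y. h (x, y)))" by simp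
  show "AE x in lborel. integrable lborel (\<lambda>y. h (x, y))"
    by (rule lborel_pair.AE_integrable_fst'[OF h1])
  show "integrable lborel (\<lambda>x. LBINT y. h (x, y))"
    by (rule lborel_pair.integrable_fst'[OF h1])
  show "(LBINT x. LBINT y. h (x, y)) = (LBINT z. h z)"
    using lborel_pair.integral_fst'[OF h1] by (simp add: lborel_prod)
  show "AE y in lborel. integrable lborel (\<lambda>x. h (x, y))"
    by (rule lborel_pair.AE_integrable_snd[OF h2])
  show "integrable lborel (\<lambda>y. LBINT x. h (x, y))"
    by (rule lborel_pair.integrable_snd[OF h2])
  show "(LBINT y. LBINT x. h (x, y)) = (LBINT z. h z)"
    using lborel_pair.integral_snd[OF h2] by (simp add: lborel_prod)
qed

lemma borel_measurable_slice:
  fixes h :: "'a::euclidean_space \<times> 'b::euclidean_space \<Rightarrow> 'c::euclidean_space"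
  assumes "h \<in> borel_measurable borel"
  shows "(\<lambda>y. h (x, y)) \<in> borel_measurable borel"
  by (rule measurable_compose[OF _ assms]) (intro borel_measurable_continuous_onI continuous_intros)

lemma AE_lborel_fst_snd:
  fixes P :: "'a::euclidean_space \<times> 'b::euclidean_space \<Rightarrow> bool"
  assumes "AE z in lborel. P z"
  shows "AE x in lborel. AE y in lborel. P (x, y)"
proof -
  have "AE z in lborel \<Otimes>\<^sub>M lborel. P z" using assms unfolding lborel_prod .
  then show ?thesis by (rule lborel_pair.AE_pair)
qed

text \<open>
  A null set of points \<open>y\<close> gives a cylindrical null set of pairs; this transports statements about almost every
  time line to the space-time cylinder.
\<close>

lemma AE_lborel_snd:
  assumes "AE y in (lborel :: 'b::euclidean_space measure). P y"
  shows "AE z in (lborel :: ('a::euclidean_space \<times> 'b) measure). P (snd z)"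
proof -
  obtain N where N: "{y. \<not> P y} \<subseteq> N" "N \<in> null_sets (lborel :: 'b measure)"
    using assms by (auto simp: eventually_ae_filter)
  have "(UNIV :: 'a set) \<times> N \<in> null_sets (lborel \<Otimes>\<^sub>M (lborel :: 'b measure))"
    using N(2) by (intro lborel.times_in_null_sets2) auto
  then have "UNIV \<times> N \<in> null_sets (lborel :: ('a \<times> 'b) measure)" by (simp add: lborel_prod)
  then show ?thesis
    by (rule AE_I') (use N(1) in auto)
qed

section \<open>Primitives on the line\<close>

lemma integrable_indicator_mult_lborel:
  fixes g :: "'a::euclidean_space \<Rightarrow> real"
  assumes "integrable lborel g" "A \<in> sets borel"
  shows "integrable lborel (\<lambda>s. indicator A s * g s)"
  using integrable_mult_indicator[of A lborel g] assms by simp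

text \<open>
  Both sides integrate \<open>g(s) \<alpha>(t)\<close> over the triangle \<open>s < t\<close>. This replaces integration by parts, for
  which primitives of merely integrable functions would have to be differentiated.
\<close>

lemma integral_primitive_mult:
  fixes g \<alpha> :: "real \<Rightarrow> real"
  assumes g: "integrable lborel g" and \<alpha>: "integrable lborel \<alpha>"
  shows "(LBINT t. (LBINT s. indicator {..<t} s * g s) * \<alpha> t)
       = (LBINT s. g s * (LBINT t. indicator {s<..} t * \<alpha> t))"
    and "integrable lborel (\<lambda>t. (LBINT s. indicator {..<t} s * g s) * \<alpha> t)"
    and "integrable lborel (\<lambda>s. g s * (LBINT t. indicator {s<..} t * \<alpha> t))"
proof -
  have [measurable]: "g \<in> borel_measurable borel" "\<alpha> \<in> borel_measurable borel" using g \<alpha> by auto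
  let ?h = "\<lambda>z::real \<times> real. indicator {z. snd z < fst z} z * (\<alpha> (fst z) * g (snd z))"
  have "integrable lborel (\<lambda>z. \<alpha> (fst z) * g (snd z))" by (rule integrable_tensor_lborel[OF \<alpha> g])
  moreover have "{z::real \<times> real. snd z < fst z} \<in> sets borel"
    by (intro borel_open open_Collect_less continuous_intros)
  ultimately have h: "integrable lborel ?h" by (intro integrable_indicator_mult_lborel)
  have a: "(LBINT s. ?h (t, s)) = (LBINT s. indicator {..<t} s * g s) * \<alpha> t" for t
  proof -
    have "(LBINT s. ?h (t, s)) = (LBINT s. (indicator {..<t} s * g s) * \<alpha> t)"
      by (rule Bochner_Integration.integral_cong) (auto simp: indicator_def)
    then show ?thesis by simp
  qed
  have b: "(LBINT t. ?h (t, s)) = g s * (LBINT t. indicator {s<..} t * \<alpha> t)" for s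
  proof -
    have "(LBINT t. ?h (t, s)) = (LBINT t. g s * (indicator {s<..} t * \<alpha> t))"
      by (rule Bochner_Integration.integral_cong) (auto simp: indicator_def)
    then show ?thesis by simp
  qed
  show "(LBINT t. (LBINT s. indicator {..<t} s * g s) * \<alpha> t)
       = (LBINT s. g s * (LBINT t. indicator {s<..} t * \<alpha> t))"
    using Fubini_lborel(3)[OF h] Fubini_lborel(6)[OF h] unfolding a b by simp
  show "integrable lborel (\<lambda>t. (LBINT s. indicator {..<t} s * g s) * \<alpha> t)"
    using Fubini_lborel(2)[OF h] unfolding a .
  show "integrable lborel (\<lambda>s. g s * (LBINT t. indicator {s<..} t * \<alpha> t))"
    using Fubini_lborel(5)[OF h] unfolding b .
qed

text \<open>
  For \<open>\<alpha> = g\<close> the two triangles \<open>s < t\<close> and \<open>s > t\<close> contribute equally and together make up the whole square. This is the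
  chain rule \<open>2 \<integral> G G' = G\<^sup>2\<close> for an absolutely continuous \<open>G\<close>.
\<close>

lemma integral_primitive_mult_self:
  fixes g :: "real \<Rightarrow> real"
  assumes g: "integrable lborel g"
  shows "2 * (LBINT t. (LBINT s. indicator {..<t} s * g s) * g t) = (LBINT t. g t)\<^sup>2"
proof -
  let ?G = "\<lambda>t. LBINT s. indicator {..<t} s * g s" and ?H = "\<lambda>s. LBINT t. indicator {s<..} t * g t"
  have [measurable]: "g \<in> borel_measurable borel" using g by auto
  note i = integral_primitive_mult[OF g g]
  have sum: "?G t + ?H t = (LBINT s. g s)" for t
  proof -
    have "?G t + ?H t = (LBINT s. indicator {..<t} s * g s + indicator {t<..} s * g s)"
      by (rule Bochner_Integration.integral_add[symmetric]) (auto intro: integrable_indicator_mult_lborel g)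
    also have "\<dots> = (LBINT s. g s)"
    proof (rule integral_cong_AE)
      show "AE s in lborel. indicator {..<t} s * g s + indicator {t<..} s * g s = g s"
        using AE_lborel_singleton[of t] by eventually_elim (auto simp: indicator_def)
    qed auto
    finally show ?thesis .
  qed
  have "2 * (LBINT t. ?G t * g t) = (LBINT t. ?G t * g t) + (LBINT t. g t * ?H t)"
    using i(1) by simp
  also have "\<dots> = (LBINT t. ?G t * g t + g t * ?H t)"
    by (rule Bochner_Integration.integral_add[symmetric]) (fact i)+
  also have "\<dots> = (LBINT t. (?G t + ?H t) * g t)" by (simp add: algebra_simps)
  finally show ?thesis unfolding sum by (simp add: power2_eq_square)
qed

lemma test_fun_real_has_derivative:
  fixes \<theta> :: "real \<Rightarrow> real"
  assumes "\<theta> \<in> test_fun S"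
  shows "(\<theta> has_real_derivative dir_deriv 1 \<theta> t) (at t)"
proof -
  have eq: "(\<lambda>v. dir_deriv v \<theta> t) = (*) (dir_deriv 1 \<theta> t)"
  proof
    show "dir_deriv v \<theta> t = dir_deriv 1 \<theta> t * v" for v
      using dir_deriv_linear[OF test_funD(4)[OF assms], of v t] by simp
  qed
  show ?thesis
    using has_derivative_frechet[OF test_funD(4)[OF assms], of t]
    unfolding has_field_derivative_def eq .
qed

lemma integral_tail_deriv_test_fun:
  fixes \<theta> :: "real \<Rightarrow> real"
  assumes \<theta>: "\<theta> \<in> test_fun S"
  shows "(LBINT t. indicator {s<..} t * dir_deriv 1 \<theta> t) = - \<theta> s"
proof -
  have \<theta>': "dir_deriv 1 \<theta> \<in> test_fun S" by (rule test_fun_dir_deriv[OF \<theta>])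
  obtain a b where ab: "\<And>t. t \<notin> cbox a b \<Longrightarrow> \<theta> t = 0" using test_fun_support_cbox[OF \<theta>] by blast
  obtain a' b' where ab': "\<And>t. t \<notin> cbox a' b' \<Longrightarrow> dir_deriv 1 \<theta> t = 0"
    using test_fun_support_cbox[OF \<theta>'] by blast
  define c where "c = max s (max b b') + 1"
  have c: "s \<le> c" "\<theta> c = 0" by (auto simp: c_def intro!: ab)
  have c': "dir_deriv 1 \<theta> t = 0" if "t > c" for t
    using that by (intro ab') (auto simp: c_def)
  have [measurable]: "dir_deriv 1 \<theta> \<in> borel_measurable borel" by (rule test_fun_borel[OF \<theta>'])
  have "(LBINT t. indicator {s<..} t * dir_deriv 1 \<theta> t) = (LBINT t. indicator {s..c} t *\<^sub>R dir_deriv 1 \<theta> t)"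
  proof (rule integral_cong_AE)
    show "AE t in lborel. indicator {s<..} t * dir_deriv 1 \<theta> t = indicator {s..c} t *\<^sub>R dir_deriv 1 \<theta> t"
      using AE_lborel_singleton[of s] by eventually_elim (use c(1) c' in \<open>auto simp: indicator_def\<close>)
  qed auto
  also have "\<dots> = \<theta> c - \<theta> s"
  proof (rule integral_FTC_atLeastAtMost[OF c(1)])
    show "(\<theta> has_vector_derivative dir_deriv 1 \<theta> t) (at t within {s..c})" for t
      using test_fun_real_has_derivative[OF \<theta>]
      by (simp add: has_real_derivative_iff_has_vector_derivative has_vector_derivative_at_within)
    show "continuous_on {s..c} (dir_deriv 1 \<theta>)"
      by (rule continuous_on_subset[OF test_funD(5)[OF \<theta>']]) simp
  qed
  finally show ?thesis by (simp add: c)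
qed

text \<open>
  Mean value zero is exactly what makes the primitive vanish to the right of the support as well.
\<close>

lemma test_fun_primitive:
  fixes \<zeta> :: "real \<Rightarrow> real"
  assumes \<zeta>: "\<zeta> \<in> test_fun {a<..<b}" and 0: "(LBINT t. \<zeta> t) = 0"
  obtains \<theta> where "\<theta> \<in> test_fun {a<..<b}" "dir_deriv 1 \<theta> = \<zeta>"
proof -
  let ?K = "closure {t. \<zeta> t \<noteq> 0}"
  have K: "compact ?K" "?K \<subseteq> {a<..<b}" by (fact test_funD(2,3)[OF \<zeta>])+
  have Kz: "\<zeta> t = 0" if "t \<notin> ?K" for t using that by (rule zero_outside_support)
  obtain p q where pq: "{p..q} \<subseteq> {a<..<b}" "?K \<subseteq> {p..q}"
  proof (cases "?K = {}")
    case True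
    have "?K \<subseteq> {1..0}" unfolding True by (rule empty_subsetI)
    moreover have "{1..0} \<subseteq> {a<..<b}" by simp
    ultimately show ?thesis by (intro that[of 1 0])
  next
    case False
    obtain p where p: "p \<in> ?K" "\<And>t. t \<in> ?K \<Longrightarrow> p \<le> t" using compact_attains_inf[OF K(1) False] by blast
    obtain q where q: "q \<in> ?K" "\<And>t. t \<in> ?K \<Longrightarrow> t \<le> q" using compact_attains_sup[OF K(1) False] by blast
    have "a < p" "q < b" using p(1) q(1) K(2) by auto
    then show ?thesis by (intro that[of p q]) (auto intro: p(2) q(2))
  qed
  define c where "c = p - 1"
  define \<theta> where "\<theta> t = integral {c..t} \<zeta>" for t
  have cont: "continuous_on A \<zeta>" for A
    by (rule continuous_on_subset[OF test_funD(5)[OF \<zeta>]]) simp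
  have low: "\<theta> t = 0" if "t < p" for t
  proof -
    have "(\<zeta> has_integral 0) {c..t}"
    proof (rule has_integral_is_0)
      fix s assume "s \<in> {c..t}"
      then have "s \<notin> ?K" using pq(2) that by force
      then show "\<zeta> s = 0" by (rule Kz)
    qed
    then show ?thesis unfolding \<theta>_def by (rule integral_unique)
  qed
  have deriv: "(\<theta> has_real_derivative \<zeta> t) (at t)" for t
  proof (cases "t < p")
    case True
    have "t \<notin> ?K" using True pq(2) by force
    then have "\<zeta> t = 0" by (rule Kz)
    then have "((\<lambda>t. 0) has_real_derivative \<zeta> t) (at t)" by simp
    then show ?thesis
      by (rule has_field_derivative_transform_within_open[where S="{..<p}"]) (use True low in auto)
  next
    case False
    then have "(\<theta> has_real_derivative \<zeta> t) (at t within {c..t + 1})"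
      unfolding \<theta>_def[abs_def] by (intro integral_has_real_derivative cont) (auto simp: c_def)
    moreover have "at t within {c..t + 1} = at t"
      using False by (intro at_within_interior) (auto simp: c_def)
    ultimately show ?thesis by simp
  qed
  have high: "\<theta> t = 0" if "t > q" "t \<ge> p" for t
  proof -
    have "(LBINT t. \<zeta> t) = (LBINT s. indicator {c..t} s *\<^sub>R \<zeta> s)"
    proof (rule Bochner_Integration.integral_cong)
      show "\<zeta> s = indicator {c..t} s *\<^sub>R \<zeta> s" for s
      proof (cases "s \<in> {c..t}")
        case False
        then have "s \<notin> ?K" using pq(2) that by (force simp: c_def)
        then have "\<zeta> s = 0" by (rule Kz)
        then show ?thesis by simp
      qed simp
    qed simp
    also have "\<dots> = \<theta> t - \<theta> c"
    proof (rule integral_FTC_atLeastAtMost)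
      show "(\<theta> has_vector_derivative \<zeta> s) (at s within {c..t})" for s
        using deriv
        by (simp add: has_real_derivative_iff_has_vector_derivative has_vector_derivative_at_within)
    qed (use that cont in \<open>auto simp: c_def\<close>)
    finally show ?thesis using 0 low[of c] by (simp add: c_def)
  qed
  have dd: "dir_deriv 1 \<theta> = \<zeta>" by (rule ext) (simp add: dir_deriv_real[OF deriv])
  have d: "\<theta> differentiable (at t)" for t
    using deriv by (auto simp: differentiable_def has_field_derivative_def)
  have "\<theta> \<in> test_fun {a<..<b}"
  proof (rule test_funI[of _ "{p..q}"])
    show "Ck k \<theta>" for k
    proof -
      have "Ck (Suc k) \<theta>" using d dd test_funD(1)[OF \<zeta>] by simp
      then show ?thesis by (rule Ck_SucD)
    qed
    show "\<theta> t = 0" if "t \<notin> {p..q}" for t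
      using that low[of t] high[of t] by (cases "t < p") auto
  qed (use pq in auto)
  then show ?thesis using dd by (rule that)
qed


section \<open>Functions with a weak time derivative\<close>

text \<open>
  Integrating out the time against a square-integrable weight is bounded on \<open>L\<^sup>2\<close>, by the Cauchy-Schwarz
  inequality on each time line. The representative constructed below is, at every time, a sum of such integrals of \<open>w\<close> and \<open>g\<close>,
  and its time increments are such integrals of \<open>g\<close>; only the weights \<open>\<alpha>\<close> differ.
\<close>

lemma slice_integral_L2:
  fixes h :: "real \<times> 'b::euclidean_space \<Rightarrow> real" and \<alpha> :: "real \<Rightarrow> real"
  assumes [measurable]: "h \<in> borel_measurable borel" "\<alpha> \<in> borel_measurable borel"
    and h: "integrable lborel (\<lambda>z. (h z)\<^sup>2)" and \<alpha>: "integrable lborel (\<lambda>t. (\<alpha> t)\<^sup>2)"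
  shows "(\<lambda>x. LBINT t. \<alpha> t * h (t, x)) \<in> borel_measurable borel"
    and "AE x in lborel. (LBINT t. \<alpha> t * h (t, x))\<^sup>2 \<le> (LBINT t. (\<alpha> t)\<^sup>2) * (LBINT t. (h (t, x))\<^sup>2)"
    and "integrable lborel (\<lambda>x. (LBINT t. \<alpha> t * h (t, x))\<^sup>2)"
    and "(LBINT x. (LBINT t. \<alpha> t * h (t, x))\<^sup>2) \<le> (LBINT t. (\<alpha> t)\<^sup>2) * (LBINT z. (h z)\<^sup>2)"
proof -
  let ?A = "LBINT t. (\<alpha> t)\<^sup>2"
  have hm [measurable]: "h \<in> borel_measurable (lborel \<Otimes>\<^sub>M lborel)" by (simp add: lborel_prod)
  have "(\<lambda>x. LBINT t. \<alpha> t * h (t, x)) \<in> borel_measurable lborel" by measurable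
  then show m [measurable]: "(\<lambda>x. LBINT t. \<alpha> t * h (t, x)) \<in> borel_measurable borel" by simp
  have sl: "(\<lambda>t. h (t, x)) \<in> borel_measurable lborel" for x by measurable
  show ae: "AE x in lborel. (LBINT t. \<alpha> t * h (t, x))\<^sup>2 \<le> ?A * (LBINT t. (h (t, x))\<^sup>2)"
    using Fubini_lborel(4)[OF h]
    by eventually_elim (intro Cauchy_Schwarz_integral \<alpha> sl; simp)
  have i: "integrable lborel (\<lambda>x. ?A * (LBINT t. (h (t, x))\<^sup>2))"
    using Fubini_lborel(5)[OF h] by simp
  show i': "integrable lborel (\<lambda>x. (LBINT t. \<alpha> t * h (t, x))\<^sup>2)"
  proof (rule Bochner_Integration.integrable_bound[OF i])
    show "AE x in lborel. norm ((LBINT t. \<alpha> t * h (t, x))\<^sup>2) \<le> norm (?A * (LBINT t. (h (t, x))\<^sup>2))"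
      using ae by eventually_elim auto
  qed simp
  have "(LBINT x. (LBINT t. \<alpha> t * h (t, x))\<^sup>2) \<le> (LBINT x. ?A * (LBINT t. (h (t, x))\<^sup>2))"
    by (rule integral_mono_AE[OF i' i ae])
  also have "\<dots> = ?A * (LBINT z. (h z)\<^sup>2)"
    using Fubini_lborel(6)[OF h] by simp
  finally show "(LBINT x. (LBINT t. \<alpha> t * h (t, x))\<^sup>2) \<le> ?A * (LBINT z. (h z)\<^sup>2)" .
qed

lemma integrable_indicator_Ioo: "integrable lborel (indicator {a<..<b} :: real \<Rightarrow> real)"
  by (cases "a \<le> b") (auto simp: integrable_indicator_iff emeasure_lborel_Ioo)

lemma integrable_bounded_indicator_sq:
  fixes \<alpha> :: "real \<Rightarrow> real"
  assumes [measurable]: "\<alpha> \<in> borel_measurable borel" and b: "\<And>t. \<bar>\<alpha> t\<bar> \<le> B" and z: "\<And>t. t \<notin> {0<..<T} \<Longrightarrow> \<alpha> t = 0"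
    and "T > 0"
  shows "integrable lborel (\<lambda>t. (\<alpha> t)\<^sup>2)" "(LBINT t. (\<alpha> t)\<^sup>2) \<le> T * B\<^sup>2"
proof -
  have i: "integrable lborel (\<lambda>t. indicator {0<..<T} t * B\<^sup>2)" by (intro integrable_mult_left integrable_indicator_Ioo)
  have le: "(\<alpha> t)\<^sup>2 \<le> indicator {0<..<T} t * B\<^sup>2" for t
    using power_mono[OF b[of t], of 2] z[of t] by (cases "t \<in> {0<..<T}") auto
  show s: "integrable lborel (\<lambda>t. (\<alpha> t)\<^sup>2)"
    by (rule Bochner_Integration.integrable_bound[OF i]) (use le in auto)
  have "(LBINT t. (\<alpha> t)\<^sup>2) \<le> (LBINT t. indicator {0<..<T} t * B\<^sup>2)"
    by (rule integral_mono[OF s i le])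
  then show "(LBINT t. (\<alpha> t)\<^sup>2) \<le> T * B\<^sup>2" using \<open>T > 0\<close> by simp
qed

lemma test_fun_unit_mass:
  fixes a b :: real
  assumes "a < b"
  obtains \<eta> where "\<eta> \<in> test_fun {a<..<b}" "(LBINT t. \<eta> t) = 1"
proof -
  define p q where "p = (2 * a + b) / 3" and "q = (a + 2 * b) / 3"
  have pq: "a < p" "p < q" "q < b" using assms by (auto simp: p_def q_def)
  let ?\<beta> = "box_bump p q 1"
  have \<beta>: "?\<beta> \<in> test_fun {a<..<b}" by (rule test_fun_box_bump) (use pq in auto)
  have pos: "0 < ?\<beta> t" if "t \<in> {p<..<q}" for t
    using that by (auto simp: box_bump_def flat_exp_def)
  have i: "integrable lborel ?\<beta>" by (rule test_fun_square_integrable(2)[OF \<beta>])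
  have "(LBINT t. ?\<beta> t) \<noteq> 0"
  proof
    assume "(LBINT t. ?\<beta> t) = 0"
    then have "AE t in lborel. ?\<beta> t = 0"
      using integral_nonneg_eq_0_iff_AE[OF i] by (simp add: box_bump_bounds)
    then have "AE t in lborel. t \<notin> {p<..<q}" by eventually_elim (use pos in force)
    then have "emeasure lborel {p<..<q} = 0" by (subst (asm) AE_iff_measurable[OF _ refl]) (auto simp: greaterThanLessThan_def greaterThan_def lessThan_def Int_def)
    then show False using pq by (simp add: emeasure_lborel_Ioo)
  qed
  moreover have "(\<lambda>t. ?\<beta> t / (LBINT t. ?\<beta> t)) \<in> test_fun {a<..<b}"
  proof (rule test_funI[OF _ test_funD(2,3)[OF \<beta>]])
    show "Ck k (\<lambda>t. ?\<beta> t / (LBINT t. ?\<beta> t))" for k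
      unfolding divide_inverse by (intro Ck_mult Ck_const test_funD(1)[OF \<beta>])
    show "?\<beta> t / (LBINT t. ?\<beta> t) = 0" if "t \<notin> closure {t. ?\<beta> t \<noteq> 0}" for t
      using zero_outside_support[OF that] by simp
  qed
  ultimately show ?thesis by (intro that[of "\<lambda>t. ?\<beta> t / (LBINT t. ?\<beta> t)"]) auto
qed

lemma test_fun_cdiff:
  assumes "\<eta> \<in> test_fun S" "\<theta> \<in> test_fun S"
  shows "(\<lambda>x. \<eta> x - c * \<theta> x) \<in> test_fun S"
proof (rule test_funI)
  let ?K = "closure {x. \<eta> x \<noteq> 0} \<union> closure {x. \<theta> x \<noteq> 0}"
  show "compact ?K" by (intro compact_Un test_funD(2)[OF assms(1)] test_funD(2)[OF assms(2)])
  show "?K \<subseteq> S" using test_funD(3)[OF assms(1)] test_funD(3)[OF assms(2)] by auto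
  show "\<eta> x - c * \<theta> x = 0" if "x \<notin> ?K" for x
    using that zero_outside_support[of x \<eta>] zero_outside_support[of x \<theta>] by simp
  have "Ck k (\<lambda>x. \<eta> x + (- c) * \<theta> x)" for k
    by (intro Ck_add Ck_mult Ck_const test_funD(1)[OF assms(1)] test_funD(1)[OF assms(2)])
  then show "Ck k (\<lambda>x. \<eta> x - c * \<theta> x)" for k by simp
qed

text \<open>
  Fix \<open>\<eta>0\<close> with support in \<open>(0, T)\<close> and integral one, and let \<open>G(t, x) = \<integral>\<^bsub>s<t\<^esub> g(s, x) ds\<close>. The
  representative is \<open>W = G + \<integral> \<eta>0 (w - G)\<close>, that is, the primitive of \<open>g\<close> whose \<open>\<eta>0\<close>-mean over each time line
  agrees with that of \<open>w\<close>.

  To see that \<open>w = W\<close>, split \<open>\<eta> = m \<eta>0 + \<theta>'\<close> with \<open>m = \<integral> \<eta>\<close> and a test function \<open>\<theta>\<close>. On the first part \<open>w\<close> and \<open>W\<close>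
  have the same mean by construction, on the second they agree because both have the weak derivative \<open>g\<close>. Hence \<open>w - W\<close> is
  orthogonal to all products \<open>\<eta>(t) \<psi>(x)\<close>.
\<close>

lemma continuous_time_representative:
  fixes w g :: "real \<times> 'b::euclidean_space \<Rightarrow> real" and \<Omega> :: "'b set"
  assumes \<Omega>: "open \<Omega>" and T: "T > 0"
    and wm [measurable]: "w \<in> borel_measurable borel" and gm [measurable]: "g \<in> borel_measurable borel"
    and wz: "\<And>z. z \<notin> {0<..<T} \<times> \<Omega> \<Longrightarrow> w z = 0" and gz: "\<And>z. z \<notin> {0<..<T} \<times> \<Omega> \<Longrightarrow> g z = 0"
    and w2: "integrable lborel (\<lambda>z. (w z)\<^sup>2)" and g2: "integrable lborel (\<lambda>z. (g z)\<^sup>2)"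
    and weak: "\<And>\<eta> \<psi>. \<eta> \<in> test_fun {0<..<T} \<Longrightarrow> \<psi> \<in> test_fun \<Omega> \<Longrightarrow>
        (LBINT z. w z * (dir_deriv 1 \<eta> (fst z) * \<psi> (snd z))) = - (LBINT z. g z * (\<eta> (fst z) * \<psi> (snd z)))"
  obtains W where "\<And>t. W t \<in> borel_measurable borel" "\<And>t x. x \<notin> \<Omega> \<Longrightarrow> W t x = 0"
    "\<And>t. integrable lborel (\<lambda>x. (W t x)\<^sup>2)"
    "\<And>s t. 0 \<le> s \<Longrightarrow> s \<le> t \<Longrightarrow> t \<le> T \<Longrightarrow> (LBINT x. (W t x - W s x)\<^sup>2) \<le> (t - s) * (LBINT z. (g z)\<^sup>2)"
    "AE z in lborel. z \<in> {0<..<T} \<times> \<Omega> \<longrightarrow> w z = W (fst z) (snd z)"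
    "(LBINT x. (W T x)\<^sup>2) - (LBINT x. (W 0 x)\<^sup>2) = 2 * (LBINT z. w z * g z)"
proof -
  let ?I = "{0<..<T} :: real set"
  have [measurable]: "w \<in> borel_measurable (lborel \<Otimes>\<^sub>M lborel)" "g \<in> borel_measurable (lborel \<Otimes>\<^sub>M lborel)"
    by (simp_all add: lborel_prod)
  obtain \<eta>0 where \<eta>0: "\<eta>0 \<in> test_fun ?I" and \<eta>01: "(LBINT t. \<eta>0 t) = 1"
    using test_fun_unit_mass[OF T] .
  have \<eta>0m [measurable]: "\<eta>0 \<in> borel_measurable borel" by (rule test_fun_borel[OF \<eta>0])
  have \<eta>0i: "integrable lborel \<eta>0" "integrable lborel (\<lambda>t. (\<eta>0 t)\<^sup>2)"
    by (rule test_fun_square_integrable[OF \<eta>0])+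
  \<comment> \<open>By Fubini on the triangle, the mean of \<open>G\<close> against \<open>\<eta>0\<close> is the integral of \<open>\<kappa> g\<close>.\<close>
  define \<kappa> where "\<kappa> s = (LBINT t. indicator {s<..} t * \<eta>0 t)" for s
  define M where "M = (LBINT t. \<bar>\<eta>0 t\<bar>)"
  have "(\<lambda>s. LBINT t. indicator {z. fst z < snd z} (s, t) * \<eta>0 t) \<in> borel_measurable lborel"
  proof -
    have [measurable]: "{z::real \<times> real. fst z < snd z} \<in> sets (lborel \<Otimes>\<^sub>M lborel)"
      unfolding lborel_prod by (simp, intro borel_open open_Collect_less continuous_intros)
    show ?thesis by measurable
  qed
  then have \<kappa>m [measurable]: "\<kappa> \<in> borel_measurable borel"
    by (simp add: \<kappa>_def[abs_def] indicator_def)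
  have \<kappa>b: "\<bar>\<kappa> s\<bar> \<le> M" for s
  proof -
    have "\<bar>\<kappa> s\<bar> \<le> (LBINT t. \<bar>indicator {s<..} t * \<eta>0 t\<bar>)"
      unfolding \<kappa>_def by (rule integral_abs_bound)
    also have "\<dots> \<le> M"
      unfolding M_def
      by (intro integral_mono integrable_abs integrable_indicator_mult_lborel \<eta>0i) (auto simp: indicator_def)
    finally show ?thesis .
  qed
  have M: "M \<ge> 0" unfolding M_def by simp
  \<comment> \<open>The weight for which \<open>\<integral> \<alpha> t s * g (s, x) ds\<close> equals \<open>G (t, x)\<close> minus its mean; the cut-off to \<open>(0, T)\<close> makes it square integrable.\<close>
  define \<alpha> where "\<alpha> t s = indicator ?I s * (indicator {..<t} s - \<kappa> s)" for t s
  have \<alpha>m [measurable]: "\<alpha> t \<in> borel_measurable borel" for t unfolding \<alpha>_def[abs_def] by measurable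
  have \<alpha>b: "\<bar>\<alpha> t s\<bar> \<le> 1 + M" for t s
    using \<kappa>b[of s] M by (auto simp: \<alpha>_def indicator_def)
  have \<alpha>2: "integrable lborel (\<lambda>s. (\<alpha> t s)\<^sup>2)" "(LBINT s. (\<alpha> t s)\<^sup>2) \<le> T * (1 + M)\<^sup>2" for t
    by (rule integrable_bounded_indicator_sq[OF _ \<alpha>b _ T]; simp add: \<alpha>_def[abs_def])+
  define c where "c x = (LBINT t. \<eta>0 t * w (t, x))" for x
  define A where "A t x = (LBINT s. \<alpha> t s * g (s, x))" for t x
  define W where "W t x = c x + A t x" for t x
  note c = slice_integral_L2[OF wm \<eta>0m w2 \<eta>0i(2), folded c_def]
  note A = slice_integral_L2[OF gm \<alpha>m g2 \<alpha>2(1), folded A_def]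
  have [measurable]: "c \<in> borel_measurable borel" "A t \<in> borel_measurable borel" for t
    using c(1) A(1)[of t] by (simp_all add: c_def[abs_def] A_def[abs_def])
  have Wm: "W t \<in> borel_measurable borel" for t unfolding W_def[abs_def] by measurable
  have Wz: "W t x = 0" if "x \<notin> \<Omega>" for t x
    using that by (simp add: W_def c_def A_def wz gz)
  have W2: "integrable lborel (\<lambda>x. (W t x)\<^sup>2)" for t
    using integrable_add_L2[of c lborel "A t"] c(3) A(3)[of t] by (simp add: W_def)

  \<comment> \<open>The pointwise formulas for \<open>W\<close> hold on the time lines where the Bochner integrals involved exist.\<close>
  define good where "good x \<longleftrightarrow> integrable lborel (\<lambda>t. (g (t, x))\<^sup>2) \<and> integrable lborel (\<lambda>t. (w (t, x))\<^sup>2) \<and>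
     (c x)\<^sup>2 \<le> (LBINT t. (\<eta>0 t)\<^sup>2) * (LBINT t. (w (t, x))\<^sup>2)" for x
  have good: "AE x in lborel. good x"
    using Fubini_lborel(4)[OF g2] Fubini_lborel(4)[OF w2] c(2)
    unfolding good_def by eventually_elim (simp add: c_def)
  have gi: "integrable lborel (\<lambda>s. g (s, x))" if "good x" for x
  proof -
    have "integrable lborel (\<lambda>s. indicator ?I s * g (s, x))"
    proof (rule integrable_mult_L2)
      have "(\<lambda>s. (indicator ?I s :: real)\<^sup>2) = indicator ?I" by (auto simp: indicator_def)
      then show "integrable lborel (\<lambda>s. (indicator ?I s :: real)\<^sup>2)"
        by (simp add: integrable_indicator_Ioo)
    qed (use that in \<open>auto simp: good_def\<close>)
    also have "(\<lambda>s. indicator ?I s * g (s, x)) = (\<lambda>s. g (s, x))"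
    proof
      show "indicator ?I s * g (s, x) = g (s, x)" for s
        using gz[of "(s, x)"] by (cases "s \<in> ?I") auto
    qed
    finally show ?thesis .
  qed
  have \<alpha>gi: "integrable lborel (\<lambda>s. \<alpha> t s * g (s, x))" if "good x" for t x
    by (rule integrable_mult_L2[OF _ _ \<alpha>2(1)]) (use that in \<open>auto simp: good_def\<close>)
  have AG: "A t x = (LBINT s. indicator {..<t} s * g (s, x)) - (LBINT s. \<kappa> s * g (s, x))"
    and \<kappa>gi: "integrable lborel (\<lambda>s. \<kappa> s * g (s, x))" if "good x" for t x
  proof -
    show i: "integrable lborel (\<lambda>s. \<kappa> s * g (s, x))"
      by (rule Bochner_Integration.integrable_bound[of _ "\<lambda>s. M * g (s, x)"])
         (use gi[OF that] \<kappa>b M in \<open>auto simp: abs_mult intro!: mult_right_mono\<close>)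
    have "A t x = (LBINT s. indicator {..<t} s * g (s, x) - \<kappa> s * g (s, x))"
      unfolding A_def
    proof (rule Bochner_Integration.integral_cong)
      show "\<alpha> t s * g (s, x) = indicator {..<t} s * g (s, x) - \<kappa> s * g (s, x)" for s
        using gz[of "(s, x)"] by (cases "s \<in> ?I") (auto simp: \<alpha>_def algebra_simps)
    qed simp
    also have "\<dots> = (LBINT s. indicator {..<t} s * g (s, x)) - (LBINT s. \<kappa> s * g (s, x))"
      by (intro Bochner_Integration.integral_diff i integrable_indicator_mult_lborel gi that) simp
    finally show "A t x = \<dots>" .
  qed

  have lip: "(LBINT x. (W t x - W s x)\<^sup>2) \<le> (t - s) * (LBINT z. (g z)\<^sup>2)"
    if st: "0 \<le> s" "s \<le> t" "t \<le> T" for s t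
  proof -
    let ?\<beta> = "\<lambda>r. \<alpha> t r - \<alpha> s r"
    \<comment> \<open>The means cancel in the increment, so that its weight is the indicator function of an interval of length \<open>t - s\<close>.\<close>
    have \<beta>: "(?\<beta> r)\<^sup>2 = indicator ({s..<t} \<inter> ?I) r" for r
      using st by (auto simp: \<alpha>_def indicator_def)
    have b1: "integrable lborel (\<lambda>r. (?\<beta> r)\<^sup>2)"
      unfolding \<beta> using st by (intro integrable_real_indicator) (auto intro: le_less_trans[OF emeasure_mono[of _ "{s..t}"]])
    have "(LBINT r. (?\<beta> r)\<^sup>2) = measure lborel ({s..<t} \<inter> ?I)"
      unfolding \<beta> by simp
    also have "\<dots> \<le> measure lborel {s..t}"
      by (rule measure_mono_fmeasurable) (use st in \<open>auto simp: fmeasurable_def\<close>)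
    finally have b2: "(LBINT r. (?\<beta> r)\<^sup>2) \<le> t - s" using st by simp
    note B = slice_integral_L2[OF gm _ g2 b1]
    have "(LBINT x. (W t x - W s x)\<^sup>2) = (LBINT x. (LBINT r. ?\<beta> r * g (r, x))\<^sup>2)"
    proof (rule integral_cong_AE)
      show "AE x in lborel. (W t x - W s x)\<^sup>2 = (LBINT r. ?\<beta> r * g (r, x))\<^sup>2"
        using good
      proof eventually_elim
        case (elim x)
        have "(LBINT r. ?\<beta> r * g (r, x)) = A t x - A s x"
          unfolding A_def left_diff_distrib
          by (rule Bochner_Integration.integral_diff) (rule \<alpha>gi[OF elim])+
        then show ?case by (simp add: W_def)
      qed
      show "(\<lambda>x. (LBINT r. ?\<beta> r * g (r, x))\<^sup>2) \<in> borel_measurable lborel"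
        using B(1) by simp
    qed (use Wm in measurable)
    also have "\<dots> \<le> (LBINT r. (?\<beta> r)\<^sup>2) * (LBINT z. (g z)\<^sup>2)"
      by (rule B(4)) auto
    also have "\<dots> \<le> (t - s) * (LBINT z. (g z)\<^sup>2)"
      by (intro mult_right_mono b2) simp
    finally show ?thesis .
  qed

  define Wp where "Wp z = W (fst z) (snd z)" for z
  have Wpm [measurable]: "Wp \<in> borel_measurable borel"
  proof -
    let ?L = "{z::(real \<times> 'b) \<times> real. snd z < fst (fst z)}"
    define H where "H z = (indicator ?I (snd z) * (indicator ?L z - \<kappa> (snd z))) * g (snd z, snd (fst z))" for z
    have s1: "(\<lambda>z::(real \<times> 'b) \<times> real. snd z) \<in> borel \<rightarrow>\<^sub>M borel"
      and s2: "(\<lambda>z::(real \<times> 'b) \<times> real. (snd z, snd (fst z))) \<in> borel \<rightarrow>\<^sub>M borel"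
      by (intro borel_measurable_continuous_onI continuous_intros)+
    have "?L \<in> sets borel" by (intro borel_open open_Collect_less continuous_intros)
    then have "H \<in> borel_measurable borel"
      unfolding H_def[abs_def]
      by (intro borel_measurable_times borel_measurable_diff borel_measurable_indicator
            measurable_compose[OF s1] measurable_compose[OF s2] gm \<kappa>m) auto
    then have "H \<in> borel_measurable (lborel \<Otimes>\<^sub>M lborel)" by (simp add: lborel_prod)
    then have "(\<lambda>z::real \<times> 'b. LBINT s. H (z, s)) \<in> borel_measurable lborel"
      by (intro lborel.borel_measurable_lebesgue_integral) simp
    also have "(\<lambda>z. LBINT s. H (z, s)) = (\<lambda>z. A (fst z) (snd z))"
      unfolding A_def \<alpha>_def H_def by (auto simp: indicator_def intro!: ext Bochner_Integration.integral_cong)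
    finally have [measurable]: "(\<lambda>z. A (fst z) (snd z)) \<in> borel_measurable (borel :: (real \<times> 'b) measure)" by simp
    have [measurable]: "(\<lambda>z::real \<times> 'b. c (snd z)) \<in> borel_measurable borel"
    proof -
      have sm: "snd \<in> (borel :: (real \<times> 'b) measure) \<rightarrow>\<^sub>M borel"
        by (intro borel_measurable_continuous_onI continuous_intros)
      have "c \<in> borel_measurable borel" by measurable
      from measurable_compose[OF sm this] show ?thesis .
    qed
    show ?thesis unfolding Wp_def[abs_def] W_def by (intro borel_measurable_add) measurable
  qed
  define D where "D x = 2 * (c x)\<^sup>2 + 2 * (T * (1 + M)\<^sup>2 * (LBINT t. (g (t, x))\<^sup>2))" for x
  have Di: "integrable lborel D"
    unfolding D_def[abs_def]
    using c(3) Fubini_lborel(5)[OF g2] by (intro Bochner_Integration.integrable_add integrable_mult_right) (simp_all add: c_def)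
  have WD: "(W t x)\<^sup>2 \<le> D x" if "good x" for t x
  proof -
    have "(A t x)\<^sup>2 \<le> (LBINT s. (\<alpha> t s)\<^sup>2) * (LBINT s. (g (s, x))\<^sup>2)"
      unfolding A_def by (rule Cauchy_Schwarz_integral[OF _ _ \<alpha>2(1)]) (use that in \<open>auto simp: good_def\<close>)
    also have "\<dots> \<le> T * (1 + M)\<^sup>2 * (LBINT s. (g (s, x))\<^sup>2)"
      by (intro mult_right_mono \<alpha>2(2)) simp
    finally have "(A t x)\<^sup>2 \<le> T * (1 + M)\<^sup>2 * (LBINT s. (g (s, x))\<^sup>2)" .
    moreover have "(W t x)\<^sup>2 \<le> 2 * (c x)\<^sup>2 + 2 * (A t x)\<^sup>2"
      using sum_squares_bound[of "c x" "A t x"] by (simp add: W_def power2_sum)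
    ultimately show ?thesis by (simp add: D_def)
  qed
  have goodz: "AE z in (lborel :: (real \<times> 'b) measure). good (snd z)" by (rule AE_lborel_snd[OF good])
  have Ii: "integrable lborel (indicator ?I :: real \<Rightarrow> real)" by (rule integrable_indicator_Ioo)
  \<comment> \<open>\<open>W\<close> does not vanish for times outside \<open>(0, T)\<close>, where it is constant in time; the truncation is square integrable over space-time.\<close>
  define V where "V z = indicator (?I \<times> UNIV) z * Wp z" for z
  have [measurable]: "V \<in> borel_measurable borel"
    unfolding V_def[abs_def]
    by (intro borel_measurable_times borel_measurable_indicator Wpm borel_open open_Times open_greaterThanLessThan open_UNIV)
  have V2: "integrable lborel (\<lambda>z. (V z)\<^sup>2)"
  proof (rule Bochner_Integration.integrable_bound)
    show "integrable lborel (\<lambda>z. indicator ?I (fst z) * D (snd z))"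
      by (rule integrable_tensor_lborel[OF Ii Di])
    show "AE z in lborel. norm ((V z)\<^sup>2) \<le> norm (indicator ?I (fst z) * D (snd z))"
      using goodz
    proof eventually_elim
      case (elim z)
      show ?case using WD[OF elim, of "fst z"]
        by (cases z) (auto simp: V_def Wp_def indicator_def)
    qed
  qed simp

  have tensor2: "integrable lborel (\<lambda>z. (\<eta> (fst z) * \<psi> (snd z))\<^sup>2)"
    and tensorm: "(\<lambda>z. \<eta> (fst z) * \<psi> (snd z)) \<in> borel_measurable borel"
    if \<eta>: "\<eta> \<in> test_fun ?I" and \<psi>: "\<psi> \<in> test_fun \<Omega>" for \<eta> \<psi>
    using test_fun_square_integrable(1)[OF test_fun_times[OF \<eta> \<psi>]] test_fun_borel[OF test_fun_times[OF \<eta> \<psi>]]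
    by auto

  have eq: "AE z in lborel. z \<in> ?I \<times> \<Omega> \<longrightarrow> w z - V z = 0"
  proof (rule AE_zero_on_open_Times[OF _ \<Omega>])
    show "integrable lborel (\<lambda>x. indicator (cbox a b) x * (w x - V x))" for a b
    proof (rule integrable_indicator_cbox_L2)
      show "integrable lborel (\<lambda>x. (w x - V x)\<^sup>2)"
        using integrable_add_L2[of w lborel "\<lambda>x. - V x"] w2 V2 by simp
    qed measurable
    fix \<eta> \<psi> assume \<eta>: "\<eta> \<in> test_fun ?I" and \<psi>: "\<psi> \<in> test_fun \<Omega>"
    define m where "m = (LBINT t. \<eta> t)"
    have \<eta>i: "integrable lborel \<eta>" by (rule test_fun_square_integrable[OF \<eta>])
    have \<zeta>: "(\<lambda>t. \<eta> t - m * \<eta>0 t) \<in> test_fun ?I" by (rule test_fun_cdiff[OF \<eta> \<eta>0])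
    have "(LBINT t. \<eta> t - m * \<eta>0 t) = 0"
      using \<eta>i \<eta>0i \<eta>01 by (simp add: m_def)
    then obtain \<theta> where \<theta>: "\<theta> \<in> test_fun ?I" and d\<theta>: "dir_deriv 1 \<theta> = (\<lambda>t. \<eta> t - m * \<eta>0 t)"
      using test_fun_primitive[OF \<zeta>] by blast
    have [measurable]: "\<eta> \<in> borel_measurable borel" "\<psi> \<in> borel_measurable borel" "\<theta> \<in> borel_measurable borel"
      using test_fun_borel \<eta> \<psi> \<theta> by auto
    note tm = tensorm[OF \<eta> \<psi>] tensorm[OF \<eta>0 \<psi>] tensorm[OF \<theta> \<psi>]
    note t2 = tensor2[OF \<eta> \<psi>] tensor2[OF \<eta>0 \<psi>] tensor2[OF \<theta> \<psi>]
    have wi: "integrable lborel (\<lambda>z. w z * (\<eta> (fst z) * \<psi> (snd z)))"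
        "integrable lborel (\<lambda>z. w z * (\<eta>0 (fst z) * \<psi> (snd z)))"
        "integrable lborel (\<lambda>z. g z * (\<theta> (fst z) * \<psi> (snd z)))"
        "integrable lborel (\<lambda>z. V z * (\<eta> (fst z) * \<psi> (snd z)))"
      using tm t2 w2 g2 V2 by (auto intro!: integrable_mult_L2)
    have "(LBINT z. w z * (\<eta> (fst z) * \<psi> (snd z))) - m * (LBINT z. w z * (\<eta>0 (fst z) * \<psi> (snd z)))
        = (LBINT z. w z * (\<eta> (fst z) * \<psi> (snd z)) - m * (w z * (\<eta>0 (fst z) * \<psi> (snd z))))"
      using wi by simp
    also have "\<dots> = (LBINT z. w z * (dir_deriv 1 \<theta> (fst z) * \<psi> (snd z)))"
      unfolding d\<theta> by (simp add: algebra_simps)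
    also have "\<dots> = - (LBINT z. g z * (\<theta> (fst z) * \<psi> (snd z)))" by (rule weak[OF \<theta> \<psi>])
    finally have w\<eta>: "(LBINT z. w z * (\<eta> (fst z) * \<psi> (snd z)))
        = m * (LBINT z. w z * (\<eta>0 (fst z) * \<psi> (snd z))) - (LBINT z. g z * (\<theta> (fst z) * \<psi> (snd z)))"
      by simp
    have "(LBINT z. V z * (\<eta> (fst z) * \<psi> (snd z))) = (LBINT x. LBINT t. V (t, x) * (\<eta> t * \<psi> x))"
      using Fubini_lborel(6)[OF wi(4)] by simp
    also have "\<dots> = (LBINT x. m * (LBINT t. w (t, x) * (\<eta>0 t * \<psi> x)) - (LBINT t. g (t, x) * (\<theta> t * \<psi> x)))"
    proof (rule integral_cong_AE)
      show "AE x in lborel. (LBINT t. V (t, x) * (\<eta> t * \<psi> x))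
         = m * (LBINT t. w (t, x) * (\<eta>0 t * \<psi> x)) - (LBINT t. g (t, x) * (\<theta> t * \<psi> x))"
        using good
      proof eventually_elim
        case (elim x)
        let ?g = "\<lambda>s. g (s, x)"
        let ?G = "\<lambda>t. LBINT s. indicator {..<t} s * ?g s"
        let ?k = "LBINT s. \<kappa> s * ?g s"
        note P = integral_primitive_mult[OF gi[OF elim] \<eta>i]
        have tail: "(LBINT t. indicator {s<..} t * \<eta> t) = m * \<kappa> s - \<theta> s" for s
        proof -
          have "(LBINT t. indicator {s<..} t * \<eta> t) - m * \<kappa> s
            = (LBINT t. indicator {s<..} t * \<eta> t - m * (indicator {s<..} t * \<eta>0 t))"
            unfolding \<kappa>_def using integrable_indicator_mult_lborel[OF \<eta>i, of "{s<..}"]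
              integrable_indicator_mult_lborel[OF \<eta>0i(1), of "{s<..}"] by simp
          also have "\<dots> = (LBINT t. indicator {s<..} t * dir_deriv 1 \<theta> t)"
            unfolding d\<theta> by (simp add: algebra_simps)
          also have "\<dots> = - \<theta> s" by (rule integral_tail_deriv_test_fun[OF \<theta>])
          finally show ?thesis by simp
        qed
        have \<theta>gi: "integrable lborel (\<lambda>s. ?g s * \<theta> s)"
          by (rule integrable_mult_L2)
             (use elim test_fun_square_integrable(1)[OF \<theta>] in \<open>auto simp: good_def\<close>)
        have "(LBINT t. V (t, x) * \<eta> t) = (LBINT t. (c x - ?k) * \<eta> t + ?G t * \<eta> t)"
        proof (rule Bochner_Integration.integral_cong)
          show "V (t, x) * \<eta> t = (c x - ?k) * \<eta> t + ?G t * \<eta> t" for t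
            using test_funD(6)[OF \<eta>, of t]
            by (cases "t \<in> ?I") (auto simp: V_def Wp_def W_def AG[OF elim] algebra_simps)
        qed simp
        also have "\<dots> = (c x - ?k) * m + (LBINT t. ?G t * \<eta> t)"
          using P(2) \<eta>i by (simp add: m_def)
        also have "(LBINT t. ?G t * \<eta> t) = (LBINT s. m * (\<kappa> s * ?g s) - ?g s * \<theta> s)"
          unfolding P(1) tail by (simp add: algebra_simps)
        also have "\<dots> = m * ?k - (LBINT s. ?g s * \<theta> s)"
          using \<kappa>gi[OF elim] \<theta>gi by simp
        finally have "(LBINT t. V (t, x) * \<eta> t) = m * c x - (LBINT s. ?g s * \<theta> s)"
          by (simp add: algebra_simps)
        moreover have "(LBINT t. V (t, x) * (\<eta> t * \<psi> x)) = (LBINT t. V (t, x) * \<eta> t) * \<psi> x"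
          by (simp add: mult.assoc[symmetric])
        moreover have "(LBINT t. w (t, x) * (\<eta>0 t * \<psi> x)) = c x * \<psi> x"
        proof -
          have "(LBINT t. w (t, x) * (\<eta>0 t * \<psi> x)) = (LBINT t. (\<eta>0 t * w (t, x)) * \<psi> x)"
            by (simp only: ac_simps)
          then show ?thesis unfolding c_def by simp
        qed
        moreover have "(LBINT t. g (t, x) * (\<theta> t * \<psi> x)) = (LBINT s. ?g s * \<theta> s) * \<psi> x"
          by (simp add: mult.assoc[symmetric])
        ultimately show ?case by (simp only: left_diff_distrib mult.assoc)
      qed
      show "(\<lambda>x. LBINT t. V (t, x) * (\<eta> t * \<psi> x)) \<in> borel_measurable lborel"
        using Fubini_lborel(5)[OF wi(4)] by auto
      show "(\<lambda>x. m * (LBINT t. w (t, x) * (\<eta>0 t * \<psi> x)) - (LBINT t. g (t, x) * (\<theta> t * \<psi> x))) \<in> borel_measurable lborel"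
        using Fubini_lborel(5)[OF wi(2)] Fubini_lborel(5)[OF wi(3)] by auto
    qed
    also have "\<dots> = m * (LBINT z. w z * (\<eta>0 (fst z) * \<psi> (snd z))) - (LBINT z. g z * (\<theta> (fst z) * \<psi> (snd z)))"
      using Fubini_lborel(5,6)[OF wi(2)] Fubini_lborel(5,6)[OF wi(3)] by simp
    finally show "(LBINT z. (w z - V z) * (\<eta> (fst z) * \<psi> (snd z))) = 0"
      using w\<eta> wi by (simp add: left_diff_distrib)
  qed auto

  have energy: "(LBINT x. (W T x)\<^sup>2) - (LBINT x. (W 0 x)\<^sup>2) = 2 * (LBINT z. w z * g z)"
  proof -
    have Vg: "integrable lborel (\<lambda>z. V z * g z)"
      by (rule integrable_mult_L2) (use V2 g2 in auto)
    have "(LBINT x. (W T x)\<^sup>2) - (LBINT x. (W 0 x)\<^sup>2) = (LBINT x. (W T x)\<^sup>2 - (W 0 x)\<^sup>2)"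
      using W2 by simp
    also have "\<dots> = (LBINT x. 2 * (LBINT t. V (t, x) * g (t, x)))"
    proof (rule integral_cong_AE)
      show "AE x in lborel. (W T x)\<^sup>2 - (W 0 x)\<^sup>2 = 2 * (LBINT t. V (t, x) * g (t, x))"
        using good
      proof eventually_elim
        case (elim x)
        let ?g = "\<lambda>s. g (s, x)"
        let ?G = "\<lambda>t. LBINT s. indicator {..<t} s * ?g s"
        define C where "C = c x - (LBINT s. \<kappa> s * ?g s)"
        note gx = gi[OF elim]
        have W: "W t x = C + ?G t" for t by (simp add: W_def AG[OF elim] C_def)
        have "?G 0 = (LINT s|(lborel :: real measure). 0)"
        proof (rule Bochner_Integration.integral_cong)
          show "indicator {..<0} s * ?g s = 0" for s
            using gz[of "(s, x)"] by (cases "s \<in> ?I") auto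
        qed simp
        then have G0: "?G 0 = 0" by simp
        have GT: "?G T = (LBINT s. ?g s)"
        proof (rule Bochner_Integration.integral_cong)
          show "indicator {..<T} s * ?g s = ?g s" for s
            using gz[of "(s, x)"] by (cases "s \<in> ?I") auto
        qed simp
        have "(LBINT t. V (t, x) * g (t, x)) = (LBINT t. C * ?g t + ?G t * ?g t)"
        proof (rule Bochner_Integration.integral_cong)
          show "V (t, x) * g (t, x) = C * ?g t + ?G t * ?g t" for t
            using gz[of "(t, x)"] by (cases "t \<in> ?I") (auto simp: V_def Wp_def W algebra_simps)
        qed simp
        also have "\<dots> = C * (LBINT s. ?g s) + (LBINT t. ?G t * ?g t)"
          using gx integral_primitive_mult(2)[OF gx gx] by simp
        finally show ?case
          using integral_primitive_mult_self[OF gx]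
          unfolding W G0 GT by (simp add: power2_sum algebra_simps)
      qed
      show "(\<lambda>x. (W T x)\<^sup>2 - (W 0 x)\<^sup>2) \<in> borel_measurable lborel" using Wm by measurable
      show "(\<lambda>x. 2 * (LBINT t. V (t, x) * g (t, x))) \<in> borel_measurable lborel"
        using Fubini_lborel(5)[OF Vg] by auto
    qed
    also have "\<dots> = 2 * (LBINT z. V z * g z)"
      using Fubini_lborel(6)[OF Vg] by simp
    also have "(LBINT z. V z * g z) = (LBINT z. w z * g z)"
    proof (rule integral_cong_AE)
      show "AE z in lborel. V z * g z = w z * g z"
        using eq by eventually_elim (use gz in auto)
    qed auto
    finally show ?thesis .
  qed

  show ?thesis
  proof (rule that[OF Wm Wz W2 lip _ energy])
    show "AE z in lborel. z \<in> ?I \<times> \<Omega> \<longrightarrow> w z = W (fst z) (snd z)"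
      using eq by eventually_elim (auto simp: V_def Wp_def)
  qed
qed


section \<open>Separability and slices in time\<close>

lemma integrable_indicator_cball:
  "integrable lborel (indicator (cball x r) :: 'a::euclidean_space \<Rightarrow> real)"
proof -
  have "emeasure lborel (cball x r) < \<infinity>" by (rule emeasure_bounded_finite) simp
  then show ?thesis by (intro integrable_real_indicator) auto
qed

text \<open>
  One natural number bounds the size, the Lipschitz constant and the support at once, so that a set of tame
  functions is a countable union of sets of equicontinuous functions.
\<close>

definition tame :: "nat \<Rightarrow> ('a::real_normed_vector \<Rightarrow> 'b::real_normed_vector) \<Rightarrow> bool" where
  "tame N j \<longleftrightarrow> (\<forall>x. norm (j x) \<le> real N) \<and> (\<forall>x y. norm (j x - j y) \<le> real N * norm (x - y)) \<and>
     (\<forall>x. x \<notin> cball 0 (real N) \<longrightarrow> j x = 0)"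

lemma tameD:
  assumes "tame N j"
  shows "norm (j x) \<le> real N" "norm (j x - j y) \<le> real N * norm (x - y)" "x \<notin> cball 0 (real N) \<Longrightarrow> j x = 0"
  using assms by (auto simp: tame_def)

text \<open>
  An \<open>N\<close>-tame function is determined by its values on a countable dense set. The space of sequences is metrisable and
  second countable, so every subset of it is separable, and equicontinuity upgrades convergence on the dense set to convergence
  everywhere. The approximating functions are tame with the same \<open>N\<close>, hence dominated.
\<close>

lemma countable_pointwise_dense:
  fixes X :: "('a::euclidean_space \<Rightarrow> 'b::euclidean_space) set"
  assumes X: "\<And>j. j \<in> X \<Longrightarrow> \<exists>N. tame N j"
  obtains C where "countable C" "C \<subseteq> X"
    "\<And>j. j \<in> X \<Longrightarrow> \<exists>(N::nat) jk. (\<forall>k. jk k \<in> C) \<and> (\<forall>k x. norm (jk k x) \<le> real N * indicator (cball 0 (real N)) x) \<and>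
        (\<forall>x. (\<lambda>k. jk k x) \<longlonglongrightarrow> j x)"
proof -
  obtain D :: "'a set" where D: "countable D" "\<And>U. open U \<Longrightarrow> U \<noteq> {} \<Longrightarrow> \<exists>d\<in>D. d \<in> U"
  proof -
    obtain D :: "'a set" where "countable D" "\<forall>U. open U \<longrightarrow> U \<noteq> {} \<longrightarrow> (\<exists>d\<in>D. d \<in> U)"
      using countable_dense_exists by auto
    then show ?thesis by (intro that[of D]) auto
  qed
  have "D \<noteq> {}" using D(2)[of UNIV] by auto
  define d where "d = from_nat_into D"
  have d: "range d = D" unfolding d_def using D(1) \<open>D \<noteq> {}\<close> by (rule range_from_nat_into[rotated])
  define E where "E j n = j (d n)" for j :: "'a \<Rightarrow> 'b" and n :: nat
  define S where "S N = (SOME S. countable S \<and> S \<subseteq> E ` {j \<in> X. tame N j} \<and> E ` {j \<in> X. tame N j} \<subseteq> closure S)" for N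
  have ex: "\<exists>S. countable S \<and> S \<subseteq> E ` {j \<in> X. tame N j} \<and> E ` {j \<in> X. tame N j} \<subseteq> closure S" for N
    by (rule separable[of "E ` {j \<in> X. tame N j}"]) blast
  have S: "countable (S N)" "S N \<subseteq> E ` {j \<in> X. tame N j}" "E ` {j \<in> X. tame N j} \<subseteq> closure (S N)" for N
    using someI_ex[OF ex, of N] unfolding S_def by auto
  define r where "r N = inv_into {j \<in> X. tame N j} E" for N
  have r: "r N e \<in> X" "tame N (r N e)" "E (r N e) = e" if "e \<in> S N" for N e
  proof -
    have "e \<in> E ` {j \<in> X. tame N j}" using S(2) that by blast
    then show "r N e \<in> X" "tame N (r N e)" "E (r N e) = e"
      using inv_into_into[of e E "{j \<in> X. tame N j}"] f_inv_into_f[of e E "{j \<in> X. tame N j}"]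
      by (auto simp: r_def)
  qed
  define C where "C = (\<Union>N. r N ` S N)"
  show ?thesis
  proof (rule that)
    show "countable C" unfolding C_def using S(1) by auto
    show "C \<subseteq> X" unfolding C_def using r(1) by auto
    fix j assume j: "j \<in> X"
    obtain N where N: "tame N j" using X[OF j] by blast
    then have "E j \<in> closure (S N)" using S(3) j by blast
    then obtain e where e: "\<And>k. e k \<in> S N" "e \<longlonglongrightarrow> E j" unfolding closure_sequential by blast
    define jk where "jk k = r N (e k)" for k :: nat
    have jk: "jk k \<in> C" "tame N (jk k)" "E (jk k) = e k" for k
    proof -
      show "tame N (jk k)" "E (jk k) = e k" using r[OF e(1)] by (auto simp: jk_def)
      show "jk k \<in> C" unfolding jk_def C_def using e(1)[of k] by blast
    qed
    have lim: "(\<lambda>k. jk k x) \<longlonglongrightarrow> j x" for x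
    proof (rule metric_LIMSEQ_I)
      fix \<epsilon> :: real assume "\<epsilon> > 0"
      define \<delta> where "\<delta> = \<epsilon> / (4 * (real N + 1))"
      have "\<delta> > 0" using \<open>\<epsilon> > 0\<close> by (simp add: \<delta>_def)
      then obtain n where n: "d n \<in> ball x \<delta>" using D(2)[of "ball x \<delta>"] d by force
      have "real N * norm (x - d n) \<le> real N * \<delta>"
        using n by (intro mult_left_mono) (auto simp: dist_norm)
      also have "\<dots> \<le> \<epsilon> / 4"
        using \<open>\<epsilon> > 0\<close> by (simp add: \<delta>_def field_simps)
      finally have small: "real N * norm (x - d n) \<le> \<epsilon> / 4" .
      have "(\<lambda>k. e k n) \<longlonglongrightarrow> E j n"
        using continuous_on_tendsto_compose[OF continuous_on_product_coordinates e(2), of n] by simp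
      then have "(\<lambda>k. jk k (d n)) \<longlonglongrightarrow> j (d n)" using jk(3) by (simp add: E_def fun_eq_iff)
      then obtain K where K: "\<And>k. k \<ge> K \<Longrightarrow> dist (jk k (d n)) (j (d n)) < \<epsilon> / 4"
        using metric_LIMSEQ_D[of _ _ "\<epsilon> / 4"] \<open>\<epsilon> > 0\<close> by fastforce
      have "dist (jk k x) (j x) < \<epsilon>" if "k \<ge> K" for k
      proof -
        have "dist (jk k x) (j x) \<le> dist (jk k x) (jk k (d n)) + dist (jk k (d n)) (j (d n)) + dist (j (d n)) (j x)"
          using dist_triangle[of "jk k x" "j x" "jk k (d n)"] dist_triangle[of "jk k (d n)" "j x" "j (d n)"] by linarith
        moreover have "dist (jk k x) (jk k (d n)) \<le> real N * norm (x - d n)" "dist (j (d n)) (j x) \<le> real N * norm (x - d n)"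
          using tameD(2)[OF jk(2), of k x "d n"] tameD(2)[OF N, of x "d n"]
          unfolding dist_norm by (simp_all add: norm_minus_commute)
        ultimately show ?thesis using K[OF that] small \<open>\<epsilon> > 0\<close> by linarith
      qed
      then show "\<exists>no. \<forall>k\<ge>no. dist (jk k x) (j x) < \<epsilon>" by blast
    qed
    have "norm (jk k x) \<le> real N * indicator (cball 0 (real N)) x" for k x
      using tameD(1,3)[OF jk(2)[of k], of x] by (cases "x \<in> cball 0 (real N)") auto
    then show "\<exists>(N::nat) jk. (\<forall>k. jk k \<in> C) \<and> (\<forall>k x. norm (jk k x) \<le> real N * indicator (cball 0 (real N)) x) \<and>
        (\<forall>x. (\<lambda>k. jk k x) \<longlonglongrightarrow> j x)"
      using jk(1) lim by blast
  qed
qed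

text \<open>
  For a single \<open>j\<close>, the function \<open>t \<mapsto> \<integral> H(t, x) \<bullet> j(x) dx\<close> is orthogonal to all test functions on \<open>(0, T)\<close> and
  vanishes for almost every \<open>t\<close>. The exceptional null sets are united over a countable dense set of functions \<open>j\<close>, and the
  remaining ones are reached by dominated convergence at fixed \<open>t\<close>.
\<close>

lemma AE_slice_orthogonal:
  fixes H :: "real \<times> 'b::euclidean_space \<Rightarrow> 'c::euclidean_space" and X :: "('b \<Rightarrow> 'c) set"
  assumes Hm [measurable]: "H \<in> borel_measurable borel"
    and H2: "integrable lborel (\<lambda>z. (norm (H z))\<^sup>2)"
    and Hz: "\<And>z. fst z \<notin> {0<..<T} \<Longrightarrow> H z = 0" and T: "T > 0"
    and X: "\<And>j. j \<in> X \<Longrightarrow> \<exists>N. tame N j"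
    and weak: "\<And>\<eta> j. \<eta> \<in> test_fun {0<..<T} \<Longrightarrow> j \<in> X \<Longrightarrow> (LBINT z. \<eta> (fst z) * (H z \<bullet> j (snd z))) = 0"
  shows "AE t in lborel. t \<in> {0<..<T} \<longrightarrow> (\<forall>j\<in>X. (LBINT x. H (t, x) \<bullet> j x) = 0)"
proof -
  let ?I = "{0<..<T} :: real set"
  have jm: "j \<in> borel_measurable borel" if jX: "j \<in> X" for j
  proof -
    obtain N where "tame N j" using X[OF jX] by blast
    then have "(real N)-lipschitz_on UNIV j" by (auto simp: lipschitz_on_def dist_norm tame_def)
    then show ?thesis by (intro borel_measurable_continuous_onI lipschitz_on_continuous_on)
  qed
  have Ii: "integrable lborel (indicator ?I :: real \<Rightarrow> real)" by (rule integrable_indicator_Ioo)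
  have cb2: "integrable lborel (\<lambda>x::'b. (c * indicator (cball 0 r) x)\<^sup>2)" for c r :: real
  proof -
    have "(\<lambda>x::'b. (c * indicator (cball 0 r) x)\<^sup>2) = (\<lambda>x. c\<^sup>2 * indicator (cball 0 r) x)"
      by (auto simp: indicator_def)
    moreover have "integrable lborel (indicator (cball 0 r) :: 'b \<Rightarrow> real)"
      by (simp add: integrable_indicator_cball)
    ultimately show ?thesis by simp
  qed
  have pairing: "integrable lborel (\<lambda>z. H z \<bullet> j (snd z))" if jX: "j \<in> X" for j
  proof -
    obtain N where "tame N j" using X[OF jX] by blast
    note N = tameD(1,3)[OF this]
    let ?b = "\<lambda>z::real \<times> 'b. indicator ?I (fst z) * (real N * indicator (cball 0 (real N)) (snd z)) :: real"
    have [measurable]: "(\<lambda>z::real \<times> 'b. j (snd z)) \<in> borel_measurable borel"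
      by (rule measurable_compose[OF _ jm[OF jX]]) (intro borel_measurable_continuous_onI continuous_intros)
    have "integrable lborel (\<lambda>z::real \<times> 'b. indicator ?I (fst z) * (real N * indicator (cball 0 (real N)) (snd z))\<^sup>2)"
      by (rule integrable_tensor_lborel[OF Ii cb2])
    moreover have "(\<lambda>z::real \<times> 'b. indicator ?I (fst z) * (real N * indicator (cball 0 (real N)) (snd z))\<^sup>2) = (\<lambda>z. (?b z)\<^sup>2)"
      by (auto simp: indicator_def)
    ultimately have b2: "integrable lborel (\<lambda>z. (?b z)\<^sup>2)" by simp
    have bm: "?b \<in> borel_measurable borel"
      using borel_measurable_integrable[OF integrable_tensor_lborel[OF Ii, of "\<lambda>x. real N * indicator (cball 0 (real N)) x"]]
      by (simp add: integrable_indicator_cball)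
    have "integrable lborel (\<lambda>z. norm (H z) * ?b z)"
      by (rule integrable_mult_L2) (use H2 b2 bm in auto)
    then show ?thesis
    proof (rule Bochner_Integration.integrable_bound)
      show "AE z in lborel. norm (H z \<bullet> j (snd z)) \<le> norm (norm (H z) * ?b z)"
      proof (rule AE_I2)
        fix z :: "real \<times> 'b"
        have "norm (H z \<bullet> j (snd z)) \<le> norm (H z) * norm (j (snd z))"
          using Cauchy_Schwarz_ineq2 by simp
        also have "\<dots> \<le> norm (H z) * ?b z"
        proof (cases "fst z \<in> ?I")
          case True
          then show ?thesis
            using N[of "snd z"] by (intro mult_left_mono) (auto simp: indicator_def)
        qed (simp add: Hz)
        finally show "norm (H z \<bullet> j (snd z)) \<le> norm (norm (H z) * ?b z)" by simp
      qed
    qed measurable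
  qed
  obtain C where C: "countable C" "C \<subseteq> X"
    "\<And>j. j \<in> X \<Longrightarrow> \<exists>(N::nat) jk. (\<forall>k. jk k \<in> C) \<and> (\<forall>k x. norm (jk k x) \<le> real N * indicator (cball 0 (real N)) x) \<and>
        (\<forall>x. (\<lambda>k. jk k x) \<longlonglongrightarrow> j x)"
    using countable_pointwise_dense[OF X] by blast
  have "AE t in lborel. t \<in> ?I \<longrightarrow> (LBINT x. H (t, x) \<bullet> j x) = 0" if j: "j \<in> X" for j
  proof (rule AE_zero_on_open)
    note i = pairing[OF j]
    have i': "integrable lborel (\<lambda>t. LBINT x. H (t, x) \<bullet> j x)"
      using Fubini_lborel(2)[OF i] by simp
    then show "(\<lambda>t. LBINT x. H (t, x) \<bullet> j x) \<in> borel_measurable borel" by auto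
    show "integrable lborel (\<lambda>t. indicator (cbox a c) t * (LBINT x. H (t, x) \<bullet> j x))" for a c
      by (rule integrable_indicator_mult_lborel[OF i']) simp
    fix a c :: real and k
    assume ac: "cbox a c \<subseteq> ?I"
    let ?\<eta> = "box_bump a c k"
    have \<eta>: "?\<eta> \<in> test_fun ?I" by (rule test_fun_box_bump[OF ac])
    have "integrable lborel (\<lambda>z. ?\<eta> (fst z) * (H z \<bullet> j (snd z)))"
    proof (rule Bochner_Integration.integrable_bound[OF i])
      have [measurable]: "(\<lambda>z::real \<times> 'b. ?\<eta> (fst z)) \<in> borel_measurable borel"
        by (rule measurable_compose[OF _ test_fun_borel[OF \<eta>]])
           (intro borel_measurable_continuous_onI continuous_intros)
      show "(\<lambda>z. ?\<eta> (fst z) * (H z \<bullet> j (snd z))) \<in> borel_measurable lborel"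
        using borel_measurable_integrable[OF i] by measurable
      show "AE z in lborel. norm (?\<eta> (fst z) * (H z \<bullet> j (snd z))) \<le> norm (H z \<bullet> j (snd z))"
        using box_bump_bounds[of a c k] by (auto simp: abs_mult intro!: mult_left_le_one_le)
    qed
    from Fubini_lborel(3)[OF this] weak[OF \<eta> j]
    show "(LBINT t. (LBINT x. H (t, x) \<bullet> j x) * ?\<eta> t) = 0"
      by (simp add: mult.commute)
  qed simp
  then have "AE t in lborel. \<forall>j\<in>C. t \<in> ?I \<longrightarrow> (LBINT x. H (t, x) \<bullet> j x) = 0"
    using C(1,2) by (subst AE_ball_countable) auto
  moreover have "AE t in lborel. integrable lborel (\<lambda>x. (norm (H (t, x)))\<^sup>2)"
    by (rule Fubini_lborel(1)[OF H2])
  ultimately show ?thesis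
  proof eventually_elim
    case (elim t)
    show ?case
    proof (intro impI ballI)
      fix j assume t: "t \<in> ?I" and j: "j \<in> X"
      obtain N :: nat and jk where jk: "\<And>k. jk k \<in> C" "\<And>k x. norm (jk k x) \<le> real N * indicator (cball 0 (real N)) x"
        "\<And>x. (\<lambda>k. jk k x) \<longlonglongrightarrow> j x"
        using C(3)[OF j] by blast
      have [measurable]: "j \<in> borel_measurable borel" "jk k \<in> borel_measurable borel" for k
        using jm j jk(1) C(2) by auto
      have [measurable]: "(\<lambda>x. H (t, x)) \<in> borel_measurable borel"
        by (rule borel_measurable_slice[OF Hm])
      have "(\<lambda>k. LBINT x. H (t, x) \<bullet> jk k x) \<longlonglongrightarrow> (LBINT x. H (t, x) \<bullet> j x)"
      proof (rule integral_dominated_convergence)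
        show "integrable lborel (\<lambda>x. norm (H (t, x)) * (real N * indicator (cball 0 (real N)) x))"
        proof (rule integrable_mult_L2)
          show "(\<lambda>x::'b. real N * indicator (cball 0 (real N)) x) \<in> borel_measurable lborel"
            by (intro borel_measurable_times borel_measurable_const borel_measurable_indicator) simp
        qed (use elim(2) cb2 in auto)
        show "AE x in lborel. (\<lambda>k. H (t, x) \<bullet> jk k x) \<longlonglongrightarrow> H (t, x) \<bullet> j x"
          by (intro AE_I2 tendsto_intros jk(3))
        show "AE x in lborel. norm (H (t, x) \<bullet> jk k x) \<le> norm (H (t, x)) * (real N * indicator (cball 0 (real N)) x)" for k
        proof (rule AE_I2)
          fix x
          have "norm (H (t, x) \<bullet> jk k x) \<le> norm (H (t, x)) * norm (jk k x)"
            using Cauchy_Schwarz_ineq2 by simp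
          also have "\<dots> \<le> norm (H (t, x)) * (real N * indicator (cball 0 (real N)) x)"
            by (rule mult_left_mono[OF jk(2)]) simp
          finally show "norm (H (t, x) \<bullet> jk k x) \<le> norm (H (t, x)) * (real N * indicator (cball 0 (real N)) x)" .
        qed
      qed measurable
      moreover have "(LBINT x. H (t, x) \<bullet> jk k x) = 0" for k
        using elim(1) jk(1) t by blast
      ultimately show "(LBINT x. H (t, x) \<bullet> j x) = 0" by (simp add: LIMSEQ_const_iff)
    qed
  qed
qed

lemma test_fun_Lipschitz:
  fixes \<phi> :: "'a::euclidean_space \<Rightarrow> real"
  assumes \<phi>: "\<phi> \<in> test_fun S"
  obtains L where "L \<ge> 0" "\<And>x y. \<bar>\<phi> x - \<phi> y\<bar> \<le> L * norm (x - y)"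
proof -
  have "\<exists>B>0. \<forall>x. \<bar>dir_deriv b \<phi> x\<bar> \<le> B" for b
    using test_fun_bounded[OF test_fun_dir_deriv[OF \<phi>, of b]] by metis
  then obtain B where B: "\<And>b. B b > 0" "\<And>b x. \<bar>dir_deriv b \<phi> x\<bar> \<le> B b" by metis
  let ?L = "\<Sum>b\<in>(Basis::'a set). B b"
  have "\<bar>\<phi> x - \<phi> y\<bar> \<le> ?L * norm (x - y)" for x y
  proof -
    have "norm (\<phi> x - \<phi> y) \<le> ?L * norm (x - y)"
    proof (rule differentiable_bound[of UNIV \<phi> "\<lambda>x v. dir_deriv v \<phi> x"])
      show "(\<phi> has_derivative (\<lambda>v. dir_deriv v \<phi> z)) (at z within UNIV)" for z
        by (intro has_derivative_frechet test_funD[OF \<phi>])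
      show "onorm (\<lambda>v. dir_deriv v \<phi> z) \<le> ?L" for z
      proof (rule onorm_le)
        fix v
        have "norm (dir_deriv v \<phi> z) \<le> (\<Sum>b\<in>Basis. \<bar>(v \<bullet> b) * dir_deriv b \<phi> z\<bar>)"
          unfolding dir_deriv_linear[OF test_funD(4)[OF \<phi>], of v] by (simp add: sum_abs)
        also have "\<dots> \<le> (\<Sum>b\<in>Basis. norm v * B b)"
          unfolding abs_mult by (intro sum_mono mult_mono B Basis_le_norm) auto
        finally show "norm (dir_deriv v \<phi> z) \<le> ?L * norm v"
          by (simp add: sum_distrib_left mult.commute)
      qed
    qed auto
    then show ?thesis by simp
  qed
  moreover have "?L \<ge> 0" by (intro sum_nonneg less_imp_le B(1))
  ultimately show ?thesis by (intro that[of ?L])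
qed

text \<open>
  The weak formulation only sees \<open>\<psi>\<close> through the pair \<open>(\<psi>, \<nabla>\<psi>)\<close>. It is this pair, not \<open>\<psi>\<close> alone, that has
  to be approximated pointwise by countably many test functions.
\<close>

definition jet :: "(real^'n \<Rightarrow> real) \<Rightarrow> real^'n \<Rightarrow> real \<times> (real^'n)" where
  "jet \<psi> x = (\<psi> x, \<chi> i. dir_deriv (axis i 1) \<psi> x)"

lemma inner_jet: "(a, F) \<bullet> jet \<psi> x = a * \<psi> x + (\<Sum>i\<in>UNIV. F $ i * dir_deriv (axis i 1) \<psi> x)"
  by (simp add: jet_def inner_prod_def inner_vec_def)

lemma norm_jet_bound:
  fixes s :: real
  assumes "\<bar>s\<bar> \<le> a" "\<And>i. \<bar>v $ i\<bar> \<le> b i"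
  shows "norm (s, v :: real^'n) \<le> a + (\<Sum>i\<in>UNIV. b i)"
proof -
  have "norm (s, v) \<le> norm s + norm v" by (rule norm_Pair_le)
  also have "norm v \<le> (\<Sum>i\<in>UNIV. \<bar>v $ i\<bar>)" by (rule norm_le_l1_cart)
  also have "\<dots> \<le> (\<Sum>i\<in>UNIV. b i)" by (intro sum_mono assms)
  finally show ?thesis using assms(1) by simp
qed

lemma jet_tame:
  fixes \<psi> :: "real^'n \<Rightarrow> real"
  assumes \<psi>: "\<psi> \<in> test_fun S"
  shows "\<exists>N. tame N (jet \<psi>)"
proof -
  let ?D = "\<lambda>i. dir_deriv (axis i 1) \<psi>"
  have D: "?D i \<in> test_fun S" for i by (rule test_fun_dir_deriv[OF \<psi>])
  obtain B where B: "\<And>x. \<bar>\<psi> x\<bar> \<le> B" using test_fun_bounded[OF \<psi>] by blast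
  obtain L where L: "\<And>x y. \<bar>\<psi> x - \<psi> y\<bar> \<le> L * norm (x - y)" using test_fun_Lipschitz[OF \<psi>] by blast
  have "\<exists>B. \<forall>x. \<bar>?D i x\<bar> \<le> B" for i using test_fun_bounded[OF D] by metis
  then obtain B' where B': "\<And>i x. \<bar>?D i x\<bar> \<le> B' i" by metis
  have "\<exists>L. \<forall>x y. \<bar>?D i x - ?D i y\<bar> \<le> L * norm (x - y)" for i using test_fun_Lipschitz[OF D] by metis
  then obtain L' where L': "\<And>i x y. \<bar>?D i x - ?D i y\<bar> \<le> L' i * norm (x - y)" by metis
  let ?K = "closure {x. \<psi> x \<noteq> 0}"
  have "bounded ?K" using test_funD(2)[OF \<psi>] compact_imp_bounded by blast
  then obtain R where R: "\<And>x. x \<in> ?K \<Longrightarrow> norm x \<le> R" unfolding bounded_iff by blast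
  obtain N :: nat where N: "N \<ge> B + (\<Sum>i\<in>UNIV. B' i)" "N \<ge> L + (\<Sum>i\<in>UNIV. L' i)" "N \<ge> R"
    using real_arch_simple[of "max (max (B + (\<Sum>i\<in>UNIV. B' i)) (L + (\<Sum>i\<in>UNIV. L' i))) R"] by auto
  show ?thesis
    unfolding tame_def
  proof (intro exI[of _ N] conjI allI impI)
    fix x y
    have "norm (jet \<psi> x) \<le> B + (\<Sum>i\<in>UNIV. B' i)"
      unfolding jet_def by (rule norm_jet_bound) (auto simp: B B')
    then show "norm (jet \<psi> x) \<le> N" using N by simp
    have "norm (jet \<psi> x - jet \<psi> y) \<le> L * norm (x - y) + (\<Sum>i\<in>UNIV. L' i * norm (x - y))"
      unfolding jet_def diff_Pair by (rule norm_jet_bound) (auto simp: L L')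
    also have "\<dots> = (L + (\<Sum>i\<in>UNIV. L' i)) * norm (x - y)"
      by (simp add: sum_distrib_right distrib_right)
    also have "\<dots> \<le> N * norm (x - y)" by (intro mult_right_mono N) simp
    finally show "norm (jet \<psi> x - jet \<psi> y) \<le> N * norm (x - y)" .
  next
    fix x :: "real^'n" assume "x \<notin> cball 0 (real N)"
    then have x: "x \<notin> ?K" using R[of x] N(3) by auto
    have "\<psi> x = 0" by (rule zero_outside_support[OF x])
    moreover have "?D i x = 0" for i by (rule dir_deriv_zero_outside[OF x])
    ultimately show "jet \<psi> x = 0" by (simp add: jet_def zero_prod_def vec_eq_iff)
  qed
qed

text \<open>
  The difference quotients in direction \<open>v\<close> have integral zero by translation invariance, and they converge boundedly.
\<close>

lemma integral_dir_deriv_test_fun: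
  fixes \<phi> :: "'a::euclidean_space \<Rightarrow> real"
  assumes \<phi>: "\<phi> \<in> test_fun S"
  shows "(LBINT x. dir_deriv v \<phi> x) = 0"
proof -
  obtain L where L: "L \<ge> 0" "\<And>x y. \<bar>\<phi> x - \<phi> y\<bar> \<le> L * norm (x - y)" using test_fun_Lipschitz[OF \<phi>] by blast
  have [measurable]: "\<phi> \<in> borel_measurable borel" "dir_deriv v \<phi> \<in> borel_measurable borel"
    using test_fun_borel[OF \<phi>] test_fun_borel[OF test_fun_dir_deriv[OF \<phi>]] by auto
  let ?K = "closure {x. \<phi> x \<noteq> 0}"
  have "bounded ?K" using test_funD(2)[OF \<phi>] compact_imp_bounded by blast
  then obtain R where R: "\<And>x. x \<in> ?K \<Longrightarrow> norm x \<le> R" unfolding bounded_iff by blast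
  have z: "\<phi> x = 0" if "norm x > R" for x
    using that R[of x] zero_outside_support[of x \<phi>] by (cases "x \<in> ?K") auto
  define h where "h k = 1 / real (Suc k)" for k
  have h: "h k > 0" "h k \<le> 1" for k by (auto simp: h_def)
  have h0: "h \<longlonglongrightarrow> 0" unfolding h_def by (rule LIMSEQ_Suc[OF lim_1_over_n])
  define q where "q k x = (\<phi> (h k *\<^sub>R v + x) - \<phi> x) / h k" for k x
  have qi: "(LBINT x. q k x) = 0" for k
  proof -
    have \<phi>i: "integrable lborel \<phi>" by (rule test_fun_square_integrable[OF \<phi>])
    have "integrable (distr lborel borel ((+) (h k *\<^sub>R v))) \<phi>" using \<phi>i by (simp add: lborel_distr_plus)
    then have i: "integrable lborel (\<lambda>x. \<phi> (h k *\<^sub>R v + x))" by (subst (asm) integrable_distr_eq) auto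
    have "(LBINT x. \<phi> x) = (LINT x|distr lborel borel ((+) (h k *\<^sub>R v)). \<phi> x)" by (simp add: lborel_distr_plus)
    also have "\<dots> = (LBINT x. \<phi> (h k *\<^sub>R v + x))" by (rule integral_distr) auto
    finally show ?thesis using i \<phi>i by (simp add: q_def)
  qed
  have "(\<lambda>k. LBINT x. q k x) \<longlonglongrightarrow> (LBINT x. dir_deriv v \<phi> x)"
  proof (rule integral_dominated_convergence)
    show "integrable lborel (\<lambda>x. L * norm v * indicator (cball 0 (R + norm v)) x)"
      by (simp add: integrable_indicator_cball)
    show "AE x in lborel. norm (q k x) \<le> L * norm v * indicator (cball 0 (R + norm v)) x" for k
    proof (rule AE_I2)
      fix x
      show "norm (q k x) \<le> L * norm v * indicator (cball 0 (R + norm v)) x"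
      proof (cases "x \<in> cball 0 (R + norm v)")
        case True
        have "norm (q k x) = \<bar>\<phi> (h k *\<^sub>R v + x) - \<phi> x\<bar> / h k" using h[of k] by (simp add: q_def)
        also have "\<dots> \<le> L * norm (h k *\<^sub>R v + x - x) / h k"
          using h[of k] by (intro divide_right_mono L) simp
        also have "\<dots> = L * norm v" using h[of k] by simp
        finally show ?thesis using True by simp
      next
        case False
        have "norm (h k *\<^sub>R v) \<le> norm v" using h[of k] by (simp add: mult_left_le_one_le)
        moreover have "norm x \<le> norm (h k *\<^sub>R v + x) + norm (h k *\<^sub>R v)"
          using norm_triangle_ineq4[of "h k *\<^sub>R v + x" "h k *\<^sub>R v"] by simp
        moreover have "norm x > R + norm v" using False by simp
        ultimately have "norm (h k *\<^sub>R v + x) > R" "norm x > R" using norm_ge_zero[of v] by linarith+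
        then show ?thesis using False by (simp add: q_def z)
      qed
    qed
    show "AE x in lborel. (\<lambda>k. q k x) \<longlonglongrightarrow> dir_deriv v \<phi> x"
    proof (rule AE_I2)
      fix x
      have "((\<lambda>s. \<phi> (x + s *\<^sub>R v)) has_derivative (\<lambda>s. dir_deriv (s *\<^sub>R v) \<phi> (x + 0 *\<^sub>R v))) (at 0)"
        by (rule has_derivative_affine_comp) (auto intro: bounded_linear_scaleR_left test_funD(4)[OF \<phi>])
      moreover have "dir_deriv (s *\<^sub>R v) \<phi> x = dir_deriv v \<phi> x * s" for s
        unfolding dir_deriv_linear[OF test_funD(4)[OF \<phi>], of "s *\<^sub>R v"] dir_deriv_linear[OF test_funD(4)[OF \<phi>], of v]
        by (simp add: sum_distrib_left sum_distrib_right mult_ac)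
      ultimately have "((\<lambda>s. \<phi> (x + s *\<^sub>R v)) has_real_derivative dir_deriv v \<phi> x) (at 0)"
        by (simp add: has_field_derivative_def)
      then have "((\<lambda>s. (\<phi> (x + s *\<^sub>R v) - \<phi> x) / s) \<longlongrightarrow> dir_deriv v \<phi> x) (at 0)"
        by (simp add: has_field_derivative_iff)
      moreover have "filterlim h (at 0) sequentially"
        using h0 h(1) by (auto simp: filterlim_at intro!: always_eventually) (metis less_irrefl)
      ultimately have "(\<lambda>k. (\<phi> (x + h k *\<^sub>R v) - \<phi> x) / h k) \<longlonglongrightarrow> dir_deriv v \<phi> x"
        by (rule filterlim_compose)
      then show "(\<lambda>k. q k x) \<longlonglongrightarrow> dir_deriv v \<phi> x" by (simp add: q_def add.commute)
    qed
  qed (auto simp: q_def[abs_def])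
  then show ?thesis by (simp add: qi LIMSEQ_const_iff)
qed


section \<open>Weak derivatives\<close>

lemma borel_rep_component:
  fixes F :: "'a::euclidean_space \<Rightarrow> real^'n"
  assumes "borel_rep S F F0"
  shows "borel_rep S (\<lambda>x. F x $ i) (\<lambda>x. F0 x $ i)"
proof -
  have [measurable]: "F0 \<in> borel_measurable borel" by (rule borel_repD(1)[OF assms])
  have "(\<lambda>x. F0 x \<bullet> axis i 1) \<in> borel_measurable borel" by measurable
  then have m: "(\<lambda>x. F0 x $ i) \<in> borel_measurable borel" by (simp add: inner_axis)
  have "integrable lborel (\<lambda>x. (norm (F0 x $ i))\<^sup>2)"
  proof (rule Bochner_Integration.integrable_bound[OF borel_repD(3)[OF assms]])
    show "AE x in lborel. norm ((norm (F0 x $ i))\<^sup>2) \<le> norm ((norm (F0 x))\<^sup>2)"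
      by (intro AE_I2) (simp add: abs_le_square_iff[symmetric] component_le_norm_cart)
  qed (use m in simp)
  then show ?thesis
    using borel_repD[OF assms] m unfolding borel_rep_def by (auto elim: eventually_mono)
qed

lemma integral_L2_mult_rep:
  fixes f g :: "'a::euclidean_space \<Rightarrow> real"
  assumes S: "open S" and f: "f \<in> L2 S" "borel_rep S f f0" and g: "g \<in> L2 S" "g0 \<in> borel_measurable borel"
    "AE x in lborel. x \<in> S \<longrightarrow> g x = g0 x"
  shows "(LINT x|lebesgue_on S. f x * g x) = (LBINT x. f0 x * g0 x)"
proof (rule integral_lebesgue_on_rep(1)[OF S])
  show "(\<lambda>x. f x * g x) \<in> borel_measurable (lebesgue_on S)"
    using L2D(1)[OF f(1)] L2D(1)[OF g(1)] by measurable
  show "(\<lambda>x. f0 x * g0 x) \<in> borel_measurable borel"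
    using borel_repD(1)[OF f(2)] g(2) by measurable
  show "f0 x * g0 x = 0" if "x \<notin> S" for x using borel_repD(2)[OF f(2) that] by simp
  show "AE x in lborel. x \<in> S \<longrightarrow> f x * g x = f0 x * g0 x"
    using borel_repD(4)[OF f(2)] g(3) by eventually_elim simp
qed

lemma L2_vec:
  fixes F :: "'a::euclidean_space \<Rightarrow> real^'n"
  assumes "\<And>i. (\<lambda>x. F x $ i) \<in> L2 S"
  shows "F \<in> L2 S"
proof -
  have eq: "(\<lambda>x. \<Sum>i\<in>UNIV. F x $ i *\<^sub>R axis i 1) = F"
    by (rule ext) (simp add: basis_expansion scalar_mult_eq_scaleR[symmetric])
  have "(\<lambda>x. \<Sum>i\<in>I. F x $ i *\<^sub>R (axis i 1 :: real^'n)) \<in> L2 S" if "finite I" for I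
    using that
  proof (induction I)
    case empty
    then show ?case by (simp add: L2_def)
  next
    case (insert i I)
    have "(\<lambda>x. F x $ i *\<^sub>R (axis i 1 :: real^'n)) \<in> L2 S"
      using assms[of i] unfolding L2_def
      by (auto simp: power_mult_distrib norm_axis_1 intro!: borel_measurable_scaleR)
    with insert show ?case by (simp add: L2_add)
  qed
  from this[of UNIV] show ?thesis by (simp only: finite eq)
qed

lemma weak_dir_deriv_test_fun:
  assumes S: "open S" and \<psi>: "\<psi> \<in> test_fun S"
  shows "has_weak_dir_deriv S v \<psi> (dir_deriv v \<psi>)"
  unfolding has_weak_dir_deriv_def
proof
  fix \<phi> assume \<phi>: "\<phi> \<in> test_fun S"
  have [measurable]: "\<psi> \<in> borel_measurable borel" "\<phi> \<in> borel_measurable borel"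
    "dir_deriv v \<psi> \<in> borel_measurable borel" "dir_deriv v \<phi> \<in> borel_measurable borel"
    using test_fun_borel \<phi> \<psi> test_fun_dir_deriv by blast+
  have \<chi>: "(\<lambda>x. \<psi> x * \<phi> x) \<in> test_fun S"
  proof (rule test_funI[OF _ test_funD(2,3)[OF \<phi>]])
    show "Ck k (\<lambda>x. \<psi> x * \<phi> x)" for k by (intro Ck_mult test_funD(1)[OF \<phi>] test_funD(1)[OF \<psi>])
    show "\<psi> x * \<phi> x = 0" if "x \<notin> closure {x. \<phi> x \<noteq> 0}" for x
      using zero_outside_support[OF that] by simp
  qed
  have i: "integrable (lebesgue_on S) (\<lambda>x. \<psi> x * dir_deriv v \<phi> x)" "integrable (lebesgue_on S) (\<lambda>x. dir_deriv v \<psi> x * \<phi> x)"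
    by (rule L2_integrable_mult[OF test_fun_L2[OF S \<psi>] test_fun_L2[OF S test_fun_dir_deriv[OF \<phi>]]],
        rule L2_integrable_mult[OF test_fun_L2[OF S test_fun_dir_deriv[OF \<psi>]] test_fun_L2[OF S \<phi>]])
  have "(LINT x|lebesgue_on S. \<psi> x * dir_deriv v \<phi> x) + (LINT x|lebesgue_on S. dir_deriv v \<psi> x * \<phi> x)
    = (LINT x|lebesgue_on S. dir_deriv v (\<lambda>x. \<psi> x * \<phi> x) x)"
    using i by (simp add: dir_deriv_mult[OF test_funD(4)[OF \<psi>] test_funD(4)[OF \<phi>]])
  also have "\<dots> = (LBINT x. dir_deriv v (\<lambda>x. \<psi> x * \<phi> x) x)"
  proof (rule integral_lebesgue_on_rep(1)[OF S])
    show "dir_deriv v (\<lambda>x. \<psi> x * \<phi> x) \<in> borel_measurable (lebesgue_on S)"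
      by (rule L2D[OF test_fun_L2[OF S test_fun_dir_deriv[OF \<chi>]]])
    show "dir_deriv v (\<lambda>x. \<psi> x * \<phi> x) \<in> borel_measurable borel"
      by (rule test_fun_borel[OF test_fun_dir_deriv[OF \<chi>]])
    show "dir_deriv v (\<lambda>x. \<psi> x * \<phi> x) x = 0" if "x \<notin> S" for x
      by (rule test_funD(6)[OF test_fun_dir_deriv[OF \<chi>] that])
  qed simp
  also have "\<dots> = 0" by (rule integral_dir_deriv_test_fun[OF \<chi>])
  finally show "(LINT x|lebesgue_on S. \<psi> x * dir_deriv v \<phi> x) = - (LINT x|lebesgue_on S. dir_deriv v \<psi> x * \<phi> x)"
    by simp
qed

lemma weak_dir_deriv_diff:
  assumes S: "open S" and L2: "f \<in> L2 S" "f' \<in> L2 S" "g \<in> L2 S" "g' \<in> L2 S"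
    and w: "has_weak_dir_deriv S v f g" "has_weak_dir_deriv S v f' g'"
  shows "has_weak_dir_deriv S v (\<lambda>x. f x - f' x) (\<lambda>x. g x - g' x)"
  unfolding has_weak_dir_deriv_def
proof
  fix \<phi> assume \<phi>: "\<phi> \<in> test_fun S"
  note m = test_fun_L2[OF S \<phi>] test_fun_L2[OF S test_fun_dir_deriv[OF \<phi>, of v]]
  show "(LINT x|lebesgue_on S. (f x - f' x) * dir_deriv v \<phi> x) = - (LINT x|lebesgue_on S. (g x - g' x) * \<phi> x)"
    using w[unfolded has_weak_dir_deriv_def, rule_format, OF \<phi>]
    by (simp add: left_diff_distrib L2_integrable_mult[OF L2(1) m(2)] L2_integrable_mult[OF L2(2) m(2)]
        L2_integrable_mult[OF L2(3) m(1)] L2_integrable_mult[OF L2(4) m(1)])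
qed

lemma weak_dir_deriv_unique:
  assumes S: "open S" and L2: "g \<in> L2 S" "g' \<in> L2 S"
    and w: "has_weak_dir_deriv S v f g" "has_weak_dir_deriv S v f g'"
  shows "AE x in lebesgue_on S. g x = g' x"
proof -
  have "AE x in lebesgue_on S. g x - g' x = 0"
  proof (rule AE_zero_if_orthogonal_test_fun[OF S L2_diff[OF L2]])
    fix \<phi> assume \<phi>: "\<phi> \<in> test_fun S"
    note m = test_fun_L2[OF S \<phi>]
    show "(LINT x|lebesgue_on S. (g x - g' x) * \<phi> x) = 0"
      using w[unfolded has_weak_dir_deriv_def, rule_format, OF \<phi>]
      by (simp add: left_diff_distrib L2_integrable_mult[OF L2(1) m] L2_integrable_mult[OF L2(2) m])
  qed
  then show ?thesis by simp
qed

lemma AE_vec_eq: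
  fixes F G :: "'a \<Rightarrow> real^'n"
  assumes "\<And>i. AE x in M. F x $ i = G x $ i"
  shows "AE x in M. F x = G x"
proof -
  have "AE x in M. \<forall>i\<in>UNIV. F x $ i = G x $ i" using assms by (intro AE_finite_allI) auto
  then show ?thesis by eventually_elim (simp add: vec_eq_iff)
qed

lemma weak_grad_unique:
  assumes "open \<Omega>" "G \<in> L2 \<Omega>" "G' \<in> L2 \<Omega>" "has_weak_grad \<Omega> f G" "has_weak_grad \<Omega> f G'"
  shows "AE x in lebesgue_on \<Omega>. G x = G' x"
  using assms unfolding has_weak_grad_def
  by (intro AE_vec_eq weak_dir_deriv_unique[OF assms(1), where f=f] L2_component) auto

lemma weak_space_grad_unique:
  assumes "open \<Xi>" "G \<in> L2 \<Xi>" "G' \<in> L2 \<Xi>" "has_weak_space_grad \<Xi> f G" "has_weak_space_grad \<Xi> f G'"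
  shows "AE x in lebesgue_on \<Xi>. G x = G' x"
  using assms unfolding has_weak_space_grad_def
  by (intro AE_vec_eq weak_dir_deriv_unique[OF assms(1), where f=f] L2_component) auto

lemma integrable_space_div_test:
  fixes F :: "real \<times> (real^'n) \<Rightarrow> real^'n"
  assumes "open \<Xi>" "F \<in> L2 \<Xi>" "\<phi> \<in> test_fun \<Xi>"
  shows "integrable (lebesgue_on \<Xi>) (\<lambda>z. \<Sum>i\<in>UNIV. F z $ i * dir_deriv (0, axis i 1) \<phi> z)"
  by (intro Bochner_Integration.integrable_sum L2_integrable_mult L2_component assms(1,2)
        test_fun_L2[OF assms(1) test_fun_dir_deriv[OF assms(3)]])

lemma weak_space_div_diff:
  fixes F F' :: "real \<times> (real^'n) \<Rightarrow> real^'n"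
  assumes S: "open \<Xi>" and L2: "F \<in> L2 \<Xi>" "F' \<in> L2 \<Xi>" "g \<in> L2 \<Xi>" "g' \<in> L2 \<Xi>"
    and w: "has_weak_space_div \<Xi> F g" "has_weak_space_div \<Xi> F' g'"
  shows "has_weak_space_div \<Xi> (\<lambda>x. F x - F' x) (\<lambda>x. g x - g' x)"
  unfolding has_weak_space_div_def
proof
  fix \<phi> assume \<phi>: "\<phi> \<in> test_fun \<Xi>"
  note m = test_fun_L2[OF S \<phi>]
  show "(LINT z|lebesgue_on \<Xi>. (\<Sum>i\<in>UNIV. (F z - F' z) $ i * dir_deriv (0, axis i 1) \<phi> z))
      = - (LINT x|lebesgue_on \<Xi>. (g x - g' x) * \<phi> x)"
    using w[unfolded has_weak_space_div_def, rule_format, OF \<phi>]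
    by (simp add: left_diff_distrib sum_subtractf L2_integrable_mult[OF L2(3) m] L2_integrable_mult[OF L2(4) m]
        integrable_space_div_test[OF S L2(1) \<phi>] integrable_space_div_test[OF S L2(2) \<phi>])
qed

lemma weak_space_div_unique:
  fixes F :: "real \<times> (real^'n) \<Rightarrow> real^'n"
  assumes S: "open \<Xi>" and L2: "g \<in> L2 \<Xi>" "g' \<in> L2 \<Xi>"
    and w: "has_weak_space_div \<Xi> F g" "has_weak_space_div \<Xi> F g'"
  shows "AE x in lebesgue_on \<Xi>. g x = g' x"
proof -
  have "AE x in lebesgue_on \<Xi>. g x - g' x = 0"
  proof (rule AE_zero_if_orthogonal_test_fun[OF S L2_diff[OF L2]])
    fix \<phi> assume \<phi>: "\<phi> \<in> test_fun \<Xi>"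
    note m = test_fun_L2[OF S \<phi>]
    show "(LINT x|lebesgue_on \<Xi>. (g x - g' x) * \<phi> x) = 0"
      using w[unfolded has_weak_space_div_def, rule_format, OF \<phi>]
      by (simp add: left_diff_distrib L2_integrable_mult[OF L2(1) m] L2_integrable_mult[OF L2(2) m])
  qed
  then show ?thesis by simp
qed

lemma space_grad_spec:
  assumes "u \<in> H01 \<Xi>"
  shows "space_grad \<Xi> u \<in> L2 \<Xi>" "has_weak_space_grad \<Xi> u (space_grad \<Xi> u)"
proof -
  have "\<exists>G. G \<in> L2 \<Xi> \<and> has_weak_space_grad \<Xi> u G" using assms by (auto simp: H01_def)
  from someI_ex[OF this] show "space_grad \<Xi> u \<in> L2 \<Xi>" "has_weak_space_grad \<Xi> u (space_grad \<Xi> u)"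
    unfolding space_grad_def by auto
qed

lemma time_deriv_spec:
  assumes "u \<in> H10 \<Xi>"
  shows "time_deriv \<Xi> u \<in> L2 \<Xi>" "has_weak_time_deriv \<Xi> u (time_deriv \<Xi> u)"
proof -
  have "\<exists>g. g \<in> L2 \<Xi> \<and> has_weak_time_deriv \<Xi> u g" using assms by (auto simp: H10_def)
  from someI_ex[OF this] show "time_deriv \<Xi> u \<in> L2 \<Xi>" "has_weak_time_deriv \<Xi> u (time_deriv \<Xi> u)"
    unfolding time_deriv_def by auto
qed

lemma space_div_spec:
  assumes "p \<in> Ddiv \<Xi>"
  shows "space_div \<Xi> p \<in> L2 \<Xi>" "has_weak_space_div \<Xi> p (space_div \<Xi> p)"
proof -
  have "\<exists>g. g \<in> L2 \<Xi> \<and> has_weak_space_div \<Xi> p g" using assms by (auto simp: Ddiv_def)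
  from someI_ex[OF this] show "space_div \<Xi> p \<in> L2 \<Xi>" "has_weak_space_div \<Xi> p (space_div \<Xi> p)"
    unfolding space_div_def by auto
qed

lemma space_grad_diff:
  assumes \<Xi>: "open \<Xi>" and u: "u \<in> H01 \<Xi>" and v: "v \<in> H01 \<Xi>"
  shows "(\<lambda>z. u z - v z) \<in> H01 \<Xi>"
    and "AE z in lebesgue_on \<Xi>. space_grad \<Xi> (\<lambda>z. u z - v z) z = space_grad \<Xi> u z - space_grad \<Xi> v z"
proof -
  let ?G = "\<lambda>z. space_grad \<Xi> u z - space_grad \<Xi> v z"
  have L2: "?G \<in> L2 \<Xi>" by (intro L2_diff space_grad_spec u v)
  have uv: "u \<in> L2 \<Xi>" "v \<in> L2 \<Xi>" using u v by (auto simp: H01_def)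
  have G: "has_weak_space_grad \<Xi> (\<lambda>z. u z - v z) ?G"
    unfolding has_weak_space_grad_def vector_minus_component
  proof
    fix i
    show "has_weak_dir_deriv \<Xi> (0, axis i 1) (\<lambda>z. u z - v z) (\<lambda>z. space_grad \<Xi> u z $ i - space_grad \<Xi> v z $ i)"
      using space_grad_spec[OF u] space_grad_spec[OF v]
      by (intro weak_dir_deriv_diff \<Xi> uv L2_component) (auto simp: has_weak_space_grad_def)
  qed
  show H: "(\<lambda>z. u z - v z) \<in> H01 \<Xi>" using L2 G uv by (auto simp: H01_def intro: L2_diff)
  show "AE z in lebesgue_on \<Xi>. space_grad \<Xi> (\<lambda>z. u z - v z) z = ?G z"
    by (rule weak_space_grad_unique[OF \<Xi> space_grad_spec(1)[OF H] L2 space_grad_spec(2)[OF H] G])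
qed

lemma time_deriv_diff:
  assumes \<Xi>: "open \<Xi>" and u: "u \<in> H10 \<Xi>" and v: "v \<in> H10 \<Xi>"
  shows "(\<lambda>z. u z - v z) \<in> H10 \<Xi>"
    and "AE z in lebesgue_on \<Xi>. time_deriv \<Xi> (\<lambda>z. u z - v z) z = time_deriv \<Xi> u z - time_deriv \<Xi> v z"
proof -
  let ?G = "\<lambda>z. time_deriv \<Xi> u z - time_deriv \<Xi> v z"
  have L2: "?G \<in> L2 \<Xi>" by (intro L2_diff time_deriv_spec u v)
  have uv: "u \<in> L2 \<Xi>" "v \<in> L2 \<Xi>" using u v by (auto simp: H10_def)
  have G: "has_weak_time_deriv \<Xi> (\<lambda>z. u z - v z) ?G"
    using time_deriv_spec[OF u] time_deriv_spec[OF v] unfolding has_weak_time_deriv_def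
    by (intro weak_dir_deriv_diff \<Xi> uv) auto
  show H: "(\<lambda>z. u z - v z) \<in> H10 \<Xi>" using L2 G uv by (auto simp: H10_def intro: L2_diff)
  show "AE z in lebesgue_on \<Xi>. time_deriv \<Xi> (\<lambda>z. u z - v z) z = ?G z"
    using time_deriv_spec[OF H] G unfolding has_weak_time_deriv_def
    by (intro weak_dir_deriv_unique[OF \<Xi> _ L2]) auto
qed

lemma space_div_diff:
  assumes \<Xi>: "open \<Xi>" and p: "p \<in> Ddiv \<Xi>" and q: "q \<in> Ddiv \<Xi>"
  shows "AE z in lebesgue_on \<Xi>. space_div \<Xi> (\<lambda>z. p z - q z) z = space_div \<Xi> p z - space_div \<Xi> q z"
proof -
  let ?G = "\<lambda>z. space_div \<Xi> p z - space_div \<Xi> q z"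
  have L2: "?G \<in> L2 \<Xi>" by (intro L2_diff space_div_spec p q)
  have pq: "p \<in> L2 \<Xi>" "q \<in> L2 \<Xi>" using p q by (auto simp: Ddiv_def)
  have G: "has_weak_space_div \<Xi> (\<lambda>z. p z - q z) ?G"
    by (intro weak_space_div_diff \<Xi> pq space_div_spec p q)
  have H: "(\<lambda>z. p z - q z) \<in> Ddiv \<Xi>" using L2 G pq by (auto simp: Ddiv_def intro: L2_diff)
  show ?thesis by (rule weak_space_div_unique[OF \<Xi> space_div_spec(1)[OF H] L2 space_div_spec(2)[OF H] G])
qed

section \<open>Green's formula for functions vanishing on the lateral boundary\<close>

lemma integral_inner_le:
  fixes F G :: "'a \<Rightarrow> 'b::euclidean_space"
  assumes [measurable]: "F \<in> borel_measurable M" "G \<in> borel_measurable M"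
    and F: "integrable M (\<lambda>x. (norm (F x))\<^sup>2)" and G: "integrable M (\<lambda>x. (norm (G x))\<^sup>2)"
  shows "integrable M (\<lambda>x. F x \<bullet> G x)"
    and "\<bar>LINT x|M. F x \<bullet> G x\<bar> \<le> sqrt (LINT x|M. (norm (F x))\<^sup>2) * sqrt (LINT x|M. (norm (G x))\<^sup>2)"
proof -
  have i: "integrable M (\<lambda>x. norm (F x) * norm (G x))"
    by (rule integrable_mult_L2) (use F G in auto)
  show i': "integrable M (\<lambda>x. F x \<bullet> G x)"
    by (rule Bochner_Integration.integrable_bound[OF i]) (auto simp: Cauchy_Schwarz_ineq2)
  have "\<bar>LINT x|M. F x \<bullet> G x\<bar> \<le> (LINT x|M. \<bar>F x \<bullet> G x\<bar>)" by (rule integral_abs_bound)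
  also have "\<dots> \<le> (LINT x|M. norm (F x) * norm (G x))"
    by (rule integral_mono[OF integrable_abs[OF i'] i]) (rule Cauchy_Schwarz_ineq2)
  also have "\<dots> \<le> sqrt ((LINT x|M. (norm (F x))\<^sup>2) * (LINT x|M. (norm (G x))\<^sup>2))"
    by (rule real_le_rsqrt, rule Cauchy_Schwarz_integral) (use F G in auto)
  finally show "\<bar>LINT x|M. F x \<bullet> G x\<bar> \<le> sqrt (LINT x|M. (norm (F x))\<^sup>2) * sqrt (LINT x|M. (norm (G x))\<^sup>2)"
    by (simp add: real_sqrt_mult)
qed

text \<open>
  For a test function in place of \<open>v\<close> the claim is the assumption \<open>weak\<close>. The integral depends continuously on \<open>(v, \<nabla>v)\<close> by the
  Cauchy-Schwarz inequality, and test functions are dense by the definition of \<open>H1_ring\<close>. The norm there is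
  computed from the selected weak gradient of \<open>v - \<psi>\<close>, which is \<open>K - \<nabla>\<psi>\<close> by uniqueness.
\<close>

lemma Green_spatial:
  fixes v d :: "real^'n \<Rightarrow> real" and K q :: "real^'n \<Rightarrow> real^'n"
  assumes \<Omega>: "open \<Omega>" and v: "v \<in> H1_ring \<Omega>" and K: "K \<in> L2 \<Omega>" "has_weak_grad \<Omega> v K"
    and d: "d \<in> L2 \<Omega>" and q: "q \<in> L2 \<Omega>"
    and weak: "\<And>\<psi>. \<psi> \<in> test_fun \<Omega> \<Longrightarrow>
      (LINT x|lebesgue_on \<Omega>. d x * \<psi> x + (\<Sum>i\<in>UNIV. q x $ i * dir_deriv (axis i 1) \<psi> x)) = 0"
  shows "(LINT x|lebesgue_on \<Omega>. d x * v x + q x \<bullet> K x) = 0"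
proof -
  let ?M = "lebesgue_on \<Omega>"
  have vL2: "v \<in> L2 \<Omega>" using v by (auto simp: H1_ring_def H1_def)
  note qm = L2D[OF q]
  define c where "c = sqrt (LINT x|?M. (norm (d x))\<^sup>2) + sqrt (LINT x|?M. (norm (q x))\<^sup>2)"
  have c0: "c \<ge> 0" unfolding c_def by (intro add_nonneg_nonneg) (auto intro!: integral_nonneg_AE)
  have bound: "\<bar>LINT x|?M. d x * v x + q x \<bullet> K x\<bar> \<le> c * \<epsilon>" if \<epsilon>: "\<epsilon> > 0" for \<epsilon>
  proof -
    obtain \<psi> where \<psi>: "\<psi> \<in> test_fun \<Omega>" and less: "H1_norm \<Omega> (\<lambda>x. v x - \<psi> x) < \<epsilon>"
      using v \<epsilon> unfolding H1_ring_def by blast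
    define D where "D x = (\<chi> i. dir_deriv (axis i 1) \<psi> x)" for x
    define e where "e x = v x - \<psi> x" for x
    define E where "E x = K x - D x" for x
    have DL2: "D \<in> L2 \<Omega>"
      by (rule L2_vec) (simp add: D_def test_fun_L2[OF \<Omega> test_fun_dir_deriv[OF \<psi>]])
    have \<psi>L2: "\<psi> \<in> L2 \<Omega>" by (rule test_fun_L2[OF \<Omega> \<psi>])
    have eL2: "e \<in> L2 \<Omega>" unfolding e_def[abs_def] by (rule L2_diff[OF vL2 \<psi>L2])
    have EL2: "E \<in> L2 \<Omega>" unfolding E_def[abs_def] by (rule L2_diff[OF K(1) DL2])
    have eE: "has_weak_grad \<Omega> e E"
      unfolding has_weak_grad_def e_def[abs_def] E_def[abs_def] vector_minus_component
    proof
      fix i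
      show "has_weak_dir_deriv \<Omega> (axis i 1) (\<lambda>x. v x - \<psi> x) (\<lambda>x. K x $ i - D x $ i)"
      proof (rule weak_dir_deriv_diff[OF \<Omega> vL2 \<psi>L2 L2_component[OF K(1)] L2_component[OF DL2]])
        show "has_weak_dir_deriv \<Omega> (axis i 1) v (\<lambda>x. K x $ i)" using K(2) by (simp add: has_weak_grad_def)
        show "has_weak_dir_deriv \<Omega> (axis i 1) \<psi> (\<lambda>x. D x $ i)"
          using weak_dir_deriv_test_fun[OF \<Omega> \<psi>] by (simp add: D_def)
      qed
    qed
    have "\<exists>G. G \<in> L2 \<Omega> \<and> has_weak_grad \<Omega> e G" using EL2 eE by blast
    then have wg: "weak_grad \<Omega> e \<in> L2 \<Omega>" "has_weak_grad \<Omega> e (weak_grad \<Omega> e)"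
      unfolding weak_grad_def using someI_ex[of "\<lambda>G. G \<in> L2 \<Omega> \<and> has_weak_grad \<Omega> e G"] by auto
    have "AE x in ?M. weak_grad \<Omega> e x = E x"
      by (rule weak_grad_unique[OF \<Omega> wg(1) EL2 wg(2) eE])
    then have nE: "(LINT x|?M. (norm (weak_grad \<Omega> e x))\<^sup>2) = (LINT x|?M. (norm (E x))\<^sup>2)"
      by (intro integral_cong_AE) (use L2D(1)[OF wg(1)] L2D(1)[OF EL2] in auto)
    have pos: "0 \<le> (LINT x|?M. (norm (e x))\<^sup>2)" "0 \<le> (LINT x|?M. (norm (E x))\<^sup>2)"
      by (auto intro!: integral_nonneg_AE)
    have "sqrt ((LINT x|?M. (norm (e x))\<^sup>2) + (LINT x|?M. (norm (E x))\<^sup>2)) < \<epsilon>"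
      using less unfolding H1_norm_def L2_norm_on_sq e_def[symmetric] nE[symmetric] by simp
    then have small: "sqrt (LINT x|?M. (norm (e x))\<^sup>2) \<le> \<epsilon>" "sqrt (LINT x|?M. (norm (E x))\<^sup>2) \<le> \<epsilon>"
      using pos real_sqrt_le_mono[of "LINT x|?M. (norm (e x))\<^sup>2" "(LINT x|?M. (norm (e x))\<^sup>2) + (LINT x|?M. (norm (E x))\<^sup>2)"]
        real_sqrt_le_mono[of "LINT x|?M. (norm (E x))\<^sup>2" "(LINT x|?M. (norm (e x))\<^sup>2) + (LINT x|?M. (norm (E x))\<^sup>2)"]
      by linarith+
    note de = integral_inner_le[OF L2D(1)[OF d] L2D(1)[OF eL2] L2D(2)[OF d] L2D(2)[OF eL2]]
    note qE = integral_inner_le[OF L2D(1)[OF q] L2D(1)[OF EL2] L2D(2)[OF q] L2D(2)[OF EL2]]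
    note d\<psi> = integral_inner_le(1)[OF L2D(1)[OF d] L2D(1)[OF \<psi>L2] L2D(2)[OF d] L2D(2)[OF \<psi>L2]]
    note qD = integral_inner_le(1)[OF L2D(1)[OF q] L2D(1)[OF DL2] L2D(2)[OF q] L2D(2)[OF DL2]]
    have "(LINT x|?M. d x * v x + q x \<bullet> K x) = (LINT x|?M. (d x \<bullet> e x + q x \<bullet> E x) + (d x \<bullet> \<psi> x + q x \<bullet> D x))"
      by (simp add: e_def E_def algebra_simps inner_diff_right)
    also have "\<dots> = (LINT x|?M. d x \<bullet> e x) + (LINT x|?M. q x \<bullet> E x) + (LINT x|?M. d x \<bullet> \<psi> x + q x \<bullet> D x)"
      using de(1) qE(1) d\<psi> qD by simp
    also have "(LINT x|?M. d x \<bullet> \<psi> x + q x \<bullet> D x) = 0"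
      using weak[OF \<psi>] by (simp add: D_def inner_vec_def)
    finally have "\<bar>LINT x|?M. d x * v x + q x \<bullet> K x\<bar> \<le> \<bar>LINT x|?M. d x \<bullet> e x\<bar> + \<bar>LINT x|?M. q x \<bullet> E x\<bar>"
      by simp
    also have "\<dots> \<le> sqrt (LINT x|?M. (norm (d x))\<^sup>2) * \<epsilon> + sqrt (LINT x|?M. (norm (q x))\<^sup>2) * \<epsilon>"
      by (intro add_mono order_trans[OF de(2)] order_trans[OF qE(2)] mult_left_mono small) auto
    finally show ?thesis by (simp add: c_def distrib_right)
  qed
  have "\<bar>LINT x|?M. d x * v x + q x \<bullet> K x\<bar> \<le> 0 + \<epsilon>" if \<epsilon>: "\<epsilon> > 0" for \<epsilon>
  proof -
    have "\<bar>LINT x|?M. d x * v x + q x \<bullet> K x\<bar> \<le> c * (\<epsilon> / (c + 1))"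
      using \<epsilon> c0 by (intro bound) simp
    also have "\<dots> \<le> \<epsilon>" using \<epsilon> c0 by (simp add: field_simps)
    finally show ?thesis by simp
  qed
  then have "\<bar>LINT x|?M. d x * v x + q x \<bullet> K x\<bar> \<le> 0" by (rule field_le_epsilon)
  then show ?thesis by simp
qed

lemma open_cyl: "open \<Omega> \<Longrightarrow> open (cyl T \<Omega>)"
  by (simp add: cyl_def open_Times)

text \<open>
  The exceptional null set of times does not depend on \<open>\<psi>\<close>; this is what allows \<open>\<psi>\<close> to be chosen depending on \<open>t\<close>
  when slices are approximated.
\<close>

lemma AE_slice_weak_div:
  fixes q :: "real \<times> (real^'n) \<Rightarrow> real^'n"
  assumes \<Omega>: "open \<Omega>" and T: "T > 0"
    and q: "q \<in> L2 (cyl T \<Omega>)" "borel_rep (cyl T \<Omega>) q q0"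
    and d: "d \<in> L2 (cyl T \<Omega>)" "borel_rep (cyl T \<Omega>) d d0"
    and weak: "has_weak_space_div (cyl T \<Omega>) q d"
  shows "AE t in lborel. t \<in> {0<..<T} \<longrightarrow>
    (\<forall>\<psi>\<in>test_fun \<Omega>. (LBINT x. d0 (t, x) * \<psi> x + (\<Sum>i\<in>UNIV. q0 (t, x) $ i * dir_deriv (axis i 1) \<psi> x)) = 0)"
proof -
  let ?\<Xi> = "cyl T \<Omega>"
  note \<Xi> = open_cyl[OF \<Omega>, of T]
  have [measurable]: "q0 \<in> borel_measurable borel" "d0 \<in> borel_measurable borel"
    using borel_repD(1)[OF q(2)] borel_repD(1)[OF d(2)] by auto
  have "AE t in lborel. t \<in> {0<..<T} \<longrightarrow> (\<forall>j\<in>jet ` test_fun \<Omega>. (LBINT x. (d0 (t, x), q0 (t, x)) \<bullet> j x) = 0)"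
  proof (rule AE_slice_orthogonal[where H="\<lambda>z. (d0 z, q0 z)" and X="jet ` test_fun \<Omega>", OF _ _ _ T])
    show "(\<lambda>z. (d0 z, q0 z)) \<in> borel_measurable borel" by simp
    have "(\<lambda>z. (norm (d0 z, q0 z))\<^sup>2) = (\<lambda>z. (norm (d0 z))\<^sup>2 + (norm (q0 z))\<^sup>2)" by (simp add: norm_Pair)
    then show "integrable lborel (\<lambda>z. (norm (d0 z, q0 z))\<^sup>2)"
      using borel_repD(3)[OF q(2)] borel_repD(3)[OF d(2)] by simp
    show "(d0 z, q0 z) = 0" if "fst z \<notin> {0<..<T}" for z
      using that borel_repD(2)[OF q(2), of z] borel_repD(2)[OF d(2), of z]
      by (cases z) (auto simp: cyl_def zero_prod_def)
    show "\<exists>N. tame N j" if "j \<in> jet ` test_fun \<Omega>" for j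
      using that jet_tame by blast
    fix \<eta> j assume \<eta>: "\<eta> \<in> test_fun {0<..<T}" and "j \<in> jet ` test_fun \<Omega>"
    then obtain \<psi> where \<psi>: "\<psi> \<in> test_fun \<Omega>" and j: "j = jet \<psi>" by blast
    define \<phi> where "\<phi> z = \<eta> (fst z) * \<psi> (snd z)" for z
    have \<phi>: "\<phi> \<in> test_fun ?\<Xi>" unfolding cyl_def \<phi>_def[abs_def] by (rule test_fun_times[OF \<eta> \<psi>])
    let ?D = "\<lambda>i. dir_deriv (0, axis i 1) \<phi>"
    have D: "?D i z = \<eta> (fst z) * dir_deriv (axis i 1) \<psi> (snd z)" for i z
      unfolding \<phi>_def[abs_def] dir_deriv_times[OF \<eta> \<psi>] by (simp add: dir_deriv_0[OF \<eta>])
    have Dm: "?D i \<in> L2 ?\<Xi>" "?D i \<in> borel_measurable borel" for i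
      using test_fun_L2[OF \<Xi>] test_fun_borel test_fun_dir_deriv[OF \<phi>] by blast+
    have \<phi>m: "\<phi> \<in> L2 ?\<Xi>" "\<phi> \<in> borel_measurable borel"
      using test_fun_L2[OF \<Xi> \<phi>] test_fun_borel[OF \<phi>] by auto
    have qi: "(\<lambda>z. q z $ i) \<in> L2 ?\<Xi>" "borel_rep ?\<Xi> (\<lambda>z. q z $ i) (\<lambda>z. q0 z $ i)" for i
      by (rule L2_component[OF q(1)], rule borel_rep_component[OF q(2)])
    have lb: "integrable lborel (\<lambda>z. d0 z * \<phi> z)" "integrable lborel (\<lambda>z. q0 z $ i * ?D i z)" for i
    proof -
      show "integrable lborel (\<lambda>z. d0 z * \<phi> z)"
        using borel_repD(3)[OF d(2)] test_fun_square_integrable(1)[OF \<phi>] \<phi>m(2)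
        by (intro integrable_mult_L2) auto
      show "integrable lborel (\<lambda>z. q0 z $ i * ?D i z)"
        using borel_repD(1,3)[OF qi(2)[of i]] test_fun_square_integrable(1)[OF test_fun_dir_deriv[OF \<phi>]] Dm(2)
        by (intro integrable_mult_L2) auto
    qed
    have "(LBINT z. \<eta> (fst z) * ((d0 z, q0 z) \<bullet> j (snd z))) = (LBINT z. d0 z * \<phi> z + (\<Sum>i\<in>UNIV. q0 z $ i * ?D i z))"
      by (simp add: j inner_jet D \<phi>_def distrib_left sum_distrib_left mult_ac)
    also have "\<dots> = (LBINT z. d0 z * \<phi> z) + (\<Sum>i\<in>UNIV. LBINT z. q0 z $ i * ?D i z)"
      using lb by simp
    also have "\<dots> = (LINT z|lebesgue_on ?\<Xi>. d z * \<phi> z) + (\<Sum>i\<in>UNIV. LINT z|lebesgue_on ?\<Xi>. q z $ i * ?D i z)"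
    proof -
      have "(LINT z|lebesgue_on ?\<Xi>. q z $ i * ?D i z) = (LBINT z. q0 z $ i * ?D i z)" for i
        by (rule integral_L2_mult_rep[OF \<Xi> qi Dm]) simp
      moreover have "(LINT z|lebesgue_on ?\<Xi>. d z * \<phi> z) = (LBINT z. d0 z * \<phi> z)"
        by (rule integral_L2_mult_rep[OF \<Xi> d \<phi>m]) simp
      ultimately show ?thesis by simp
    qed
    also have "\<dots> = (LINT z|lebesgue_on ?\<Xi>. d z * \<phi> z) + (LINT z|lebesgue_on ?\<Xi>. (\<Sum>i\<in>UNIV. q z $ i * ?D i z))"
      by (subst Bochner_Integration.integral_sum) (auto intro!: L2_integrable_mult qi Dm)
    also have "\<dots> = 0"
      using weak \<phi> by (auto simp: has_weak_space_div_def)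
    finally show "(LBINT z. \<eta> (fst z) * ((d0 z, q0 z) \<bullet> j (snd z))) = 0" .
  qed
  then show ?thesis by eventually_elim (auto simp: inner_jet)
qed


text \<open>
  Green's formula holds on almost every time slice and is then integrated over time.
\<close>

lemma Green_cylinder:
  fixes q :: "real \<times> (real^'n) \<Rightarrow> real^'n" and w :: "real \<times> (real^'n) \<Rightarrow> real"
  assumes \<Omega>: "open \<Omega>" and T: "T > 0" and w: "w \<in> H01_ring T \<Omega>"
    and G: "G \<in> L2 (cyl T \<Omega>)" "has_weak_space_grad (cyl T \<Omega>) w G"
    and q: "q \<in> L2 (cyl T \<Omega>)" and d: "d \<in> L2 (cyl T \<Omega>)" "has_weak_space_div (cyl T \<Omega>) q d"
  shows "(LINT z|lebesgue_on (cyl T \<Omega>). d z * w z + q z \<bullet> G z) = 0"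
proof -
  let ?\<Xi> = "cyl T \<Omega>" and ?I = "{0<..<T} :: real set"
  note \<Xi> = open_cyl[OF \<Omega>, of T]
  have wL2: "w \<in> L2 ?\<Xi>" using w by (auto simp: H01_ring_def H01_def)
  obtain w0 where w0: "borel_rep ?\<Xi> w w0" using borel_rep_exists[OF \<Xi> wL2] .
  obtain G0 where G0: "borel_rep ?\<Xi> G G0" using borel_rep_exists[OF \<Xi> G(1)] .
  obtain q0 where q0: "borel_rep ?\<Xi> q q0" using borel_rep_exists[OF \<Xi> q] .
  obtain d0 where d0: "borel_rep ?\<Xi> d d0" using borel_rep_exists[OF \<Xi> d(1)] .
  have m [measurable]: "w0 \<in> borel_measurable borel" "G0 \<in> borel_measurable borel"
    "q0 \<in> borel_measurable borel" "d0 \<in> borel_measurable borel"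
    using w0 G0 q0 d0 borel_repD(1) by blast+
  have slices [measurable]: "(\<lambda>x. w0 (t, x)) \<in> borel_measurable borel" "(\<lambda>x. G0 (t, x)) \<in> borel_measurable borel"
    "(\<lambda>x. q0 (t, x)) \<in> borel_measurable borel" "(\<lambda>x. d0 (t, x)) \<in> borel_measurable borel" for t
    by (intro borel_measurable_slice m)+
  have off: "w0 (t, x) = 0" "G0 (t, x) = 0" "q0 (t, x) = 0" "d0 (t, x) = 0" if "t \<notin> ?I \<or> x \<notin> \<Omega>" for t x
    using that borel_repD(2)[OF w0, of "(t, x)"] borel_repD(2)[OF G0, of "(t, x)"]
      borel_repD(2)[OF q0, of "(t, x)"] borel_repD(2)[OF d0, of "(t, x)"] by (auto simp: cyl_def)

  have div_slices: "AE t in lborel. t \<in> ?I \<longrightarrow>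
    (\<forall>\<psi>\<in>test_fun \<Omega>. (LBINT x. d0 (t, x) * \<psi> x + (\<Sum>i\<in>UNIV. q0 (t, x) $ i * dir_deriv (axis i 1) \<psi> x)) = 0)"
    by (rule AE_slice_weak_div[OF \<Omega> T q q0 d(1) d0 d(2)])
  \<comment> \<open>The partial derivative \<open>\<partial>\<^sub>i w\<close> is the divergence of the field \<open>w e\<^sub>i\<close>, so the slicing result for divergences also covers gradients.\<close>
  have grad_slices: "AE t in lborel. t \<in> ?I \<longrightarrow>
    (\<forall>\<psi>\<in>test_fun \<Omega>. (LBINT x. G0 (t, x) $ i * \<psi> x + w0 (t, x) * dir_deriv (axis i 1) \<psi> x) = 0)" for i
  proof -
    have single: "(\<Sum>j\<in>UNIV. (c *\<^sub>R axis i 1 :: real^'n) $ j * g j) = c * g i" for c and g :: "'n \<Rightarrow> real"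
      by (simp add: axis_def if_distrib[of "\<lambda>x. c * x * _"] mult.assoc[symmetric] cong: if_cong)
         (subst sum.delta'; simp)?
    have L: "(\<lambda>z. w z *\<^sub>R (axis i 1 :: real^'n)) \<in> L2 ?\<Xi>"
      using L2D[OF wL2] unfolding L2_def by (auto simp: power_mult_distrib norm_axis_1)
    have R: "borel_rep ?\<Xi> (\<lambda>z. w z *\<^sub>R (axis i 1 :: real^'n)) (\<lambda>z. w0 z *\<^sub>R axis i 1)"
      using borel_repD[OF w0] unfolding borel_rep_def
      by (auto simp: power_mult_distrib norm_axis_1 elim!: eventually_mono)
    have W: "has_weak_space_div ?\<Xi> (\<lambda>z. w z *\<^sub>R axis i 1) (\<lambda>z. G z $ i)"
      using G(2) unfolding has_weak_space_div_def has_weak_space_grad_def has_weak_dir_deriv_def single by blast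
    from AE_slice_weak_div[OF \<Omega> T L R L2_component[OF G(1)] borel_rep_component[OF G0] W]
    show ?thesis unfolding single .
  qed
  have "AE t in lborel. \<forall>i\<in>UNIV. t \<in> ?I \<longrightarrow>
    (\<forall>\<psi>\<in>test_fun \<Omega>. (LBINT x. G0 (t, x) $ i * \<psi> x + w0 (t, x) * dir_deriv (axis i 1) \<psi> x) = 0)"
    using grad_slices by (intro AE_finite_allI) auto
  moreover have "AE t in lborel. t \<in> ?I \<longrightarrow> (\<lambda>x. w (t, x)) \<in> H1_ring \<Omega>"
    using w by (auto simp: H01_ring_def AE_lebesgue_on_open)
  moreover have "AE t in lborel. AE x in lborel. (t, x) \<in> ?\<Xi> \<longrightarrow> w (t, x) = w0 (t, x)"
    using AE_lborel_fst_snd[OF borel_repD(4)[OF w0]] .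
  moreover have "AE t in lborel. integrable lborel (\<lambda>x. (norm (w0 (t, x)))\<^sup>2)"
    by (rule Fubini_lborel(1)[OF borel_repD(3)[OF w0]])
  moreover have "AE t in lborel. integrable lborel (\<lambda>x. (norm (G0 (t, x)))\<^sup>2)"
    by (rule Fubini_lborel(1)[OF borel_repD(3)[OF G0]])
  moreover have "AE t in lborel. integrable lborel (\<lambda>x. (norm (q0 (t, x)))\<^sup>2)"
    by (rule Fubini_lborel(1)[OF borel_repD(3)[OF q0]])
  moreover have "AE t in lborel. integrable lborel (\<lambda>x. (norm (d0 (t, x)))\<^sup>2)"
    by (rule Fubini_lborel(1)[OF borel_repD(3)[OF d0]])
  ultimately have zero: "AE t in lborel. (LBINT x. d0 (t, x) * w0 (t, x) + q0 (t, x) \<bullet> G0 (t, x)) = 0"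
    using div_slices
  proof eventually_elim
    case (elim t)
    show ?case
    proof (cases "t \<in> ?I")
      case False
      then show ?thesis by (simp add: off)
    next
      case True
      have L2: "(\<lambda>x. G0 (t, x)) \<in> L2 \<Omega>" "(\<lambda>x. q0 (t, x)) \<in> L2 \<Omega>" "(\<lambda>x. d0 (t, x)) \<in> L2 \<Omega>" "(\<lambda>x. w0 (t, x)) \<in> L2 \<Omega>"
        using elim by (auto intro!: L2I_borel[OF \<Omega>] slices)
      have vm: "(\<lambda>x. w (t, x)) \<in> L2 \<Omega>" using elim(2) True by (auto simp: H1_ring_def H1_def)
      have ae: "AE x in lborel. x \<in> \<Omega> \<longrightarrow> w (t, x) = w0 (t, x)"
        using elim(3) by eventually_elim (use True in \<open>auto simp: cyl_def\<close>)
      have grad: "has_weak_grad \<Omega> (\<lambda>x. w (t, x)) (\<lambda>x. G0 (t, x))"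
        unfolding has_weak_grad_def has_weak_dir_deriv_def
      proof (intro allI ballI)
        fix i \<psi> assume \<psi>: "\<psi> \<in> test_fun \<Omega>"
        let ?D = "dir_deriv (axis i 1) \<psi>"
        have D: "?D \<in> test_fun \<Omega>" by (rule test_fun_dir_deriv[OF \<psi>])
        have [measurable]: "\<psi> \<in> borel_measurable borel" "?D \<in> borel_measurable borel"
          using test_fun_borel[OF \<psi>] test_fun_borel[OF D] by auto
        have gi: "(\<lambda>x. G0 (t, x) \<bullet> axis i 1) \<in> borel_measurable borel" by measurable
        have i: "integrable (lebesgue_on \<Omega>) (\<lambda>x. G0 (t, x) $ i * \<psi> x)" "integrable (lebesgue_on \<Omega>) (\<lambda>x. w (t, x) * ?D x)"
          by (rule L2_integrable_mult[OF L2_component[OF L2(1)] test_fun_L2[OF \<Omega> \<psi>]],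
              rule L2_integrable_mult[OF vm test_fun_L2[OF \<Omega> D]])
        have "(LINT x|lebesgue_on \<Omega>. G0 (t, x) $ i * \<psi> x) + (LINT x|lebesgue_on \<Omega>. w (t, x) * ?D x)
          = (LINT x|lebesgue_on \<Omega>. G0 (t, x) $ i * \<psi> x + w (t, x) * ?D x)"
          using i by simp
        also have "\<dots> = (LBINT x. G0 (t, x) $ i * \<psi> x + w0 (t, x) * ?D x)"
        proof (rule integral_lebesgue_on_rep(1)[OF \<Omega>])
          show "(\<lambda>x. G0 (t, x) $ i * \<psi> x + w (t, x) * ?D x) \<in> borel_measurable (lebesgue_on \<Omega>)"
            using borel_measurable_integrable[OF i(1)] borel_measurable_integrable[OF i(2)] by measurable
          show "(\<lambda>x. G0 (t, x) $ i * \<psi> x + w0 (t, x) * ?D x) \<in> borel_measurable borel"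
            using gi unfolding inner_axis by simp
          show "AE x in lborel. x \<in> \<Omega> \<longrightarrow> G0 (t, x) $ i * \<psi> x + w (t, x) * ?D x = G0 (t, x) $ i * \<psi> x + w0 (t, x) * ?D x"
            using ae by eventually_elim auto
        qed (simp add: off)
        also have "\<dots> = 0" using elim(1) True \<psi> by blast
        finally show "(LINT x|lebesgue_on \<Omega>. w (t, x) * ?D x) = - (LINT x|lebesgue_on \<Omega>. G0 (t, x) $ i * \<psi> x)" by simp
      qed
      have "(LINT x|lebesgue_on \<Omega>. d0 (t, x) * w (t, x) + q0 (t, x) \<bullet> G0 (t, x)) = 0"
      proof (rule Green_spatial[OF \<Omega> _ L2(1) grad L2(3) L2(2)])
        show "(\<lambda>x. w (t, x)) \<in> H1_ring \<Omega>" using elim(2) True by blast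
        fix \<psi> assume \<psi>: "\<psi> \<in> test_fun \<Omega>"
        have D: "dir_deriv (axis i 1) \<psi> \<in> test_fun \<Omega>" for i by (rule test_fun_dir_deriv[OF \<psi>])
        have [measurable]: "\<psi> \<in> borel_measurable borel" "dir_deriv (axis i 1) \<psi> \<in> borel_measurable borel" for i
          using test_fun_borel[OF \<psi>] test_fun_borel[OF D] by auto
        have "(\<lambda>x. q0 (t, x) \<bullet> axis i 1) \<in> borel_measurable borel" for i by measurable
        then have [measurable]: "(\<lambda>x. q0 (t, x) $ i) \<in> borel_measurable borel" for i by (simp add: inner_axis)
        have "(LINT x|lebesgue_on \<Omega>. d0 (t, x) * \<psi> x + (\<Sum>i\<in>UNIV. q0 (t, x) $ i * dir_deriv (axis i 1) \<psi> x))
          = (LBINT x. d0 (t, x) * \<psi> x + (\<Sum>i\<in>UNIV. q0 (t, x) $ i * dir_deriv (axis i 1) \<psi> x))"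
        proof (rule integral_lebesgue_on_rep(1)[OF \<Omega>])
          show "(\<lambda>x. d0 (t, x) * \<psi> x + (\<Sum>i\<in>UNIV. q0 (t, x) $ i * dir_deriv (axis i 1) \<psi> x)) \<in> borel_measurable (lebesgue_on \<Omega>)"
            by (intro measurable_restrict_space1 measurable_completion) measurable
          show "(\<lambda>x. d0 (t, x) * \<psi> x + (\<Sum>i\<in>UNIV. q0 (t, x) $ i * dir_deriv (axis i 1) \<psi> x)) \<in> borel_measurable borel"
            by measurable
        qed (simp_all add: off)
        also have "\<dots> = 0" using elim(8) True \<psi> by blast
        finally show "(LINT x|lebesgue_on \<Omega>. d0 (t, x) * \<psi> x + (\<Sum>i\<in>UNIV. q0 (t, x) $ i * dir_deriv (axis i 1) \<psi> x)) = 0" .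
      qed
      moreover have "(LINT x|lebesgue_on \<Omega>. d0 (t, x) * w (t, x) + q0 (t, x) \<bullet> G0 (t, x))
        = (LBINT x. d0 (t, x) * w0 (t, x) + q0 (t, x) \<bullet> G0 (t, x))"
      proof (rule integral_lebesgue_on_rep(1)[OF \<Omega>])
        show "(\<lambda>x. d0 (t, x) * w (t, x) + q0 (t, x) \<bullet> G0 (t, x)) \<in> borel_measurable (lebesgue_on \<Omega>)"
          using L2D(1)[OF L2(1)] L2D(1)[OF L2(2)] L2D(1)[OF L2(3)] L2D(1)[OF vm] by measurable
        show "AE x in lborel. x \<in> \<Omega> \<longrightarrow> d0 (t, x) * w (t, x) + q0 (t, x) \<bullet> G0 (t, x) = d0 (t, x) * w0 (t, x) + q0 (t, x) \<bullet> G0 (t, x)"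
          using ae by eventually_elim auto
      qed (simp_all add: off)
      ultimately show ?thesis by simp
    qed
  qed
  have i: "integrable lborel (\<lambda>z. d0 z * w0 z + q0 z \<bullet> G0 z)"
    using integral_inner_le(1)[of d0 lborel w0] integral_inner_le(1)[of q0 lborel G0]
      borel_repD(3)[OF w0] borel_repD(3)[OF G0] borel_repD(3)[OF q0] borel_repD(3)[OF d0]
    by simp
  have "(LINT z|lebesgue_on ?\<Xi>. d z * w z + q z \<bullet> G z) = (LBINT z. d0 z * w0 z + q0 z \<bullet> G0 z)"
  proof (rule integral_lebesgue_on_rep(1)[OF \<Xi>])
    show "(\<lambda>z. d z * w z + q z \<bullet> G z) \<in> borel_measurable (lebesgue_on ?\<Xi>)"
      using L2D(1)[OF d(1)] L2D(1)[OF wL2] L2D(1)[OF q] L2D(1)[OF G(1)] by measurable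
    show "d0 z * w0 z + q0 z \<bullet> G0 z = 0" if "z \<notin> ?\<Xi>" for z
      using borel_repD(2)[OF d0 that] borel_repD(2)[OF q0 that] by simp
    show "AE z in lborel. z \<in> ?\<Xi> \<longrightarrow> d z * w z + q z \<bullet> G z = d0 z * w0 z + q0 z \<bullet> G0 z"
      using borel_repD(4)[OF d0] borel_repD(4)[OF w0] borel_repD(4)[OF q0] borel_repD(4)[OF G0]
      by eventually_elim auto
  qed measurable
  also have "\<dots> = (LBINT t. LBINT x. d0 (t, x) * w0 (t, x) + q0 (t, x) \<bullet> G0 (t, x))"
    by (rule Fubini_lborel(3)[OF i, symmetric])
  also have "\<dots> = (LINT t|(lborel :: real measure). 0)"
  proof (rule integral_cong_AE)
    show "(\<lambda>t. LBINT x. d0 (t, x) * w0 (t, x) + q0 (t, x) \<bullet> G0 (t, x)) \<in> borel_measurable lborel"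
      by (rule borel_measurable_integrable[OF Fubini_lborel(2)[OF i]])
  qed (use zero in auto)
  finally show ?thesis by simp
qed

section \<open>Values at fixed times\<close>

lemma L2_norm_on_add_sq:
  assumes "f \<in> L2 S" "g \<in> L2 S"
  shows "(L2_norm_on S (\<lambda>x. f x + g x))\<^sup>2 \<le> 2 * (L2_norm_on S f)\<^sup>2 + 2 * (L2_norm_on S g)\<^sup>2"
proof -
  have "(LINT x|lebesgue_on S. (norm (f x + g x))\<^sup>2) \<le> (LINT x|lebesgue_on S. 2 * (norm (f x))\<^sup>2 + 2 * (norm (g x))\<^sup>2)"
  proof (rule integral_mono)
    show "integrable (lebesgue_on S) (\<lambda>x. (norm (f x + g x))\<^sup>2)" using L2D[OF L2_add[OF assms]] by simp
    show "integrable (lebesgue_on S) (\<lambda>x. 2 * (norm (f x))\<^sup>2 + 2 * (norm (g x))\<^sup>2)"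
      using L2D[OF assms(1)] L2D[OF assms(2)] by simp
  qed (rule norm_add_sq_le)
  also have "\<dots> = 2 * (LINT x|lebesgue_on S. (norm (f x))\<^sup>2) + 2 * (LINT x|lebesgue_on S. (norm (g x))\<^sup>2)"
    using L2D[OF assms(1)] L2D[OF assms(2)] by simp
  finally show ?thesis unfolding L2_norm_on_sq .
qed

lemma L2_norm_on_nonneg: "0 \<le> L2_norm_on S f"
  unfolding L2_norm_on_def by (auto intro!: integral_nonneg_AE)

lemma L2_norm_on_minus: "L2_norm_on S (\<lambda>x. f x - g x) = L2_norm_on S (\<lambda>x. g x - f x)"
  unfolding L2_norm_on_def by (simp add: norm_minus_commute)

lemma L2_norm_on_cong_AE:
  assumes "f \<in> L2 S" "g \<in> L2 S" "AE x in lebesgue_on S. f x = g x"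
  shows "L2_norm_on S f = L2_norm_on S g"
proof -
  have "(LINT x|lebesgue_on S. (norm (f x))\<^sup>2) = (LINT x|lebesgue_on S. (norm (g x))\<^sup>2)"
  proof (rule integral_cong_AE)
    show "AE x in lebesgue_on S. (norm (f x))\<^sup>2 = (norm (g x))\<^sup>2" using assms(3) by eventually_elim simp
  qed (use L2D(1)[OF assms(1)] L2D(1)[OF assms(2)] in measurable)
  then show ?thesis by (simp add: L2_norm_on_def)
qed

lemma AE_lborel_interval_ex:
  fixes a b :: real
  assumes "AE s in lborel. P s" "a < b"
  obtains s where "a < s" "s < b" "P s"
proof -
  have "\<exists>s\<in>{a<..<b}. P s"
  proof (rule ccontr)
    assume "\<not> ?thesis"
    then have "AE s in lborel. s \<notin> {a<..<b}" using assms(1) by (auto elim!: eventually_mono)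
    then have "{a<..<b} \<in> null_sets lborel" by (simp add: AE_iff_null_sets)
    then show False using assms(2) by (simp add: null_sets_def emeasure_lborel_Ioo)
  qed
  then show ?thesis using that by auto
qed

text \<open>
  Two representatives agree at almost every time, hence at times arbitrarily close to \<open>t\<close> inside \<open>[0, T]\<close>, and
  continuity in \<open>L\<^sup>2\<close> carries the agreement over to \<open>t\<close>. This includes the end points.
\<close>

lemma cont_time_rep_unique:
  assumes \<Omega>: "open \<Omega>" and T: "T > 0" and \<Phi>: "cont_time_rep T \<Omega> f \<Phi>" and \<Psi>: "cont_time_rep T \<Omega> f \<Psi>"
    and t: "t \<in> {0..T}"
  shows "AE x in lebesgue_on \<Omega>. \<Phi> t x = \<Psi> t x"
proof -
  let ?n = "L2_norm_on \<Omega>"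
  have L2: "\<Phi> s \<in> L2 \<Omega>" "\<Psi> s \<in> L2 \<Omega>" if "s \<in> {0..T}" for s
    using \<Phi> \<Psi> that by (auto simp: cont_time_rep_def)
  define \<delta> where "\<delta> = (?n (\<lambda>x. \<Phi> t x - \<Psi> t x))\<^sup>2"
  have "AE s in lebesgue_on {0<..<T}. AE x in lebesgue_on \<Omega>. \<Phi> s x = \<Psi> s x"
  proof -
    have "AE s in lebesgue_on {0<..<T}. AE x in lebesgue_on \<Omega>. \<Phi> s x = f (s, x)"
      "AE s in lebesgue_on {0<..<T}. AE x in lebesgue_on \<Omega>. \<Psi> s x = f (s, x)"
      using \<Phi> \<Psi> by (auto simp: cont_time_rep_def)
    then show ?thesis
    proof eventually_elim
      case (elim s)
      from elim(1) elim(2) show ?case by eventually_elim simp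
    qed
  qed
  then have ae: "AE s in lborel. s \<in> {0<..<T} \<longrightarrow> (AE x in lebesgue_on \<Omega>. \<Phi> s x = \<Psi> s x)"
    by (simp add: AE_lebesgue_on_open)
  have "\<delta> \<le> 0 + \<epsilon>" if \<epsilon>: "\<epsilon> > 0" for \<epsilon> :: real
  proof -
    have "((\<lambda>s. ?n (\<lambda>x. \<Phi> s x - \<Phi> t x)) \<longlongrightarrow> 0) (at t within {0..T})"
      "((\<lambda>s. ?n (\<lambda>x. \<Psi> s x - \<Psi> t x)) \<longlongrightarrow> 0) (at t within {0..T})"
      using \<Phi> \<Psi> t unfolding cont_time_rep_def by blast+
    then have "\<forall>\<^sub>F s in at t within {0..T}. dist (?n (\<lambda>x. \<Phi> s x - \<Phi> t x)) 0 < sqrt (\<epsilon> / 4)"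
      "\<forall>\<^sub>F s in at t within {0..T}. dist (?n (\<lambda>x. \<Psi> s x - \<Psi> t x)) 0 < sqrt (\<epsilon> / 4)"
      using \<epsilon> by (auto dest!: tendstoD[where e="sqrt (\<epsilon> / 4)"])
    then have "\<forall>\<^sub>F s in at t within {0..T}. (?n (\<lambda>x. \<Phi> s x - \<Phi> t x))\<^sup>2 \<le> \<epsilon> / 4 \<and> (?n (\<lambda>x. \<Psi> s x - \<Psi> t x))\<^sup>2 \<le> \<epsilon> / 4"
    proof eventually_elim
      case (elim s)
      have "a\<^sup>2 \<le> \<epsilon> / 4" if "dist a 0 < sqrt (\<epsilon> / 4)" for a
        using power_mono[of "\<bar>a\<bar>" "sqrt (\<epsilon> / 4)" 2] that \<epsilon> by simp
      with elim show ?case by blast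
    qed
    then obtain r where r: "r > 0" "\<And>s. s \<in> {0..T} \<Longrightarrow> s \<noteq> t \<Longrightarrow> dist s t < r \<Longrightarrow>
        (?n (\<lambda>x. \<Phi> s x - \<Phi> t x))\<^sup>2 \<le> \<epsilon> / 4 \<and> (?n (\<lambda>x. \<Psi> s x - \<Psi> t x))\<^sup>2 \<le> \<epsilon> / 4"
      unfolding eventually_at by blast
    obtain a b where ab: "a < b" "0 \<le> a" "b \<le> T" "\<And>s. a < s \<Longrightarrow> s < b \<Longrightarrow> s \<noteq> t \<and> dist s t < r"
    proof (cases "t < T")
      case True
      show ?thesis by (rule that[of t "min T (t + r)"]) (use True t r(1) in \<open>auto simp: dist_real_def\<close>)
    next
      case False
      show ?thesis by (rule that[of "max 0 (t - r)" t]) (use False t r(1) T in \<open>auto simp: dist_real_def\<close>)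
    qed
    obtain s where s: "a < s" "s < b" "AE x in lebesgue_on \<Omega>. \<Phi> s x = \<Psi> s x"
      using AE_lborel_interval_ex[OF ae ab(1)] ab(2,3)
      by (metis greaterThanLessThan_iff order_le_less_trans order_less_le_trans)
    have sT: "s \<in> {0..T}" using s ab by auto
    have n: "(?n (\<lambda>x. \<Phi> s x - \<Phi> t x))\<^sup>2 \<le> \<epsilon> / 4" "(?n (\<lambda>x. \<Psi> s x - \<Psi> t x))\<^sup>2 \<le> \<epsilon> / 4"
      using r(2)[OF sT] ab(4)[OF s(1,2)] by auto
    have "?n (\<lambda>x. \<Phi> t x - \<Psi> t x) = ?n (\<lambda>x. (\<Phi> t x - \<Phi> s x) + (\<Psi> s x - \<Psi> t x))"
    proof (rule L2_norm_on_cong_AE)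
      show "AE x in lebesgue_on \<Omega>. \<Phi> t x - \<Psi> t x = (\<Phi> t x - \<Phi> s x) + (\<Psi> s x - \<Psi> t x)"
        using s(3) by eventually_elim simp
    qed (intro L2_add L2_diff L2 sT t)+
    then have "\<delta> \<le> 2 * (?n (\<lambda>x. \<Phi> t x - \<Phi> s x))\<^sup>2 + 2 * (?n (\<lambda>x. \<Psi> s x - \<Psi> t x))\<^sup>2"
      unfolding \<delta>_def using L2_norm_on_add_sq[OF L2_diff[OF L2(1)[OF t] L2(1)[OF sT]] L2_diff[OF L2(2)[OF sT] L2(2)[OF t]]]
      by simp
    also have "\<dots> \<le> \<epsilon>"
      using n L2_norm_on_minus[of \<Omega> "\<Phi> t" "\<Phi> s"] by simp
    finally show ?thesis by simp
  qed
  then have "\<delta> \<le> 0" by (rule field_le_epsilon)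
  then have "(LINT x|lebesgue_on \<Omega>. (norm (\<Phi> t x - \<Psi> t x))\<^sup>2) = 0"
    unfolding \<delta>_def L2_norm_on_sq by (intro antisym) (auto intro!: integral_nonneg_AE)
  moreover have i: "integrable (lebesgue_on \<Omega>) (\<lambda>x. (norm (\<Phi> t x - \<Psi> t x))\<^sup>2)"
    using L2D[OF L2_diff[OF L2[OF t]]] by simp
  ultimately have "AE x in lebesgue_on \<Omega>. (norm (\<Phi> t x - \<Psi> t x))\<^sup>2 = 0"
    using integral_nonneg_eq_0_iff_AE[OF i] by simp
  then show ?thesis by eventually_elim simp
qed

lemma cont_time_rep_diff:
  assumes \<Phi>: "cont_time_rep T \<Omega> f \<Phi>" and \<Psi>: "cont_time_rep T \<Omega> g \<Psi>"
  shows "cont_time_rep T \<Omega> (\<lambda>z. f z - g z) (\<lambda>t x. \<Phi> t x - \<Psi> t x)"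
  unfolding cont_time_rep_def
proof (intro conjI ballI)
  let ?n = "L2_norm_on \<Omega>"
  have L2: "\<Phi> s \<in> L2 \<Omega>" "\<Psi> s \<in> L2 \<Omega>" if "s \<in> {0..T}" for s
    using \<Phi> \<Psi> that by (auto simp: cont_time_rep_def)
  show "(\<lambda>x. \<Phi> t x - \<Psi> t x) \<in> L2 \<Omega>" if "t \<in> {0..T}" for t
    by (rule L2_diff[OF L2[OF that]])
  show "((\<lambda>s. ?n (\<lambda>x. \<Phi> s x - \<Psi> s x - (\<Phi> t x - \<Psi> t x))) \<longlongrightarrow> 0) (at t within {0..T})" if t: "t \<in> {0..T}" for t
  proof (rule tendsto_sandwich)
    show "((\<lambda>s. 0) \<longlongrightarrow> (0::real)) (at t within {0..T})" by simp
    let ?b = "\<lambda>s. sqrt (2 * (?n (\<lambda>x. \<Phi> s x - \<Phi> t x))\<^sup>2 + 2 * (?n (\<lambda>x. \<Psi> s x - \<Psi> t x))\<^sup>2)"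
    have "(?b \<longlongrightarrow> sqrt (2 * 0\<^sup>2 + 2 * 0\<^sup>2)) (at t within {0..T})"
      using \<Phi> \<Psi> t unfolding cont_time_rep_def by (intro tendsto_intros) auto
    then show "(?b \<longlongrightarrow> 0) (at t within {0..T})" by simp
    show "\<forall>\<^sub>F s in at t within {0..T}. 0 \<le> ?n (\<lambda>x. \<Phi> s x - \<Psi> s x - (\<Phi> t x - \<Psi> t x))"
      by (simp add: L2_norm_on_nonneg)
    have "?n (\<lambda>x. \<Phi> s x - \<Psi> s x - (\<Phi> t x - \<Psi> t x)) \<le> ?b s" if s: "s \<in> {0..T}" for s
    proof (rule real_le_rsqrt)
      have eq: "(\<lambda>x. \<Phi> s x - \<Psi> s x - (\<Phi> t x - \<Psi> t x)) = (\<lambda>x. (\<Phi> s x - \<Phi> t x) + (\<Psi> t x - \<Psi> s x))" by auto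
      show "(?n (\<lambda>x. \<Phi> s x - \<Psi> s x - (\<Phi> t x - \<Psi> t x)))\<^sup>2 \<le> 2 * (?n (\<lambda>x. \<Phi> s x - \<Phi> t x))\<^sup>2 + 2 * (?n (\<lambda>x. \<Psi> s x - \<Psi> t x))\<^sup>2"
        unfolding eq L2_norm_on_minus[of \<Omega> "\<Psi> s" "\<Psi> t"]
        by (rule L2_norm_on_add_sq) (intro L2_diff L2 s t)+
    qed
    then show "\<forall>\<^sub>F s in at t within {0..T}. ?n (\<lambda>x. \<Phi> s x - \<Psi> s x - (\<Phi> t x - \<Psi> t x)) \<le> ?b s"
      unfolding eventually_at_filter by (auto intro!: always_eventually)
  qed
  have "AE t in lebesgue_on {0<..<T}. AE x in lebesgue_on \<Omega>. \<Phi> t x = f (t, x)"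
    "AE t in lebesgue_on {0<..<T}. AE x in lebesgue_on \<Omega>. \<Psi> t x = g (t, x)"
    using \<Phi> \<Psi> by (auto simp: cont_time_rep_def)
  then show "AE t in lebesgue_on {0<..<T}. AE x in lebesgue_on \<Omega>. \<Phi> t x - \<Psi> t x = f (t, x) - g (t, x)"
  proof eventually_elim
    case (elim t)
    from elim(1) elim(2) show ?case by eventually_elim simp
  qed
qed

lemma weak_time_deriv_energy:
  fixes w g :: "real \<times> (real^'n) \<Rightarrow> real"
  assumes \<Omega>: "open \<Omega>" and T: "T > 0" and w: "w \<in> L2 (cyl T \<Omega>)" and g: "g \<in> L2 (cyl T \<Omega>)"
    and weak: "has_weak_time_deriv (cyl T \<Omega>) w g"
  obtains \<Phi> where "cont_time_rep T \<Omega> w \<Phi>"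
    "(L2_norm_on \<Omega> (\<Phi> T))\<^sup>2 - (L2_norm_on \<Omega> (\<Phi> 0))\<^sup>2 = 2 * (LINT z|lebesgue_on (cyl T \<Omega>). w z * g z)"
proof -
  let ?\<Xi> = "cyl T \<Omega>" and ?I = "{0<..<T} :: real set"
  note \<Xi> = open_cyl[OF \<Omega>, of T]
  obtain w0 where w0: "borel_rep ?\<Xi> w w0" using borel_rep_exists[OF \<Xi> w] .
  obtain g0 where g0: "borel_rep ?\<Xi> g g0" using borel_rep_exists[OF \<Xi> g] .
  have weak0: "(LBINT z. w0 z * (dir_deriv 1 \<eta> (fst z) * \<psi> (snd z))) = - (LBINT z. g0 z * (\<eta> (fst z) * \<psi> (snd z)))"
    if \<eta>: "\<eta> \<in> test_fun ?I" and \<psi>: "\<psi> \<in> test_fun \<Omega>" for \<eta> \<psi>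
  proof -
    define \<phi> where "\<phi> z = \<eta> (fst z) * \<psi> (snd z)" for z
    have \<phi>: "\<phi> \<in> test_fun ?\<Xi>" unfolding cyl_def \<phi>_def[abs_def] by (rule test_fun_times[OF \<eta> \<psi>])
    note D = test_fun_dir_deriv[OF \<phi>, of "(1, 0)"]
    have d: "dir_deriv (1, 0) \<phi> z = dir_deriv 1 \<eta> (fst z) * \<psi> (snd z)" for z
      unfolding \<phi>_def[abs_def] dir_deriv_times[OF \<eta> \<psi>] by (simp add: dir_deriv_0[OF \<psi>])
    have "(LBINT z. w0 z * dir_deriv (1, 0) \<phi> z) = (LINT z|lebesgue_on ?\<Xi>. w z * dir_deriv (1, 0) \<phi> z)"
      using integral_L2_mult_rep[OF \<Xi> w w0 test_fun_L2[OF \<Xi> D] test_fun_borel[OF D]] by simp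
    also have "\<dots> = - (LINT z|lebesgue_on ?\<Xi>. g z * \<phi> z)"
      using weak \<phi> by (auto simp: has_weak_time_deriv_def has_weak_dir_deriv_def)
    also have "(LINT z|lebesgue_on ?\<Xi>. g z * \<phi> z) = (LBINT z. g0 z * \<phi> z)"
      using integral_L2_mult_rep[OF \<Xi> g g0 test_fun_L2[OF \<Xi> \<phi>] test_fun_borel[OF \<phi>]] by simp
    finally show ?thesis unfolding d unfolding \<phi>_def .
  qed
  obtain W where Wm: "\<And>t. W t \<in> borel_measurable borel" and Wz: "\<And>t x. x \<notin> \<Omega> \<Longrightarrow> W t x = 0"
    and W2: "\<And>t. integrable lborel (\<lambda>x. (W t x)\<^sup>2)"
    and lip: "\<And>s t. 0 \<le> s \<Longrightarrow> s \<le> t \<Longrightarrow> t \<le> T \<Longrightarrow> (LBINT x. (W t x - W s x)\<^sup>2) \<le> (t - s) * (LBINT z. (g0 z)\<^sup>2)"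
    and Wae: "AE z in lborel. z \<in> ?I \<times> \<Omega> \<longrightarrow> w0 z = W (fst z) (snd z)"
    and energy: "(LBINT x. (W T x)\<^sup>2) - (LBINT x. (W 0 x)\<^sup>2) = 2 * (LBINT z. w0 z * g0 z)"
  proof (rule continuous_time_representative[OF \<Omega> T, of w0 g0])
    show "w0 z = 0" "g0 z = 0" if "z \<notin> ?I \<times> \<Omega>" for z
      using borel_repD(2)[OF w0] borel_repD(2)[OF g0] that by (auto simp: cyl_def)
    show "integrable lborel (\<lambda>z. (w0 z)\<^sup>2)" "integrable lborel (\<lambda>z. (g0 z)\<^sup>2)"
      using borel_repD(3)[OF w0] borel_repD(3)[OF g0] by simp_all
  qed (use borel_repD(1)[OF w0] borel_repD(1)[OF g0] weak0 that in blast)+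
  have L2: "W t \<in> L2 \<Omega>" for t by (rule L2I_borel[OF \<Omega> Wm]) (use W2 in simp)
  have norm_W: "(L2_norm_on \<Omega> (\<lambda>x. W t x - W s x))\<^sup>2 = (LBINT x. (W t x - W s x)\<^sup>2)" for s t
    unfolding L2_norm_on_sq
  proof (rule integral_lebesgue_on_rep(1)[OF \<Omega>])
    show "(\<lambda>x. (norm (W t x - W s x))\<^sup>2) \<in> borel_measurable (lebesgue_on \<Omega>)"
      using L2D(1)[OF L2[of t]] L2D(1)[OF L2[of s]] by measurable
    show "(\<lambda>x. (W t x - W s x)\<^sup>2) \<in> borel_measurable borel" using Wm[of t] Wm[of s] by measurable
  qed (simp_all add: Wz)
  have norm_W': "(L2_norm_on \<Omega> (W t))\<^sup>2 = (LBINT x. (W t x)\<^sup>2)" for t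
    unfolding L2_norm_on_sq
  proof (rule integral_lebesgue_on_rep(1)[OF \<Omega>])
    show "(\<lambda>x. (norm (W t x))\<^sup>2) \<in> borel_measurable (lebesgue_on \<Omega>)"
      using L2D(1)[OF L2[of t]] by measurable
    show "(\<lambda>x. (W t x)\<^sup>2) \<in> borel_measurable borel" using Wm[of t] by measurable
  qed (simp_all add: Wz)
  define c where "c = (LBINT z. (g0 z)\<^sup>2)"
  have lip': "L2_norm_on \<Omega> (\<lambda>x. W s x - W t x) \<le> sqrt (\<bar>s - t\<bar> * c)" if "s \<in> {0..T}" "t \<in> {0..T}" for s t
  proof (rule real_le_rsqrt)
    show "(L2_norm_on \<Omega> (\<lambda>x. W s x - W t x))\<^sup>2 \<le> \<bar>s - t\<bar> * c"
    proof (cases "t \<le> s")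
      case True
      then show ?thesis using lip[of t s] that by (simp add: norm_W c_def)
    next
      case False
      then show ?thesis using lip[of s t] that L2_norm_on_minus[of \<Omega> "W s" "W t"] by (simp add: norm_W c_def)
    qed
  qed
  have "cont_time_rep T \<Omega> w W"
    unfolding cont_time_rep_def
  proof (intro conjI ballI L2)
    fix t assume t: "t \<in> {0..T}"
    show "((\<lambda>s. L2_norm_on \<Omega> (\<lambda>x. W s x - W t x)) \<longlongrightarrow> 0) (at t within {0..T})"
    proof (rule tendsto_sandwich)
      show "((\<lambda>s. 0) \<longlongrightarrow> (0::real)) (at t within {0..T})" by simp
      have "((\<lambda>s. sqrt (\<bar>s - t\<bar> * c)) \<longlongrightarrow> sqrt (\<bar>t - t\<bar> * c)) (at t within {0..T})"
        by (intro tendsto_intros)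
      then show "((\<lambda>s. sqrt (\<bar>s - t\<bar> * c)) \<longlongrightarrow> 0) (at t within {0..T})" by simp
      show "\<forall>\<^sub>F s in at t within {0..T}. 0 \<le> L2_norm_on \<Omega> (\<lambda>x. W s x - W t x)"
        by (simp add: L2_norm_on_nonneg)
      show "\<forall>\<^sub>F s in at t within {0..T}. L2_norm_on \<Omega> (\<lambda>x. W s x - W t x) \<le> sqrt (\<bar>s - t\<bar> * c)"
        unfolding eventually_at_filter using lip' t by (auto intro!: always_eventually)
    qed
  next
    have "AE z in lborel. z \<in> ?I \<times> \<Omega> \<longrightarrow> W (fst z) (snd z) = w z"
      using Wae borel_repD(4)[OF w0] by eventually_elim (auto simp: cyl_def)
    from AE_lborel_fst_snd[OF this]
    have "AE t in lborel. t \<in> ?I \<longrightarrow> (AE x in lborel. x \<in> \<Omega> \<longrightarrow> W t x = w (t, x))"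
    proof eventually_elim
      case (elim t)
      show ?case
      proof
        assume "t \<in> ?I"
        with elim show "AE x in lborel. x \<in> \<Omega> \<longrightarrow> W t x = w (t, x)" by (auto elim!: eventually_mono)
      qed
    qed
    then show "AE t in lebesgue_on ?I. AE x in lebesgue_on \<Omega>. W t x = w (t, x)"
      by (simp add: AE_lebesgue_on_open \<Omega>)
  qed
  moreover have "(L2_norm_on \<Omega> (W T))\<^sup>2 - (L2_norm_on \<Omega> (W 0))\<^sup>2 = 2 * (LINT z|lebesgue_on ?\<Xi>. w z * g z)"
    using energy integral_L2_mult_rep[OF \<Xi> w w0 g borel_repD(1)[OF g0] borel_repD(4)[OF g0]]
    by (simp add: norm_W')
  ultimately show ?thesis by (rule that)
qed

lemma cont_time_rep_time_value:
  assumes "open \<Omega>" "T > 0" "w \<in> H10 (cyl T \<Omega>)"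
  shows "cont_time_rep T \<Omega> w (time_value T \<Omega> w)"
proof -
  have "w \<in> L2 (cyl T \<Omega>)" using assms(3) by (auto simp: H10_def)
  then obtain \<Phi> where "cont_time_rep T \<Omega> w \<Phi>"
    using weak_time_deriv_energy[OF assms(1,2) _ time_deriv_spec[OF assms(3)]] by blast
  then show ?thesis unfolding time_value_def by (rule someI[of "cont_time_rep T \<Omega> w"])
qed

text \<open>
  The selected values coincide with those of the representative constructed above, by uniqueness.
\<close>

lemma time_value_energy:
  assumes \<Omega>: "open \<Omega>" and T: "T > 0" and w: "w \<in> H10 (cyl T \<Omega>)"
  shows "(L2_norm_on \<Omega> (time_value T \<Omega> w T))\<^sup>2 - (L2_norm_on \<Omega> (time_value T \<Omega> w 0))\<^sup>2
    = 2 * (LINT z|lebesgue_on (cyl T \<Omega>). w z * time_deriv (cyl T \<Omega>) w z)"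
proof -
  have "w \<in> L2 (cyl T \<Omega>)" using w by (auto simp: H10_def)
  then obtain \<Phi> where \<Phi>: "cont_time_rep T \<Omega> w \<Phi>"
    "(L2_norm_on \<Omega> (\<Phi> T))\<^sup>2 - (L2_norm_on \<Omega> (\<Phi> 0))\<^sup>2 = 2 * (LINT z|lebesgue_on (cyl T \<Omega>). w z * time_deriv (cyl T \<Omega>) w z)"
    using weak_time_deriv_energy[OF \<Omega> T _ time_deriv_spec[OF w]] by blast
  note V = cont_time_rep_time_value[OF \<Omega> T w]
  have "L2_norm_on \<Omega> (time_value T \<Omega> w t) = L2_norm_on \<Omega> (\<Phi> t)" if "t \<in> {0..T}" for t
    by (rule L2_norm_on_cong_AE[OF _ _ cont_time_rep_unique[OF \<Omega> T V \<Phi>(1) that]])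
       (use V \<Phi>(1) that in \<open>auto simp: cont_time_rep_def\<close>)
  with \<Phi>(2) T show ?thesis by simp
qed


section \<open>The error identity\<close>

theorem theorem3p4:
  fixes \<Omega> :: "(real^'n) set" and T :: real and \<Xi> :: "(real \<times> (real^'n)) set"
    and f u u' :: "real \<times> (real^'n) \<Rightarrow> real" and p p' :: "real \<times> (real^'n) \<Rightarrow> real^'n"
    and u\<^sub>0 :: "real^'n \<Rightarrow> real"
  assumes "open \<Omega>" and "connected \<Omega>" and "\<Omega> \<noteq> {}" and "T > 0"
    and "\<Xi> = cyl T \<Omega>"
    and "f \<in> L2 \<Xi>" and "u\<^sub>0 \<in> H1_ring \<Omega>"
    and "exact_solution T \<Omega> f u\<^sub>0 u p"
    and "u' \<in> H11_ring T \<Omega>" and "p' \<in> Ddiv \<Xi>"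
  shows "(H01_norm \<Xi> (\<lambda>z. u z - u' z))\<^sup>2
       + (L2_norm_on \<Xi> (\<lambda>z. p z - p' z))\<^sup>2
       + (L2_norm_on \<Xi> (\<lambda>z. time_deriv \<Xi> (\<lambda>y. u y - u' y) z + space_div \<Xi> (\<lambda>y. p' y - p y) z))\<^sup>2
       + (L2_norm_on \<Omega> (time_value T \<Omega> (\<lambda>z. u z - u' z) T))\<^sup>2
       = (L2_norm_on \<Xi> (\<lambda>z. f z - time_deriv \<Xi> u' z - u' z + space_div \<Xi> p' z))\<^sup>2
       + (L2_norm_on \<Xi> (\<lambda>z. p' z - space_grad \<Xi> u' z))\<^sup>2
       + (L2_norm_on \<Omega> (\<lambda>x. u\<^sub>0 x - time_value T \<Omega> u' 0 x))\<^sup>2"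
proof -
  note \<Omega> = \<open>open \<Omega>\<close> and T = \<open>T > 0\<close>
  have \<Xi>_def: "\<Xi> = cyl T \<Omega>" by fact
  have \<Xi>: "open \<Xi>" unfolding \<Xi>_def by (rule open_cyl[OF \<Omega>])
  let ?M = "lebesgue_on \<Xi>"
  have ex: "u \<in> H11_ring T \<Omega>" "p \<in> Ddiv \<Xi>"
    and grad_u: "AE z in ?M. - space_grad \<Xi> u z + p z = 0"
    and evol: "AE z in ?M. time_deriv \<Xi> u z - space_div \<Xi> p z + u z = f z"
    and init: "AE x in lebesgue_on \<Omega>. time_value T \<Omega> u 0 x = u\<^sub>0 x"
    using \<open>exact_solution T \<Omega> f u\<^sub>0 u p\<close> unfolding exact_solution_def \<Xi>_def
    by - (elim conjE, assumption)+
  have u: "u \<in> H01_ring T \<Omega>" "u \<in> H10 \<Xi>" "u \<in> H01 \<Xi>" "u \<in> L2 \<Xi>"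
    and u': "u' \<in> H01_ring T \<Omega>" "u' \<in> H10 \<Xi>" "u' \<in> H01 \<Xi>" "u' \<in> L2 \<Xi>"
    using ex(1) \<open>u' \<in> H11_ring T \<Omega>\<close> by (auto simp: H11_ring_def H01_ring_def H10_def \<Xi>_def)
  have p: "p \<in> Ddiv \<Xi>" "p \<in> L2 \<Xi>" and p': "p' \<in> Ddiv \<Xi>" "p' \<in> L2 \<Xi>"
    using ex(2) \<open>p' \<in> Ddiv \<Xi>\<close> by (auto simp: Ddiv_def)
  define w where "w z = u z - u' z" for z
  define s where "s z = space_grad \<Xi> u z - space_grad \<Xi> u' z" for z
  define r where "r z = p z - p' z" for z
  define d where "d z = space_div \<Xi> p z - space_div \<Xi> p' z" for z
  define g where "g = time_deriv \<Xi> w"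
  define a where "a z = g z - d z" for z
  have w: "w \<in> H10 \<Xi>" "w \<in> L2 \<Xi>"
    using time_deriv_diff(1)[OF \<Xi> u(2) u'(2)] by (auto simp: w_def[abs_def] H10_def)
  have L2: "s \<in> L2 \<Xi>" "r \<in> L2 \<Xi>" "d \<in> L2 \<Xi>" "g \<in> L2 \<Xi>"
    unfolding s_def[abs_def] r_def[abs_def] d_def[abs_def] g_def
    by (intro L2_diff space_grad_spec(1) space_div_spec(1) time_deriv_spec(1) u u' p p' w)+
  have aL2: "a \<in> L2 \<Xi>" unfolding a_def[abs_def] by (intro L2_diff L2)
  have div_eq: "AE z in ?M. space_div \<Xi> (\<lambda>y. p' y - p y) z = - d z"
    using space_div_diff[OF \<Xi> p'(1) p(1)] by eventually_elim (simp add: d_def)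
  have g_eq: "AE z in ?M. g z = time_deriv \<Xi> u z - time_deriv \<Xi> u' z"
    using time_deriv_diff(2)[OF \<Xi> u(2) u'(2)] by (simp add: g_def w_def[abs_def])
  have s_eq: "AE z in ?M. space_grad \<Xi> w z = s z"
    using space_grad_diff(2)[OF \<Xi> u(3) u'(3)] by (simp add: s_def w_def[abs_def])
  have pdiff: "(\<lambda>y. p' y - p y) \<in> Ddiv \<Xi>"
  proof -
    have "has_weak_space_div \<Xi> (\<lambda>y. p' y - p y) (\<lambda>z. space_div \<Xi> p' z - space_div \<Xi> p z)"
      by (intro weak_space_div_diff \<Xi> p p' space_div_spec)
    moreover have "(\<lambda>z. space_div \<Xi> p' z - space_div \<Xi> p z) \<in> L2 \<Xi>"
      by (intro L2_diff space_div_spec(1) p p')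
    ultimately show ?thesis using L2_diff[OF p'(2) p(2)] by (auto simp: Ddiv_def)
  qed
  have wH01: "w \<in> H01 \<Xi>" using space_grad_diff(1)[OF \<Xi> u(3) u'(3)] by (simp add: w_def[abs_def])

  \<comment> \<open>Green's formula is applied to \<open>u\<close> and \<open>u'\<close> separately, since \<open>H01_ring\<close> is known to contain each of them.\<close>
  have Green: "(LINT z|?M. d z * w z) + (LINT z|?M. r z \<bullet> s z) = 0"
  proof -
    note rd = weak_space_div_diff[OF \<Xi> p(2) p'(2) space_div_spec(1)[OF p(1)] space_div_spec(1)[OF p'(1)]
        space_div_spec(2)[OF p(1)] space_div_spec(2)[OF p'(1)], folded r_def d_def]
    have G: "(LINT z|?M. d z * v z + r z \<bullet> space_grad \<Xi> v z) = 0"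
      and Gi: "integrable ?M (\<lambda>z. d z * v z)" "integrable ?M (\<lambda>z. r z \<bullet> space_grad \<Xi> v z)"
      if v: "v \<in> H01_ring T \<Omega>" "v \<in> H01 \<Xi>" for v
    proof -
      show "(LINT z|?M. d z * v z + r z \<bullet> space_grad \<Xi> v z) = 0"
        using Green_cylinder[OF \<Omega> T v(1)] space_grad_spec[OF v(2)] L2 rd unfolding \<Xi>_def by blast
      have vL2: "v \<in> L2 \<Xi>" using v(2) by (auto simp: H01_def)
      show "integrable ?M (\<lambda>z. d z * v z)" by (rule L2_integrable_mult[OF L2(3) vL2])
      show "integrable ?M (\<lambda>z. r z \<bullet> space_grad \<Xi> v z)"
        by (intro integral_inner_le(1) L2D L2 space_grad_spec(1) v)
    qed
    have "(LINT z|?M. d z * w z) + (LINT z|?M. r z \<bullet> s z)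
        = (LINT z|?M. d z * u z + r z \<bullet> space_grad \<Xi> u z) - (LINT z|?M. d z * u' z + r z \<bullet> space_grad \<Xi> u' z)"
      using Gi[OF u(1,3)] Gi[OF u'(1,3)] by (simp add: w_def s_def right_diff_distrib inner_diff_right)
    then show ?thesis using G[OF u(1,3)] G[OF u'(1,3)] by simp
  qed
  have energy: "(L2_norm_on \<Omega> (time_value T \<Omega> w T))\<^sup>2 - (L2_norm_on \<Omega> (time_value T \<Omega> w 0))\<^sup>2 = 2 * (LINT z|?M. w z * g z)"
    using time_value_energy[OF \<Omega> T] w(1) by (simp add: \<Xi>_def g_def)

  have lhs1: "(H01_norm \<Xi> (\<lambda>z. u z - u' z))\<^sup>2 = (LINT z|?M. (norm (w z))\<^sup>2) + (LINT z|?M. (norm (s z))\<^sup>2)"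
    using L2_norm_on_cong_AE[OF space_grad_spec(1)[OF wH01] L2(1) s_eq]
    unfolding H01_norm_def w_def[abs_def, symmetric] by (simp add: L2_norm_on_sq)
  have lhs2: "(L2_norm_on \<Xi> (\<lambda>z. p z - p' z))\<^sup>2 = (LINT z|?M. (norm (r z))\<^sup>2)"
    unfolding L2_norm_on_sq r_def ..
  have lhs3: "(L2_norm_on \<Xi> (\<lambda>z. time_deriv \<Xi> (\<lambda>y. u y - u' y) z + space_div \<Xi> (\<lambda>y. p' y - p y) z))\<^sup>2
      = (LINT z|?M. (norm (a z))\<^sup>2)"
  proof -
    have "L2_norm_on \<Xi> (\<lambda>z. g z + space_div \<Xi> (\<lambda>y. p' y - p y) z) = L2_norm_on \<Xi> a"
    proof (rule L2_norm_on_cong_AE[OF _ aL2])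
      show "AE z in ?M. g z + space_div \<Xi> (\<lambda>y. p' y - p y) z = a z"
        using div_eq by eventually_elim (simp add: a_def)
    qed (intro L2_add L2 space_div_spec(1) pdiff)
    then show ?thesis by (simp add: g_def w_def[abs_def] L2_norm_on_sq)
  qed
  have rhs1: "(L2_norm_on \<Xi> (\<lambda>z. f z - time_deriv \<Xi> u' z - u' z + space_div \<Xi> p' z))\<^sup>2
      = (LINT z|?M. (norm (a z + w z))\<^sup>2)"
  proof -
    have "L2_norm_on \<Xi> (\<lambda>z. f z - time_deriv \<Xi> u' z - u' z + space_div \<Xi> p' z) = L2_norm_on \<Xi> (\<lambda>z. a z + w z)"
    proof (rule L2_norm_on_cong_AE)
      show "AE z in ?M. f z - time_deriv \<Xi> u' z - u' z + space_div \<Xi> p' z = a z + w z"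
        using evol g_eq by eventually_elim (simp add: a_def d_def w_def)
    qed (intro L2_add L2_diff aL2 w \<open>f \<in> L2 \<Xi>\<close> u' time_deriv_spec(1) space_div_spec(1) p')+
    then show ?thesis by (simp add: L2_norm_on_sq)
  qed
  have rhs2: "(L2_norm_on \<Xi> (\<lambda>z. p' z - space_grad \<Xi> u' z))\<^sup>2 = (LINT z|?M. (norm (s z - r z))\<^sup>2)"
  proof -
    have "L2_norm_on \<Xi> (\<lambda>z. p' z - space_grad \<Xi> u' z) = L2_norm_on \<Xi> (\<lambda>z. s z - r z)"
    proof (rule L2_norm_on_cong_AE)
      show "AE z in ?M. p' z - space_grad \<Xi> u' z = s z - r z"
        using grad_u by eventually_elim (simp add: s_def r_def)
    qed (intro L2_diff L2 p' space_grad_spec(1) u')+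
    then show ?thesis by (simp add: L2_norm_on_sq)
  qed
  have rhs3: "L2_norm_on \<Omega> (\<lambda>x. u\<^sub>0 x - time_value T \<Omega> u' 0 x) = L2_norm_on \<Omega> (time_value T \<Omega> w 0)"
  proof (rule L2_norm_on_cong_AE)
    have rep: "cont_time_rep T \<Omega> v (time_value T \<Omega> v)" if "v \<in> H10 \<Xi>" for v
      using cont_time_rep_time_value[OF \<Omega> T] that by (simp add: \<Xi>_def)
    have 0: "(0::real) \<in> {0..T}" using T by simp
    have "cont_time_rep T \<Omega> w (\<lambda>t x. time_value T \<Omega> u t x - time_value T \<Omega> u' t x)"
      unfolding w_def[abs_def] by (intro cont_time_rep_diff rep u u')
    from cont_time_rep_unique[OF \<Omega> T this rep[OF w(1)] 0] init
    show "AE x in lebesgue_on \<Omega>. u\<^sub>0 x - time_value T \<Omega> u' 0 x = time_value T \<Omega> w 0 x"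
      by eventually_elim simp
    show "time_value T \<Omega> w 0 \<in> L2 \<Omega>" using rep[OF w(1)] 0 by (auto simp: cont_time_rep_def)
    have "time_value T \<Omega> u' 0 \<in> L2 \<Omega>" using rep[OF u'(2)] 0 by (auto simp: cont_time_rep_def)
    moreover have "u\<^sub>0 \<in> L2 \<Omega>" using \<open>u\<^sub>0 \<in> H1_ring \<Omega>\<close> by (auto simp: H1_ring_def H1_def)
    ultimately show "(\<lambda>x. u\<^sub>0 x - time_value T \<Omega> u' 0 x) \<in> L2 \<Omega>" by (rule L2_diff[rotated])
  qed
  note sq = L2D(2)[OF aL2] L2D(2)[OF w(2)] L2D(2)[OF L2(1)] L2D(2)[OF L2(2)]
  note i = L2_integrable_mult[OF aL2 w(2)] L2_integrable_mult[OF L2(4) w(2)] L2_integrable_mult[OF L2(3) w(2)]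
    integral_inner_le(1)[OF L2D(1)[OF L2(2)] L2D(1)[OF L2(1)] L2D(2)[OF L2(2)] L2D(2)[OF L2(1)]]
  have "(LINT z|?M. (norm (a z + w z))\<^sup>2) = (LINT z|?M. (norm (a z))\<^sup>2 + (norm (w z))\<^sup>2 + 2 * (a z * w z))"
    by (simp add: power2_sum mult_ac)
  also have "\<dots> = (LINT z|?M. (norm (a z))\<^sup>2) + (LINT z|?M. (norm (w z))\<^sup>2) + 2 * (LINT z|?M. a z * w z)"
    using sq i by simp
  also have "(LINT z|?M. a z * w z) = (LINT z|?M. w z * g z) - (LINT z|?M. d z * w z)"
    using i(2,3) by (simp add: a_def left_diff_distrib mult.commute[of "w _" "g _"])
  finally have A: "(LINT z|?M. (norm (a z + w z))\<^sup>2) = (LINT z|?M. (norm (a z))\<^sup>2) + (LINT z|?M. (norm (w z))\<^sup>2)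
      + 2 * ((LINT z|?M. w z * g z) - (LINT z|?M. d z * w z))" .
  have "(LINT z|?M. (norm (s z - r z))\<^sup>2) = (LINT z|?M. (norm (s z))\<^sup>2 + (norm (r z))\<^sup>2 - 2 * (r z \<bullet> s z))"
    by (simp add: power2_norm_eq_inner inner_diff_left inner_diff_right inner_commute algebra_simps)
  also have "\<dots> = (LINT z|?M. (norm (s z))\<^sup>2) + (LINT z|?M. (norm (r z))\<^sup>2) - 2 * (LINT z|?M. r z \<bullet> s z)"
    using sq i by simp
  finally have B: "(LINT z|?M. (norm (s z - r z))\<^sup>2) = (LINT z|?M. (norm (s z))\<^sup>2) + (LINT z|?M. (norm (r z))\<^sup>2)
      - 2 * (LINT z|?M. r z \<bullet> s z)" .
  show ?thesis
    unfolding lhs1 lhs2 lhs3 rhs1 rhs2 rhs3 A B unfolding w_def[abs_def, symmetric]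
    using Green energy by (simp add: algebra_simps)
qed


end
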